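(* Any disc triangulation with $V$ vertices in total, $n$ of which are boundary vertices, and with all internal vertices of degree at least $6$, satisfies $$V \le \left\lfloor \frac{(n+3)^2}{12} \right\rfloor .$$ Equality is achieved in the Euclidean triangular lattice.
   Context: A disc triangulation is a finite graph embedded in the closed disc whose outer boundary is a simple cycle of the graph and all of whose inner faces are triangles. The vertices on the outer boundary cycle are the boundary vertices; all other vertices are internal. $\lfloor x\rfloor$ denotes the greatest integer not exceeding $x$. The Euclidean triangular lattice is the $6$-regular triangulation of the plane by equilateral triangles.
   Formalization: The floor is replaced by the nearest integer to (n+3)²/12: the two agree unless 6 divides n, where the nearest integer is larger by 1; the floor bound fails there, e.g. a vertex with its six lattice neighbours has n=6, V=7 > 6. *)

theory Defs
  imports "HOL-Analysis.Analysis"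
begin

text \<open>
  A finite simple graph embedded in the plane is given by its vertices (points) and its edges
  (images of arcs).  The ends of an edge \<open>e\<close> are the two vertices lying on it, so \<open>e \<inter> V\<close> is the
  abstract edge; the last conjunct of \<open>plane_graph\<close> excludes parallel edges, and arcs cannot be
  loops.
\<close>

definition joined_by_arc :: "complex \<Rightarrow> complex \<Rightarrow> complex set \<Rightarrow> bool" where
  "joined_by_arc u v e \<longleftrightarrow>
     (\<exists>g. arc g \<and> pathstart g = u \<and> pathfinish g = v \<and> path_image g = e)"

definition plane_graph :: "complex set \<Rightarrow> complex set set \<Rightarrow> bool" where
  "plane_graph V E \<longleftrightarrow>
     finite V \<and> finite E \<and>
     (\<forall>e\<in>E. \<exists>u v. joined_by_arc u v e \<and> e \<inter> V = {u, v}) \<and>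
     (\<forall>e\<in>E. \<forall>e'\<in>E. e \<noteq> e' \<longrightarrow> e \<inter> e' \<subseteq> V) \<and>
     (\<forall>e\<in>E. \<forall>e'\<in>E. e \<inter> V = e' \<inter> V \<longrightarrow> e = e')"

definition vertex_degree :: "complex set set \<Rightarrow> complex \<Rightarrow> nat" where
  "vertex_degree E v = card {e \<in> E. v \<in> e}"

text \<open>\<open>vs\<close> lists the vertices of the cycle in cyclic order, \<open>C\<close> is the set of its edges.\<close>

definition simple_cycle ::
    "complex set \<Rightarrow> complex set set \<Rightarrow> complex list \<Rightarrow> complex set set \<Rightarrow> bool" where
  "simple_cycle V E vs C \<longleftrightarrow>
     3 \<le> length vs \<and> distinct vs \<and> set vs \<subseteq> V \<and>
     (\<exists>es. length es = length vs \<and> set es = C \<and> C \<subseteq> E \<and>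
        (\<forall>i<length vs. es ! i \<inter> V = {vs ! i, vs ! (Suc i mod length vs)}))"

text \<open>
  \<open>D\<close> is a closed topological disc in the plane (an arbitrary one rather than the unit disc, so
  that pieces of the triangular lattice qualify as they stand).  Its topological boundary is
  \<open>frontier D\<close>, and the inner faces are the components of the complement of the graph in \<open>D\<close>.
\<close>

definition disc_triangulation ::
    "complex set \<Rightarrow> complex set \<Rightarrow> complex set set \<Rightarrow> bool" where
  "disc_triangulation D V E \<longleftrightarrow>
     D homeomorphic cball (0::complex) 1 \<and>
     plane_graph V E \<and> V \<subseteq> D \<and> \<Union>E \<subseteq> D \<and>
     (\<exists>vs C. simple_cycle V E vs C \<and> \<Union>C = frontier D) \<and>
     (\<forall>F \<in> components (D - (V \<union> \<Union>E)).
        \<exists>vs C. simple_cycle V E vs C \<and> length vs = 3 \<and> \<Union>C = frontier F)"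

definition boundary_vertices :: "complex set \<Rightarrow> complex set \<Rightarrow> complex set" where
  "boundary_vertices D V = V \<inter> frontier D"

definition internal_vertices :: "complex set \<Rightarrow> complex set \<Rightarrow> complex set" where
  "internal_vertices D V = V - frontier D"

definition triangular_lattice :: "complex set" where
  "triangular_lattice = {of_int a + of_int b * cis (pi / 3) | a b. True}"

definition triangular_lattice_edges :: "complex set set" where
  "triangular_lattice_edges =
     {closed_segment u v | u v. u \<in> triangular_lattice \<and> v \<in> triangular_lattice \<and> dist u v = 1}"

text \<open>
  The bound is the integer nearest to \<open>(n + 3)\<^sup>2 / 12\<close>.  It exceeds the floor exactly when \<open>6\<close>
  divides \<open>n\<close>, and there the floor is too small: the regular lattice hexagon of side \<open>k \<ge> 1\<close> has
  \<open>n = 6 * k\<close> boundary vertices and \<open>3 * k\<^sup>2 + 3 * k + 1\<close> vertices, all internal ones of degree \<open>6\<close>,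
  whereas the floor is \<open>3 * k\<^sup>2 + 3 * k\<close>.
\<close>

lemma round_bound_eq_floor:
  "round ((real n + 3)\<^sup>2 / 12) = \<lfloor>(real n + 3)\<^sup>2 / 12\<rfloor> + (if 6 dvd n then 1 else 0)"
proof -
  obtain k r where n: "n = 6 * k + r" "r < 6"
    by (metis mod_less_divisor mult_div_mod_eq zero_less_numeral)
  have eq: "(real n + 3)\<^sup>2 / 12 = of_int (3 * (int k)\<^sup>2 + int r * int k + 3 * int k) + (real r + 3)\<^sup>2 / 12"
    unfolding n by (simp add: power2_eq_square field_simps)
  have dvd: "6 dvd n \<longleftrightarrow> r = 0"
    using n by presburger
  have "r = 0 \<or> r = 1 \<or> r = 2 \<or> r = 3 \<or> r = 4 \<or> r = 5"
    using n by linarith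
  then show ?thesis
    unfolding round_def dvd eq add.assoc floor_add_int [symmetric]
    by (elim disjE) (simp_all add: floor_eq_iff)
qed

end

theory Submission
  imports Defs "HOL-Complex_Analysis.Contour_Integration"
begin

text \<open>
  Upper bound: for a set of vertices with \<open>E\<close> induced edges and \<open>F\<close> induced triangles let
  \<open>n = 2 E - 3 F\<close>, the length of its boundary walk.  Peeling off the vertices on the boundary walk
  of a region without holes shortens this walk by at least \<open>6\<close>, because internal degrees are at
  least \<open>6\<close>, and removes at most \<open>n\<close> vertices, so
    by induction \<open>12 (E - F) \<le> n (n + 6)\<close>.  Since
  \<open>V - E + F = 1\<close> for the whole disc, \<open>12 (V - 1) \<le> n (n + 6)\<close>.  Working with \<open>n\<close> and the Euler
  characteristic only, the peeled region may fall apart into pieces meeting at cut vertices or cut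
  edges; all that is needed is that it has no holes, which follows from Euler's formula applied
  to the plane subgraph.

  Euler's formula is obtained by adding the edges one by one: an edge joining two components of
  the graph does not separate anything (Janiszewski), an edge closing a cycle separates its two
  sides (Jordan).

  Extremal examples: lattice triangles with three corners cut off, as close to a regular hexagon
  as the boundary length permits.  Counting their points from below is enough, as the other
  inequality is the upper bound.
\<close>

section \<open>Counting in a triangulation\<close>

text \<open>A core in several pieces has Euler characteristic above 1, say \<open>1 + j\<close>, so
  the vertex count alone does not descend well from step to step. \<open>E - F\<close> does: one
  peel lowers it by at most \<open>n + j\<close>, and the perimeter then drops by at least
  \<open>6 + 4 * j\<close> instead of 6, which more than pays for \<open>j\<close>. A hole could
  make \<open>j\<close> negative and ruin the estimate. Freedom from holes is therefore carried as a
  condition on the graph alone (\<open>outward\<close>), which peeling preserves and which the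
  topology turns into an Euler inequality.

  Edges are arbitrary arcs, so it is not visible locally that an edge closing a cycle creates only
  one new region. The triangulation itself supplies the local picture: an inner edge has exactly two
  faces along it, a rim edge one face and the exterior (\<open>two_sided\<close>). That two faces
  glue along a common edge to an open set comes from theta graphs. The same pairs of sides serve for
  the whole graph and for all induced subgraphs.

  The resulting bound \<open>V <= ((n + 3)^2 + 3) / 12\<close> stays below the
  \<open>((n + 3)^2 + 6) / 12\<close> that rounding allows.\<close>

text \<open>\<open>E - F\<close> is the number of vertices minus the Euler characteristic, and \<open>n (n + 6)\<close> grows by
  exactly \<open>12 n\<close> when the perimeter \<open>n - 6\<close> of the core is replaced by \<open>n\<close>.\<close>

lemma isoperimetric_arith:
  fixes u u' E F E' F' n n' :: int
  assumes "n = 2 * E - 3 * F" "n' = 2 * E' - 3 * F'" "0 \<le> n'"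
    and "E + 1 \<le> u + F" "E' + 1 \<le> u' + F'"
    and "u - u' \<le> n" "6 * u' \<le> 2 * E' + F - F'"
    and "12 * (E' - F') \<le> n' * (n' + 6)"
  shows "12 * (E - F) \<le> n * (n + 6)"
proof -
  \<comment> \<open>The excess of the Euler characteristic of the core over 1.\<close>
  define j where "j = u' - E' + F' - 1"
  have j: "0 \<le> j" using assms(5) unfolding j_def by linarith
  have k: "(E - F) - (E' - F') \<le> n + j" using assms(4,6) unfolding j_def by linarith
  \<comment> \<open>Inserting \<open>u' = E' - F' + 1 + j\<close> into the degree inequality yields
    a gain of \<open>6 + 6 * j\<close>; estimating \<open>E\<close> from below by \<open>k\<close>
    takes back \<open>2 * j\<close> of it.\<close>
  have n': "n' \<le> n - 6 - 4 * j" using assms(1,2,7) k unfolding j_def by (simp add: algebra_simps)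
  have "n' * (n' + 6) \<le> (n - 6 - 4 * j) * (n - 4 * j)"
    using n' assms(3) j by (intro mult_mono) linarith+
  with assms(8) have "12 * (E' - F') \<le> (n - 6 - 4 * j) * (n - 4 * j)" by (rule order_trans)
  then have "12 * (n + j) + 12 * (E' - F') \<le> 12 * (n + j) + (n - 6 - 4 * j) * (n - 4 * j)"
    by (rule add_left_mono)
  moreover have "12 * (E - F) \<le> 12 * (n + j) + 12 * (E' - F')"
    using k by (simp add: algebra_simps)
  ultimately have "12 * (E - F) \<le> 12 * (n + j) + (n - 6 - 4 * j) * (n - 4 * j)"
    by (rule order_trans[rotated])
  also have "\<dots> = n * (n + 6) - 4 * j * (2 * n - 9 - 4 * j)"
    by (simp add: algebra_simps)
  also have "\<dots> \<le> n * (n + 6)"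
  proof -
    \<comment> \<open>As \<open>n'\<close> is nonnegative, \<open>n\<close> is at least
      \<open>6 + 4 * j\<close>, which makes the second factor positive.\<close>
    have "0 \<le> 4 * j * (2 * n - 9 - 4 * j)" using n' assms(3) j j by (intro mult_nonneg_nonneg) simp_all
    then show ?thesis by linarith
  qed
  finally show ?thesis .
qed

lemma double_count:
  assumes "finite X" "finite Y"
  shows "(\<Sum>x\<in>X. card {y \<in> Y. R x y}) = (\<Sum>y\<in>Y. card {x \<in> X. R x y})"
proof -
  have "(\<Sum>x\<in>X. card {y \<in> Y. R x y}) = (\<Sum>x\<in>X. \<Sum>y\<in>Y. if R x y then 1 else 0)"
    using assms by (simp add: sum.If_cases Int_def)
  also have "\<dots> = (\<Sum>y\<in>Y. \<Sum>x\<in>X. if R x y then 1 else 0)"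
    by (rule sum.swap)
  also have "\<dots> = (\<Sum>y\<in>Y. card {x \<in> X. R x y})"
    using assms by (simp add: sum.If_cases Int_def)
  finally show ?thesis .
qed

text \<open>Exactly the combinatorial facts that the induction uses; all topology goes into the
  interpretation of this locale. \<open>link\<close> says that the edges at an internal vertex
  cannot be split into two classes without some face at that vertex having a side in each. The inner
  premise of \<open>euler_induced\<close> expresses that \<open>U\<close> has no holes.\<close>

locale triangle_incidence =
  fixes V :: "'v set" and E :: "'e set" and F :: "'f set" and Bd :: "'v set"
    and ends :: "'e \<Rightarrow> 'v set" and corners :: "'f \<Rightarrow> 'v set" and sides :: "'f \<Rightarrow> 'e set"
  assumes finite_V: "finite V" and finite_E: "finite E" and finite_F: "finite F"
    and ends_pair: "e \<in> E \<Longrightarrow> \<exists>u v. u \<in> V \<and> v \<in> V \<and> u \<noteq> v \<and> ends e = {u, v}"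
    and triangle: "f \<in> F \<Longrightarrow> \<exists>a b c e1 e2 e3. distinct [a, b, c] \<and> corners f = {a, b, c} \<and>
          sides f = {e1, e2, e3} \<and> sides f \<subseteq> E \<and>
          ends e1 = {a, b} \<and> ends e2 = {b, c} \<and> ends e3 = {c, a}"
    and sides_le_2: "e \<in> E \<Longrightarrow> card {f \<in> F. e \<in> sides f} \<le> 2"
    and sides_eq_2: "e \<in> E \<Longrightarrow> \<not> ends e \<subseteq> Bd \<Longrightarrow> card {f \<in> F. e \<in> sides f} = 2"
    and boundary_edge: "v \<in> Bd \<Longrightarrow> \<exists>e\<in>E. v \<in> ends e \<and> card {f \<in> F. e \<in> sides f} \<le> 1"
    and boundary_length: "2 * card E = 3 * card F + card Bd"
    and link: "v \<in> V - Bd \<Longrightarrow> e \<in> E \<Longrightarrow> v \<in> ends e \<Longrightarrow> e \<in> A \<Longrightarrow>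
          e' \<in> E \<Longrightarrow> v \<in> ends e' \<Longrightarrow> e' \<notin> A \<Longrightarrow>
          \<exists>f\<in>F. \<exists>d\<in>sides f \<inter> A. \<exists>d'\<in>sides f - A. v \<in> ends d \<and> v \<in> ends d'"
    and degree: "v \<in> V - Bd \<Longrightarrow> 6 \<le> card {e \<in> E. v \<in> ends e}"
    and euler: "card V + card F = card E + 1"
    and euler_induced: "U \<subseteq> V - Bd \<Longrightarrow> U \<noteq> {} \<Longrightarrow>
          (\<And>X. X \<noteq> {} \<Longrightarrow> X \<subseteq> V - U - Bd \<Longrightarrow> \<exists>e\<in>E. \<exists>x\<in>X. \<exists>y\<in>V - U - X. ends e = {x, y}) \<Longrightarrow>
          card {e \<in> E. ends e \<subseteq> U} + 1 \<le> card U + card {f \<in> F. corners f \<subseteq> U}"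
begin

section \<open>Regions spanned by sets of vertices\<close>

definition induced_edges :: "'v set \<Rightarrow> 'e set" where
  "induced_edges U = {e \<in> E. ends e \<subseteq> U}"

definition induced_faces :: "'v set \<Rightarrow> 'f set" where
  "induced_faces U = {f \<in> F. corners f \<subseteq> U}"

text \<open>What survives when the vertices on the boundary walk of the region are peeled
  off.\<close>

definition core :: "'v set \<Rightarrow> 'v set" where
  "core U = {v \<in> U - Bd. \<forall>e\<in>E. v \<in> ends e \<longrightarrow> ends e \<subseteq> U}"

text \<open>Length of the boundary walk: by \<open>perimeter_eq\<close> an edge counts twice, once
  or not at all according as it has no, one or two induced faces, so an edge without faces is walked
  in both directions.\<close>

definition perimeter :: "'v set \<Rightarrow> int" where
  "perimeter U = 2 * int (card (induced_edges U)) - 3 * int (card (induced_faces U))"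

definition no_isolated :: "'v set \<Rightarrow> bool" where
  "no_isolated U \<longleftrightarrow> (\<forall>v\<in>U. \<exists>e\<in>induced_edges U. v \<in> ends e)"

lemma finite_induced [simp]: "finite (induced_edges U)" "finite (induced_faces U)"
  using finite_E finite_F by (auto simp: induced_edges_def induced_faces_def)

lemma ends_subset_V: "e \<in> E \<Longrightarrow> ends e \<subseteq> V"
  by (drule ends_pair) auto

lemma other_end: "e \<in> E \<Longrightarrow> v \<in> ends e \<Longrightarrow> \<exists>w\<in>V. ends e = {v, w}"
  by (drule ends_pair) (auto simp: insert_commute)

lemma edge_at:
  assumes "v \<in> V - Bd"
  shows "\<exists>e\<in>E. v \<in> ends e"
proof (rule ccontr)
  assume "\<not> ?thesis"
  then have "{e \<in> E. v \<in> ends e} = {}" by blast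
  then have "card {e \<in> E. v \<in> ends e} = 0" by (simp only: card.empty)
  with degree[OF assms] show False by linarith
qed

lemma card_ends: "e \<in> E \<Longrightarrow> card (ends e) = 2"
  by (drule ends_pair) auto

lemma triangleE:
  assumes "f \<in> F"
  obtains a b c e1 e2 e3 where "distinct [a, b, c]" "corners f = {a, b, c}"
    "sides f = {e1, e2, e3}" "sides f \<subseteq> E"
    "ends e1 = {a, b}" "ends e2 = {b, c}" "ends e3 = {c, a}" "distinct [e1, e2, e3]"
proof -
  obtain a b c e1 e2 e3 where *: "distinct [a, b, c]" "corners f = {a, b, c}"
    "sides f = {e1, e2, e3}" "sides f \<subseteq> E" "ends e1 = {a, b}" "ends e2 = {b, c}" "ends e3 = {c, a}"
    using triangle[OF assms] by (elim exE conjE) (rule that)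
  then have "distinct [e1, e2, e3]" by (auto simp: doubleton_eq_iff)
  with * show ?thesis by (rule that)
qed

lemma induced_V: "induced_edges V = E" "induced_faces V = F"
proof -
  show "induced_edges V = E"
    unfolding induced_edges_def using ends_subset_V by blast
  have "corners f \<subseteq> V" if f: "f \<in> F" for f
  proof -
    obtain a b c e1 e2 e3 where "corners f = {a, b, c}" "sides f = {e1, e2, e3}" "sides f \<subseteq> E"
      "ends e1 = {a, b}" "ends e2 = {b, c}" using f by (rule triangleE)
    then show ?thesis using ends_subset_V[of e1] ends_subset_V[of e2] by auto
  qed
  then show "induced_faces V = F" unfolding induced_faces_def by blast
qed

lemma sides_E: "f \<in> F \<Longrightarrow> sides f \<subseteq> E"
  by (erule triangleE)

lemma card_sides: "f \<in> F \<Longrightarrow> card (sides f) = 3"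
  by (erule triangleE) simp

lemma ends_sides: "f \<in> F \<Longrightarrow> e \<in> sides f \<Longrightarrow> ends e \<subseteq> corners f"
  by (erule triangleE) auto

lemma corner_pair:
  assumes "f \<in> F" "u \<in> corners f" "v \<in> corners f" "u \<noteq> v"
  shows "\<exists>e\<in>sides f. ends e = {u, v}"
proof -
  obtain a b c e1 e2 e3 where *: "corners f = {a, b, c}" "sides f = {e1, e2, e3}"
    "ends e1 = {a, b}" "ends e2 = {b, c}" "ends e3 = {c, a}" using assms(1) by (rule triangleE)
  show ?thesis using assms(2-4) unfolding * by (auto simp: *(3-5) insert_commute)
qed

lemma sides_at_corner:
  assumes f: "f \<in> F"
  shows "card {e \<in> sides f. v \<in> ends e} = (if v \<in> corners f then 2 else 0)"
proof -
  obtain a b c e1 e2 e3 where *: "distinct [a, b, c]" "corners f = {a, b, c}" "sides f = {e1, e2, e3}"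
    "ends e1 = {a, b}" "ends e2 = {b, c}" "ends e3 = {c, a}" "distinct [e1, e2, e3]" using f by (rule triangleE)
  have "{e \<in> sides f. v \<in> ends e} =
    (if v = a \<or> v = b then {e1} else {}) \<union> (if v = b \<or> v = c then {e2} else {}) \<union>
    (if v = c \<or> v = a then {e3} else {})"
    using * by auto
  then show ?thesis using * by auto
qed

definition incident :: "'v set \<Rightarrow> 'e \<Rightarrow> nat" where
  "incident U e = card {f \<in> induced_faces U. e \<in> sides f}"

lemma incident_le_2: "e \<in> E \<Longrightarrow> incident U e \<le> 2"
proof -
  assume "e \<in> E"
  have "incident U e \<le> card {f \<in> F. e \<in> sides f}"
    unfolding incident_def by (rule card_mono) (auto simp: finite_F induced_faces_def)
  then show ?thesis using sides_le_2[OF \<open>e \<in> E\<close>] by simp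
qed

lemma sides_induced: "f \<in> induced_faces U \<Longrightarrow> sides f \<subseteq> induced_edges U"
  using ends_sides sides_E unfolding induced_faces_def induced_edges_def by blast

lemma sum_incident: "(\<Sum>e\<in>induced_edges U. incident U e) = 3 * card (induced_faces U)"
proof -
  have "(\<Sum>e\<in>induced_edges U. incident U e) = (\<Sum>f\<in>induced_faces U. card {e \<in> induced_edges U. e \<in> sides f})"
    unfolding incident_def by (rule double_count) auto
  also have "\<dots> = (\<Sum>f\<in>induced_faces U. 3)"
  proof (rule sum.cong)
    fix f assume f: "f \<in> induced_faces U"
    then have "{e \<in> induced_edges U. e \<in> sides f} = sides f" using sides_induced by blast
    then show "card {e \<in> induced_edges U. e \<in> sides f} = 3"
      using f card_sides by (auto simp: induced_faces_def)
  qed simp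
  finally show ?thesis by simp
qed

lemma perimeter_eq: "perimeter U = (\<Sum>e\<in>induced_edges U. 2 - int (incident U e))"
  using sum_incident[of U] by (simp add: perimeter_def sum_subtractf flip: of_nat_sum)

lemma perimeter_nonneg: "0 \<le> perimeter U"
  unfolding perimeter_eq using incident_le_2 by (intro sum_nonneg) (force simp: induced_edges_def)

text \<open>A weighted handshake: every edge is met once from each of its ends in
  \<open>W\<close>.\<close>

lemma sum_ends:
  assumes "W \<subseteq> V" "finite X"
  shows "(\<Sum>v\<in>W. \<Sum>e\<in>{e \<in> X. v \<in> ends e}. g e) = (\<Sum>e\<in>X. int (card (ends e \<inter> W)) * (g e :: int))"
proof -
  have fW: "finite W" using assms finite_V finite_subset by blast
  have "(\<Sum>v\<in>W. \<Sum>e\<in>{e \<in> X. v \<in> ends e}. g e) = (\<Sum>v\<in>W. \<Sum>e\<in>X. if v \<in> ends e then g e else 0)"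
    using assms by (simp add: sum.inter_filter)
  also have "\<dots> = (\<Sum>e\<in>X. \<Sum>v\<in>W. if v \<in> ends e then g e else 0)"
    by (rule sum.swap)
  also have "\<dots> = (\<Sum>e\<in>X. int (card (ends e \<inter> W)) * g e)"
    using fW by (intro sum.cong) (simp_all add: sum.If_cases Int_def conj_commute)
  finally show ?thesis .
qed

text \<open>The number of induced edges missing a face is at least two around every vertex outside the
  core: it is positive by connectivity of the link, and even because every face at a vertex has
  two sides there.\<close>

lemma card_rim_le_perimeter:
  assumes U: "U \<subseteq> V" "no_isolated U" "U \<inter> Bd = {} \<or> U = V"
  shows "int (card (U - core U)) \<le> perimeter U"
proof -
  let ?E = "induced_edges U"
  let ?d = "\<lambda>e. 2 - int (incident U e)"
  have d0: "0 \<le> ?d e" if "e \<in> ?E" for e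
    using incident_le_2 that by (force simp: induced_edges_def)
  have ge2: "2 \<le> (\<Sum>e\<in>{e \<in> ?E. v \<in> ends e}. ?d e)" if v: "v \<in> U - core U" for v
  proof -
    let ?Ev = "{e \<in> ?E. v \<in> ends e}"
    have "(\<Sum>e\<in>?Ev. incident U e) = (\<Sum>f\<in>induced_faces U. card {e \<in> ?Ev. e \<in> sides f})"
      unfolding incident_def by (rule double_count) auto
    also have "\<dots> = (\<Sum>f\<in>induced_faces U. if v \<in> corners f then 2 else 0)"
    proof (rule sum.cong)
      fix f assume f: "f \<in> induced_faces U"
      then have "{e \<in> ?Ev. e \<in> sides f} = {e \<in> sides f. v \<in> ends e}" using sides_induced by blast
      then show "card {e \<in> ?Ev. e \<in> sides f} = (if v \<in> corners f then 2 else 0)"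
        using f sides_at_corner by (auto simp: induced_faces_def)
    qed simp
    also have "even \<dots>" by (rule dvd_sum) auto
    finally have "even (\<Sum>e\<in>?Ev. ?d e)"
      by (simp add: sum_subtractf flip: of_nat_sum)
    moreover have "\<exists>e\<in>?Ev. incident U e \<le> 1"
    proof (cases "v \<in> Bd")
      \<comment> \<open>Only \<open>U = V\<close> contains boundary vertices, and then
        \<open>incident\<close> counts all faces along an edge.\<close>
      case True
      then show ?thesis
        using v U induced_V boundary_edge[OF True] unfolding incident_def by auto
    next
      case False
      then obtain e' where e': "e' \<in> E" "v \<in> ends e'" "\<not> ends e' \<subseteq> U"
        using v unfolding core_def by blast
      obtain e where e: "e \<in> ?E" "v \<in> ends e"
        using U v unfolding no_isolated_def by blast
      have "v \<in> V - Bd" using v U False by blast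
      \<comment> \<open>Separating induced from other edges at \<open>v\<close>, the link yields a
        face with an induced side \<open>d\<close> and another side outside \<open>U\<close>. That
        face is not induced, so \<open>d\<close> has lost one of its at most two faces.\<close>
      from link[OF this, of e ?E e'] e e' obtain f d d' where
        f: "f \<in> F" "d \<in> sides f" "d \<in> ?E" "d' \<in> sides f" "d' \<notin> ?E" "v \<in> ends d"
        unfolding induced_edges_def by blast
      have "{f \<in> induced_faces U. d \<in> sides f} \<subset> {f \<in> F. d \<in> sides f}"
        using f sides_induced f by (auto simp: induced_faces_def)
      then have "incident U d < card {f \<in> F. d \<in> sides f}"
        unfolding incident_def using finite_F by (intro psubset_card_mono) auto
      moreover have "card {f \<in> F. d \<in> sides f} \<le> 2"
        using sides_le_2 f(3) by (simp add: induced_edges_def)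
      ultimately show ?thesis using f by force
    qed
    then have "0 < (\<Sum>e\<in>?Ev. ?d e)"
      using d0 by (force intro: sum_pos2)
    ultimately show ?thesis by presburger
  qed
  have fin: "finite U" using U finite_V finite_subset by blast
  have "2 * int (card (U - core U)) = (\<Sum>v\<in>U - core U. 2)" by simp
  also have "\<dots> \<le> (\<Sum>v\<in>U - core U. \<Sum>e\<in>{e \<in> ?E. v \<in> ends e}. ?d e)"
    by (rule sum_mono[OF ge2])
  also have "\<dots> \<le> (\<Sum>v\<in>U. \<Sum>e\<in>{e \<in> ?E. v \<in> ends e}. ?d e)"
    using fin d0 by (intro sum_mono2 sum_nonneg) auto
  also have "\<dots> = (\<Sum>e\<in>?E. int (card (ends e \<inter> U)) * ?d e)"
    using U by (intro sum_ends) (auto simp: induced_edges_def finite_E)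
  also have "\<dots> = (\<Sum>e\<in>?E. 2 * ?d e)"
  proof (rule sum.cong)
    fix e assume "e \<in> ?E"
    then have "ends e \<inter> U = ends e" "card (ends e) = 2" by (auto simp: induced_edges_def card_ends)
    then show "int (card (ends e \<inter> U)) * ?d e = 2 * ?d e" by simp
  qed simp
  also have "\<dots> = 2 * perimeter U" by (simp add: perimeter_eq sum_distrib_left)
  finally show ?thesis by simp
qed

lemma core_subset: "core U \<subseteq> U" "core U \<inter> Bd = {}"
  by (auto simp: core_def)

lemma core_edge: "e \<in> E \<Longrightarrow> ends e \<inter> core U \<noteq> {} \<Longrightarrow> ends e \<subseteq> U"
  by (auto simp: core_def)

text \<open>Any two corners of a triangle are joined by a side, so one corner in the core pulls the
  other two into \<open>U\<close>.\<close>

lemma core_face: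
  assumes f: "f \<in> F" "corners f \<inter> core U \<noteq> {}"
  shows "f \<in> induced_faces U"
proof -
  obtain v where v: "v \<in> corners f" "v \<in> core U" using f by blast
  have "w \<in> U" if w: "w \<in> corners f" for w
  proof (cases "w = v")
    case False
    then obtain e where "e \<in> sides f" "ends e = {v, w}"
      using corner_pair[OF f(1) v(1) w] by blast
    then show ?thesis using core_edge[of e U] v sides_E[OF f(1)] by auto
  qed (use v core_subset in auto)
  then show ?thesis using f by (auto simp: induced_faces_def)
qed

section \<open>One peel: the edges and faces between a region and its core\<close>

definition crossing :: "'v set \<Rightarrow> 'e set" where
  "crossing W = {e \<in> E. card (ends e \<inter> W) = 1}"

text \<open>Summing degrees over the core meets an edge inside it twice and a crossing edge once;
  core vertices are internal, so each degree is at least 6.\<close>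

lemma degree_sum_core:
  assumes U: "U \<subseteq> V"
  shows "6 * card (core U) \<le> 2 * card (induced_edges (core U)) + card (crossing (core U))"
proof -
  let ?W = "core U"
  have W: "?W \<subseteq> V" using U core_subset by blast
  have "6 * int (card ?W) = (\<Sum>v\<in>?W. 6)" by simp
  also have "\<dots> \<le> (\<Sum>v\<in>?W. \<Sum>e\<in>{e \<in> E. v \<in> ends e}. 1)"
    using degree core_subset W by (intro sum_mono) force
  also have "\<dots> = (\<Sum>e\<in>E. int (card (ends e \<inter> ?W)) * 1)"
    by (rule sum_ends[OF W finite_E])
  also have "\<dots> = (\<Sum>e\<in>E. (if e \<in> induced_edges ?W then 2 else 0) + (if e \<in> crossing ?W then 1 else 0))"
  proof (rule sum.cong)
    fix e assume e: "e \<in> E"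
    show "int (card (ends e \<inter> ?W)) * 1 =
      (if e \<in> induced_edges ?W then 2 else 0) + (if e \<in> crossing ?W then 1 else 0)"
      using ends_pair[OF e] e by (cases "u \<in> ?W"; cases "v \<in> ?W") (auto simp: induced_edges_def crossing_def)
  qed simp
  also have "\<dots> = 2 * int (card (induced_edges ?W)) + int (card (crossing ?W))"
    using finite_E by (simp add: sum.distrib sum.If_cases induced_edges_def crossing_def Int_def)
  finally show ?thesis by linarith
qed

text \<open>A crossing edge has an internal end, hence two faces, and both belong to
  \<open>U\<close> but not to the core. Conversely the three sides of a triangle cannot all cross,
  because crossing means changing between core and complement; so such a face has at most two
  crossing sides. Double counting cancels the two factors 2.\<close>

lemma card_crossing_core:
  "card (crossing (core U)) + card (induced_faces (core U)) \<le> card (induced_faces U)"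
proof -
  let ?W = "core U"
  let ?R = "induced_faces U - induced_faces ?W"
  have cut: "card {e \<in> sides f. card (ends e \<inter> ?W) = 1} \<le> 2" if f: "f \<in> F" for f
  proof -
    obtain a b c e1 e2 e3 where *: "distinct [a, b, c]" "sides f = {e1, e2, e3}"
      "ends e1 = {a, b}" "ends e2 = {b, c}" "ends e3 = {c, a}" "distinct [e1, e2, e3]" using f by (rule triangleE)
    have pair: "card ({u, v} \<inter> ?W) = 1 \<longleftrightarrow> (u \<in> ?W) \<noteq> (v \<in> ?W)"
      if "u \<noteq> v" for u v
      using that by (cases "u \<in> ?W"; cases "v \<in> ?W") simp_all
    have "\<exists>e\<in>sides f. card (ends e \<inter> ?W) \<noteq> 1"
    proof (rule ccontr)
      assume "\<not> ?thesis"
      then show False using * *(1) pair[of a b] pair[of b c] pair[of c a] by auto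
    qed
    then have "{e \<in> sides f. card (ends e \<inter> ?W) = 1} \<subset> sides f" by blast
    then have "card {e \<in> sides f. card (ends e \<inter> ?W) = 1} < card (sides f)"
      using *(2) by (intro psubset_card_mono) simp_all
    then show ?thesis using card_sides[OF f] by simp
  qed
  have face: "f \<in> ?R" if e: "e \<in> crossing ?W" and f: "f \<in> F" "e \<in> sides f" for e f
  proof -
    have "ends e \<inter> ?W \<noteq> {}" "\<not> ends e \<subseteq> ?W"
      using e card_ends[of e] by (auto simp: crossing_def Int_absorb2)
    then show ?thesis using core_face[of f U] ends_sides[of f e] f by (auto simp: induced_faces_def)
  qed
  have "2 * card (crossing ?W) = (\<Sum>e\<in>crossing ?W. 2)" by simp
  also have "\<dots> = (\<Sum>e\<in>crossing ?W. card {f \<in> ?R. e \<in> sides f})"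
  proof (rule sum.cong)
    fix e assume e: "e \<in> crossing ?W"
    then have "ends e \<inter> ?W \<noteq> {}" "e \<in> E" by (auto simp: crossing_def)
    then have "card {f \<in> F. e \<in> sides f} = 2" using sides_eq_2[of e] core_subset by blast
    moreover have "{f \<in> F. e \<in> sides f} = {f \<in> ?R. e \<in> sides f}"
      using face[OF e] by (auto simp: induced_faces_def)
    ultimately show "2 = card {f \<in> ?R. e \<in> sides f}" by simp
  qed simp
  also have "\<dots> = (\<Sum>f\<in>?R. card {e \<in> crossing ?W. e \<in> sides f})"
    using finite_E by (intro double_count) (auto simp: crossing_def)
  also have "\<dots> \<le> (\<Sum>f\<in>?R. 2)"
  proof (rule sum_mono)
    fix f assume "f \<in> ?R"
    then have f: "f \<in> F" by (auto simp: induced_faces_def)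
    have "{e \<in> crossing ?W. e \<in> sides f} = {e \<in> sides f. card (ends e \<inter> ?W) = 1}"
      using sides_E[OF f] by (auto simp: crossing_def)
    then show "card {e \<in> crossing ?W. e \<in> sides f} \<le> 2" using cut[OF f] by simp
  qed
  also have "\<dots> = 2 * card ?R" by simp
  finally have "card (crossing ?W) \<le> card ?R" by simp
  moreover have "induced_faces ?W \<subseteq> induced_faces U"
    using core_subset(1)[of U] by (auto simp: induced_faces_def)
  ultimately show ?thesis
    using card_mono[of "induced_faces U" "induced_faces ?W"]
    by (simp add: card_Diff_subset)
qed

lemma isoperimetric_step:
  assumes U: "U \<subseteq> V" "no_isolated U" "U \<inter> Bd = {} \<or> U = V"
    and chi: "card (induced_edges U) + 1 \<le> card U + card (induced_faces U)"
    and core: "core U \<noteq> {} \<Longrightarrow>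
      card (induced_edges (core U)) + 1 \<le> card (core U) + card (induced_faces (core U)) \<and>
      12 * (int (card (induced_edges (core U))) - int (card (induced_faces (core U))))
        \<le> perimeter (core U) * (perimeter (core U) + 6)"
  shows "12 * (int (card (induced_edges U)) - int (card (induced_faces U)))
        \<le> perimeter U * (perimeter U + 6)"
proof -
  have fin: "finite U" using U finite_V finite_subset by blast
  have rim: "int (card U) - int (card (core U)) \<le> perimeter U"
    using card_rim_le_perimeter[OF U] core_subset(1)[of U] card_mono[OF fin core_subset(1)] fin
    by (simp add: card_Diff_subset finite_subset of_nat_diff)
  show ?thesis
  proof (cases "core U = {}")
    case True
    then have "int (card (induced_edges U)) - int (card (induced_faces U)) \<le> perimeter U - 1"
      using chi rim by simp
    \<comment> \<open>The difference of the two sides is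
      \<open>(perimeter U - 3)^2 + 3\<close>.\<close>
    moreover have "12 * (perimeter U - 1) \<le> perimeter U * (perimeter U + 6)"
      using zero_le_power2[of "perimeter U - 3"] by (simp add: power2_eq_square algebra_simps)
    ultimately show ?thesis using order_trans[of _ "12 * (perimeter U - 1)"] by simp
  next
    case False
    show ?thesis
    proof (rule isoperimetric_arith)
      show "int (card U) - int (card (core U)) \<le> perimeter U" by (fact rim)
      show "6 * int (card (core U)) \<le> 2 * int (card (induced_edges (core U))) +
          int (card (induced_faces U)) - int (card (induced_faces (core U)))"
        using degree_sum_core[OF U(1)] card_crossing_core[of U] by linarith
      show "0 \<le> perimeter (core U)" by (rule perimeter_nonneg)
    qed (use chi core[OF False] in \<open>auto simp: perimeter_def\<close>)
  qed
qed

text \<open>For \<open>U\<close> disjoint from \<open>Bd\<close> this means that every component of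
  the graph without \<open>U\<close> contains a boundary vertex, that is, \<open>U\<close> encloses
  nothing. Quantifying over sets \<open>X\<close> avoids paths in the graph.\<close>

definition outward :: "'v set \<Rightarrow> bool" where
  "outward U \<longleftrightarrow> (\<forall>X. X \<noteq> {} \<longrightarrow> X \<subseteq> V - U - Bd \<longrightarrow>
     (\<exists>e\<in>E. \<exists>x\<in>X. \<exists>y\<in>V - U - X. ends e = {x, y}))"

text \<open>A vertex given up by \<open>U\<close> lies on the boundary or has a neighbour in the old
  outside, so no new enclosed set can arise. Both uses are of this kind: dropping isolated vertices
  and passing to the core.\<close>

lemma outward_subset:
  assumes U: "outward U" and W: "W \<subseteq> U"
    and step: "\<And>v. v \<in> U - W \<Longrightarrow> v \<in> Bd \<or> (\<exists>e\<in>E. v \<in> ends e \<and> \<not> ends e \<subseteq> U)"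
  shows "outward W"
  unfolding outward_def
proof (intro allI impI)
  fix X assume X: "X \<noteq> {}" "X \<subseteq> V - W - Bd"
  show "\<exists>e\<in>E. \<exists>x\<in>X. \<exists>y\<in>V - W - X. ends e = {x, y}"
  proof (cases "X \<subseteq> U")
    case True
    then obtain v e where e: "v \<in> X" "e \<in> E" "v \<in> ends e" "\<not> ends e \<subseteq> U" using X step by blast
    then obtain w where "w \<in> V" "ends e = {v, w}" using other_end by blast
    then have "w \<in> V - W - X" using e True W by auto
    then show ?thesis using e(1,2) \<open>ends e = {v, w}\<close> by blast
  next
    case False
    then have "X - U \<noteq> {}" "X - U \<subseteq> V - U - Bd" using X by blast+
    then obtain e x y where e: "e \<in> E" "x \<in> X - U" "y \<in> V - U - (X - U)" "ends e = {x, y}"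
      using U unfolding outward_def by metis
    then show ?thesis using W e by blast
  qed
qed

lemma outward_induced:
  "outward U \<Longrightarrow> U \<subseteq> V - Bd \<Longrightarrow> U \<noteq> {} \<Longrightarrow>
    card (induced_edges U) + 1 \<le> card U + card (induced_faces U)"
  using euler_induced[of U] unfolding outward_def induced_edges_def induced_faces_def by blast

text \<open>Vertices of \<open>U\<close> without an induced edge change neither \<open>E - F\<close>
  nor the perimeter, but would be counted in the rim without contributing to the perimeter. Hence
  \<open>U\<close> is first reduced to \<open>X\<close>, and \<open>X\<close> is peeled.\<close>

lemma isoperimetric_inner:
  "U \<subseteq> V - Bd \<Longrightarrow> outward U \<Longrightarrow>
    12 * (int (card (induced_edges U)) - int (card (induced_faces U)))
        \<le> perimeter U * (perimeter U + 6)"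
proof (induction "card U" arbitrary: U rule: less_induct)
  case less
  define X where "X = {v \<in> U. \<exists>e\<in>induced_edges U. v \<in> ends e}"
  have edge: "v \<in> X \<longleftrightarrow> (\<exists>e\<in>E. v \<in> ends e \<and> ends e \<subseteq> U)" for v
    unfolding X_def induced_edges_def by blast
  have XU: "X \<subseteq> U" by (auto simp: X_def)
  have eqE: "induced_edges X = induced_edges U"
    using XU edge unfolding induced_edges_def by blast
  have eqF: "induced_faces X = induced_faces U"
  proof -
    have "corners f \<subseteq> X" if f: "f \<in> F" "corners f \<subseteq> U" for f
    proof
      fix v assume v: "v \<in> corners f"
      have "\<exists>e\<in>sides f. v \<in> ends e" using f(1) v by (elim triangleE) auto
      then show "v \<in> X" using edge f ends_sides sides_E by blast
    qed
    then show ?thesis using XU unfolding induced_faces_def by blast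
  qed
  have nonisol: "\<exists>e\<in>E. v \<in> ends e" if "v \<in> U" for v
    using edge_at less.prems(1) that by blast
  have outX: "outward X"
    by (rule outward_subset[OF less.prems(2) XU]) (use nonisol edge in blast)
  have niX: "no_isolated X" unfolding no_isolated_def eqE using X_def by blast
  have XV: "X \<subseteq> V - Bd" using XU less.prems by blast
  have outC: "outward (core X)"
    by (rule outward_subset[OF outX core_subset(1)]) (auto simp: core_def)
  show ?case
  proof (cases "X = {}")
    case True
    have "induced_edges X = {}" unfolding True induced_edges_def by (auto dest: ends_pair)
    moreover have "induced_faces X = {}" unfolding True induced_faces_def by (auto elim: triangleE)
    ultimately show ?thesis
      using perimeter_nonneg[of U] eqE eqF by simp
  next
    case False
    have fin: "finite U" using less.prems finite_V finite_subset by (meson Diff_subset)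
    have "12 * (int (card (induced_edges X)) - int (card (induced_faces X)))
        \<le> perimeter X * (perimeter X + 6)"
    proof (rule isoperimetric_step)
      assume C: "core X \<noteq> {}"
      have CV: "core X \<subseteq> V - Bd" using XV core_subset by blast
      \<comment> \<open>The induction makes progress: otherwise no edge leaves \<open>U\<close>, so
        the degrees give \<open>3 * card U\<close> at most the number of induced edges, and the
        nonnegative perimeter bounds three times the faces by twice the edges. Together these
        contradict the Euler inequality.\<close>
      have "core X \<noteq> U"
      proof
        assume eq: "core X = U"
        then have UX: "X = U" using core_subset XU by blast
        show False
          using perimeter_nonneg[of U] degree_sum_core[of U] card_crossing_core[of U]
            outward_induced[OF less.prems(2,1)] C eq UX less.prems(1)
          by (auto simp: perimeter_def)
      qed
      then have "card (core X) < card U"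
        using core_subset(1)[of X] XU fin by (metis order.trans psubsetI psubset_card_mono)
      then show "card (induced_edges (core X)) + 1 \<le> card (core X) + card (induced_faces (core X)) \<and>
         12 * (int (card (induced_edges (core X))) - int (card (induced_faces (core X))))
         \<le> perimeter (core X) * (perimeter (core X) + 6)"
        using outward_induced[OF outC CV C] less.hyps[OF _ CV outC] by blast
    qed (use niX XV outward_induced[OF outX XV False] in auto)
    then show ?thesis by (simp add: eqE eqF perimeter_def)
  qed
qed

text \<open>\<open>V\<close> is the only region containing boundary vertices and is peeled once; its
  core consists of internal vertices, where the induction applies.\<close>

theorem isoperimetric: "12 * (card V - 1) \<le> card Bd * (card Bd + 6)"
proof -
  have ni: "no_isolated V"
    unfolding no_isolated_def induced_V using edge_at boundary_edge by blast
  have "outward V" by (simp add: outward_def)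
  then have out: "outward (core V)"
    by (rule outward_subset[OF _ core_subset(1)]) (auto simp: core_def)
  have CV: "core V \<subseteq> V - Bd" using core_subset by blast
  have "12 * (int (card (induced_edges V)) - int (card (induced_faces V)))
        \<le> perimeter V * (perimeter V + 6)"
  proof (rule isoperimetric_step[OF _ ni])
    show "card (induced_edges V) + 1 \<le> card V + card (induced_faces V)"
      using euler by (simp add: induced_V)
  qed (use outward_induced[OF out CV] isoperimetric_inner[OF CV out] in simp_all)
  moreover have "perimeter V = int (card Bd)"
    using boundary_length by (simp add: perimeter_def induced_V)
  ultimately have *: "12 * (int (card V) - 1) \<le> int (card Bd * (card Bd + 6))"
    using euler by (simp add: induced_V)
  have "int (12 * (card V - 1)) \<le> int (card Bd * (card Bd + 6))"
  proof (cases "card V = 0")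
    case False
    then have "int (12 * (card V - 1)) = 12 * (int (card V) - 1)" by (simp add: of_nat_diff)
    then show ?thesis using * by (simp only:)
  qed simp
  then show ?thesis by (simp only: of_nat_le_iff)
qed

end

section \<open>Complements of plane sets\<close>

text \<open>The inverse of the arc would embed a nonempty open subset of the plane in the line,
  against invariance of dimension.\<close>

lemma open_subset_arc_empty:
  fixes g :: "real \<Rightarrow> complex"
  assumes "arc g" "open U" "U \<subseteq> path_image g"
  shows "U = {}"
proof (rule ccontr)
  assume "U \<noteq> {}"
  obtain h where h: "homeomorphism {0..1} (path_image g) g h"
    using homeomorphism_arc[OF assms(1)] by blast
  then have "continuous_on (path_image g) h" "inj_on h (path_image g)"
    by (auto simp: homeomorphism_def intro: inj_on_inverseI)
  then have "continuous_on U h" "inj_on h U"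
    using assms(3) continuous_on_subset inj_on_subset by blast+
  from invariance_of_dimension[OF this(1) assms(2) this(2) \<open>U \<noteq> {}\<close>] show False by simp
qed

text \<open>By finiteness the union of the remaining members is closed too, so a connected set
  meeting \<open>K\<close> cannot also meet the rest.\<close>

lemma components_closed_unique:
  assumes fin: "finite \<K>" and disj: "pairwise disjnt \<K>"
    and K: "\<And>K. K \<in> \<K> \<Longrightarrow> closed K \<and> connected K \<and> K \<noteq> {}"
  shows "components (\<Union>\<K>) = \<K>"
proof -
  have *: "K \<in> components (\<Union>\<K>)" if k: "K \<in> \<K>" for K
    unfolding in_components_maximal
  proof (intro conjI allI impI)
    fix d assume d: "d \<noteq> {} \<and> K \<subseteq> d \<and> d \<subseteq> \<Union>\<K> \<and> connected d"
    have cl: "closed K" "closed (\<Union>(\<K> - {K}))" using K k fin by auto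
    have dj: "K \<inter> \<Union>(\<K> - {K}) = {}"
      using disj k unfolding pairwise_def disjnt_def by blast
    have "d \<inter> K = {} \<or> d \<inter> \<Union>(\<K> - {K}) = {}"
      using connected_closedD[of d K "\<Union>(\<K> - {K})"] d cl dj by blast
    then show "d = K" using d k K by blast
  qed (use K k in auto)
  show ?thesis
  proof
    show "components (\<Union>\<K>) \<subseteq> \<K>"
    proof
      fix C assume C: "C \<in> components (\<Union>\<K>)"
      then obtain x where "x \<in> C" using in_components_nonempty by blast
      moreover have "C \<subseteq> \<Union>\<K>" using C by (rule in_components_subset)
      ultimately obtain K where k: "K \<in> \<K>" "x \<in> K" by blast
      then have "C = K" using C *[OF k(1)] components_nonoverlap[of C "\<Union>\<K>" K] \<open>x \<in> C\<close> by blast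
      then show "C \<in> \<K>" using k by simp
    qed
  qed (use * in auto)
qed

lemma components_Un_connected:
  fixes T e :: "'a::real_normed_vector set"
  assumes T: "closed T" "finite (components T)" and e: "closed e" "connected e"
    and K: "Ku \<in> components T" "Kv \<in> components T" "e \<inter> T \<subseteq> Ku \<union> Kv"
    and ne: "e \<inter> Ku \<noteq> {}" "e \<inter> Kv \<noteq> {}"
  shows "components (T \<union> e) = insert (Ku \<union> Kv \<union> e) (components T - {Ku, Kv})"
proof -
  let ?\<K> = "insert (Ku \<union> Kv \<union> e) (components T - {Ku, Kv})"
  have sub: "C \<subseteq> T" if "C \<in> components T" for C using that by (rule in_components_subset)
  have disj: "C \<inter> C' = {}" if "C \<in> components T" "C' \<in> components T" "C \<noteq> C'" for C C'
    using components_nonoverlap that by blast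
  have "\<Union>?\<K> = \<Union>(components T) \<union> e" using K by blast
  then have eq: "\<Union>?\<K> = T \<union> e" by simp
  have "components (\<Union>?\<K>) = ?\<K>"
  proof (rule components_closed_unique)
    have "disjnt (Ku \<union> Kv \<union> e) C" if "C \<in> components T - {Ku, Kv}" for C
      using that disj[of C Ku] disj[of C Kv] K sub[of C] unfolding disjnt_def by blast
    moreover have "pairwise disjnt (components T)"
      using disj by (auto simp: pairwise_def disjnt_def)
    ultimately show "pairwise disjnt ?\<K>"
      by (auto simp: pairwise_insert disjnt_sym intro: pairwise_subset)
    fix C assume C: "C \<in> ?\<K>"
    have cl: "closed C" if "C \<in> components T" for C
      using that T closed_components by blast
    have cn: "connected C" if "C \<in> components T" for C
      using that by (rule in_components_connected)
    have "connected (Ku \<union> e \<union> Kv)"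
      using ne cn[OF K(1)] cn[OF K(2)] e by (intro connected_Un) auto
    then have "connected (Ku \<union> Kv \<union> e)" by (simp add: ac_simps)
    then show "closed C \<and> connected C \<and> C \<noteq> {}"
      using C cl[of C] cn[of C] cl[OF K(1)] cl[OF K(2)] ne e in_components_nonempty[of C T] by auto
  qed (use T in simp)
  then show ?thesis using eq by simp
qed

text \<open>The map on components induced by an inclusion of \<open>A\<close> in \<open>S\<close>.
  The effect of a new edge on the number of regions is read off from its injectivity and
  surjectivity.\<close>

definition super_component :: "'a::topological_space set \<Rightarrow> 'a set \<Rightarrow> 'a set" where
  "super_component S C = (SOME K. K \<in> components S \<and> C \<subseteq> K)"

lemma super_component:
  assumes "C \<in> components A" "A \<subseteq> S"
  shows "super_component S C \<in> components S" "C \<subseteq> super_component S C"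
proof -
  have "C \<subseteq> S" "connected C" "C \<noteq> {}"
    using assms in_components_subset in_components_connected in_components_nonempty by blast+
  then obtain K where "K \<in> components S \<and> C \<subseteq> K" using exists_component_superset by blast
  then have "super_component S C \<in> components S \<and> C \<subseteq> super_component S C"
    unfolding super_component_def by (rule someI)
  then show "super_component S C \<in> components S" "C \<subseteq> super_component S C" by auto
qed

lemma super_component_eq:
  assumes "C \<in> components A" "A \<subseteq> S" "K \<in> components S" "C \<inter> K \<noteq> {}"
  shows "super_component S C = K"
  using super_component[OF assms(1,2)] assms(3,4) components_nonoverlap[of K S "super_component S C"] by blast

lemma in_same_componentD:
  "K \<in> components S \<Longrightarrow> a \<in> K \<Longrightarrow> b \<in> K \<Longrightarrow> connected_component S a b"
  unfolding connected_component_def using in_components_connected in_components_subset by blast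

lemma in_same_componentI:
  assumes "C \<in> components S" "a \<in> C" "connected_component S a b"
  shows "b \<in> C"
proof -
  obtain t where "connected t" "t \<subseteq> S" "a \<in> t" "b \<in> t"
    using assms(3) unfolding connected_component_def by blast
  then show ?thesis using components_maximal[of C S t] assms by blast
qed

lemma component_of_point: "x \<in> S \<Longrightarrow> \<exists>C\<in>components S. x \<in> C"
  using Union_components[of S] by blast

text \<open>\<open>e\<close> meets \<open>Ku\<close> only in \<open>u\<close> and the rest of \<open>T\<close> only in \<open>v\<close>, so Janiszewski's theorem
  applies twice.\<close>

lemma connected_component_compl_Un_arc:
  fixes T :: "complex set"
  assumes T: "compact T" "finite (components T)" and g: "arc g" and e: "e = path_image g"
    and uv: "e \<inter> T = {u, v}" and K: "Ku \<in> components T" "u \<in> Ku" "v \<notin> Ku"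
    and ab: "connected_component (- T) a b" "a \<notin> e" "b \<notin> e"
  shows "connected_component (- (T \<union> e)) a b"
proof -
  define L where "L = \<Union>(components T - {Ku})"
  have cl: "compact C" if "C \<in> components T" for C
    using compact_components[OF T(1) that] .
  have L: "compact L" unfolding L_def using T cl by (intro compact_Union) auto
  have "\<Union>(components T) = Ku \<union> L" unfolding L_def using K(1) by blast
  then have TU: "T = Ku \<union> L" by simp
  have dj: "Ku \<inter> L = {}" unfolding L_def using components_nonoverlap K(1) by fast
  have uT: "u \<in> e" "v \<in> e" "u \<in> T" "v \<in> T" using uv by auto
  have Kue: "Ku \<inter> e = {u}" using uv K(2,3) uT unfolding TU by fast
  have Le: "L \<inter> e = {v}" using uv K(2,3) uT dj unfolding TU by fast
  have conn: "connected_component (- S) a b" if "S \<subseteq> T" for S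
    using ab(1) that unfolding connected_component_def by (meson Compl_subset_Compl_iff order_trans)
  have e': "compact e" "connected (- e)"
    using g e by (auto simp: compact_arc_image connected_arc_complement)
  have e'': "connected_component (- e) a b"
    using e'(2) ab(2,3) by (simp add: connected_iff_connected_component)
  have Kuc: "compact Ku" by (rule cl[OF K(1)])
  have KL: "connected_component (- Ku) a b" "connected_component (- L) a b"
    using TU by (auto intro!: conn)
  have KeL: "(Ku \<union> e) \<inter> L = {v}" using Le dj by blast
  have Ke: "connected_component (- (Ku \<union> e)) a b"
    by (rule Janiszewski[OF Kuc compact_imp_closed[OF e'(1)] _ KL(1) e'']) (simp add: Kue)
  have "connected_component (- ((Ku \<union> e) \<union> L)) a b"
    by (rule Janiszewski[OF compact_Un[OF Kuc e'(1)] compact_imp_closed[OF L] _ Ke KL(2)]) (simp only: KeL connected_sing)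
  moreover have "(Ku \<union> e) \<union> L = T \<union> e" unfolding TU by blast
  ultimately show ?thesis by simp
qed

text \<open>Points of one region of \<open>- T\<close> stay connected after \<open>e\<close> is
  added, so no region is split and \<open>super_component\<close> is injective.\<close>

lemma card_components_bridge:
  fixes T :: "complex set"
  assumes T: "compact T" "finite (components T)" and g: "arc g" and e: "e = path_image g"
    and uv: "e \<inter> T = {u, v}" and K: "Ku \<in> components T" "u \<in> Ku" "v \<notin> Ku"
    and fin: "finite (components (- T))"
  shows "finite (components (- (T \<union> e))) \<and> card (components (- (T \<union> e))) \<le> card (components (- T))"
proof -
  let ?\<phi> = "super_component (- T)"
  have sub: "- (T \<union> e) \<subseteq> - T" by blast
  have "inj_on ?\<phi> (components (- (T \<union> e)))"
  proof (rule inj_onI)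
    fix C C' assume C: "C \<in> components (- (T \<union> e))" "C' \<in> components (- (T \<union> e))" "?\<phi> C = ?\<phi> C'"
    obtain a b where ab: "a \<in> C" "b \<in> C'"
      using in_components_nonempty[OF C(1)] in_components_nonempty[OF C(2)] by (metis ex_in_conv)
    then have "a \<in> - (T \<union> e)" "b \<in> - (T \<union> e)"
      using in_components_subset[OF C(1)] in_components_subset[OF C(2)] by blast+
    moreover have "connected_component (- T) a b"
      using super_component[OF C(1) sub] super_component(2)[OF C(2) sub] ab
      unfolding C(3)[symmetric] by (intro in_same_componentD[of "?\<phi> C"]) (auto intro: subsetD)
    ultimately have "connected_component (- (T \<union> e)) a b"
      using connected_component_compl_Un_arc[OF T g e uv K] by blast
    then show "C = C'" using in_same_componentI C(1) ab(1) components_nonoverlap[OF C(1,2)] ab by blast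
  qed
  moreover have "?\<phi> ` components (- (T \<union> e)) \<subseteq> components (- T)"
    by (auto intro: super_component(1)[OF _ sub])
  ultimately show ?thesis using fin inj_on_finite[of ?\<phi>] card_inj_on_le[of ?\<phi>] by metis
qed

text \<open>An open region is never swallowed by an arc, so each one keeps a point off
  \<open>e\<close>.\<close>

lemma super_component_surj:
  fixes T :: "complex set"
  assumes T: "closed T" and g: "arc g" and e: "e = path_image g"
  shows "super_component (- T) ` components (- (T \<union> e)) = components (- T)"
proof
  have sub: "- (T \<union> e) \<subseteq> - T" by blast
  show "super_component (- T) ` components (- (T \<union> e)) \<subseteq> components (- T)"
    by (auto intro: super_component(1)[OF _ sub])
  show "components (- T) \<subseteq> super_component (- T) ` components (- (T \<union> e))"
  proof
    fix K assume K: "K \<in> components (- T)"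
    obtain x where x: "x \<in> K" "x \<notin> e"
      using open_components[OF open_Compl[OF T] K] in_components_nonempty[OF K] open_subset_arc_empty[OF g, of K] e by blast
    then obtain C where C: "C \<in> components (- (T \<union> e))" "x \<in> C"
      using in_components_subset[OF K] x component_of_point[of x "- (T \<union> e)"] by blast
    then show "K \<in> super_component (- T) ` components (- (T \<union> e))"
      using super_component_eq[OF C(1) sub K] x C by blast
  qed
qed

lemma card_components_arc_mono:
  fixes T :: "complex set"
  assumes T: "closed T" and g: "arc g" and e: "e = path_image g"
    and fin: "finite (components (- (T \<union> e)))"
  shows "card (components (- T)) \<le> card (components (- (T \<union> e)))"
  using super_component_surj[OF assms(1-3)] fin by (metis card_image_le)

text \<open>The edge and an arc inside \<open>K\<close> form a Jordan curve \<open>J\<close>. The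
  region of \<open>- T\<close> through which \<open>e\<close> runs meets both the inside and the
  outside of \<open>J\<close>, so it is the image of two different regions under
  \<open>super_component\<close>.\<close>

lemma card_components_chord_ge:
  fixes T :: "complex set"
  assumes T: "closed T" and g: "arc g" and e: "e = path_image g"
    and uv: "e \<inter> T = {pathstart g, pathfinish g}"
    and K: "path_connected K" "K \<subseteq> T" "pathstart g \<in> K" "pathfinish g \<in> K"
    and fin: "finite (components (- (T \<union> e)))"
  shows "card (components (- T)) + 1 \<le> card (components (- (T \<union> e)))"
proof -
  let ?\<phi> = "super_component (- T)"
  let ?\<C> = "components (- (T \<union> e))"
  have sub: "- (T \<union> e) \<subseteq> - T" by blast
  have ne: "pathfinish g \<noteq> pathstart g" using g arc_distinct_ends by metis
  \<comment> \<open>Path connectedness of \<open>K\<close>, not mere connectedness, is what supplies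
    the return arc.\<close>
  have "\<exists>h. arc h \<and> path_image h \<subseteq> K \<and> pathstart h = pathfinish g \<and> pathfinish h = pathstart g"
    using K(1) K(3,4) ne unfolding path_connected_arcwise by simp
  then obtain h where h: "arc h" "path_image h \<subseteq> K" "pathstart h = pathfinish g" "pathfinish h = pathstart g"
    by blast
  have sp: "simple_path (g +++ h)"
    using uv e h K g h by (intro simple_path_join_loop) auto
  define J where "J = path_image (g +++ h)"
  have J: "J = e \<union> path_image h" using h e by (simp add: J_def path_image_join)
  have JT: "J \<subseteq> T \<union> e" using J h K by blast
  note jordan = Jordan_inside_outside[OF sp, folded J_def]
  have loop: "pathfinish (g +++ h) = pathstart (g +++ h)" using h by simp
  have j: "open (inside J)" "open (outside J)" "inside J \<inter> outside J = {}"
    "inside J \<union> outside J = - J" "frontier (inside J) = J" "frontier (outside J) = J"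
    using jordan[OF loop] by auto
  obtain p where p: "p \<in> e" "p \<notin> T"
    using nonempty_simple_path_endless[OF arc_imp_simple_path[OF g]] uv e by blast
  obtain M where M: "M \<in> components (- T)" "p \<in> M" using component_of_point[of p "- T"] p by blast
  have oM: "open M" using open_components[OF open_Compl[OF T] M(1)] .
  have pJ: "p \<in> J" using p J by blast
  have "p \<in> closure (inside J)" using pJ j(5) unfolding frontier_def by blast
  then obtain a where a: "a \<in> inside J" "a \<in> M" using open_Int_closure_eq_empty[OF oM] M(2) by blast
  have "p \<in> closure (outside J)" using pJ j(6) unfolding frontier_def by blast
  then obtain b where b: "b \<in> outside J" "b \<in> M" using open_Int_closure_eq_empty[OF oM] M(2) by blast
  have MT: "M \<inter> T = {}" using in_components_subset[OF M(1)] by blast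
  have "a \<notin> T \<union> e" "b \<notin> T \<union> e" using a b MT j(4) J by blast+
  then obtain A B where A: "A \<in> ?\<C>" "a \<in> A" and B: "B \<in> ?\<C>" "b \<in> B"
    using component_of_point[of _ "- (T \<union> e)"] by (metis ComplI)
  have "A \<noteq> B"
  proof
    assume "A = B"
    have cA: "connected A" "A \<subseteq> - (T \<union> e)"
      using in_components_connected[OF A(1)] in_components_subset[OF A(1)] .
    then have "A \<subseteq> inside J \<union> outside J" using j(4) JT by blast
    moreover have "inside J \<inter> outside J \<inter> A = {}" "inside J \<inter> A \<noteq> {}" "outside J \<inter> A \<noteq> {}"
      using j(3) A B \<open>A = B\<close> a b by blast+
    ultimately show False using connectedD[OF cA(1) j(1,2)] by blast
  qed
  have "?\<phi> A = M" "?\<phi> B = M"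
    using super_component_eq[OF A(1) sub M(1)] super_component_eq[OF B(1) sub M(1)] A B a b by blast+
  moreover have "B \<in> ?\<C> - {A}" using B \<open>A \<noteq> B\<close> by blast
  ultimately have "?\<phi> A \<in> ?\<phi> ` (?\<C> - {A})" by (metis imageI)
  then have "?\<phi> ` (?\<C> - {A}) = ?\<phi> ` ?\<C>"
    using A(1) by (metis image_insert insert_Diff insert_absorb)
  then have "card (components (- T)) \<le> card (?\<C> - {A})"
    using super_component_surj[OF T g e] fin by (metis card_image_le finite_Diff)
  moreover have "card (?\<C> - {A}) + 1 = card ?\<C>"
    using A(1) fin by (metis Suc_eq_plus1 card_Suc_Diff1)
  ultimately show ?thesis by linarith
qed

text \<open>Every component cut off by \<open>e\<close> has a frontier point in the interior of \<open>e\<close>, hence contains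
  one of the two sides of \<open>e\<close>.\<close>

lemma card_components_chord_le:
  fixes T :: "complex set"
  assumes T: "closed T" and g: "arc g" and e: "e = path_image g"
    and uv: "e \<inter> T = {pathstart g, pathfinish g}"
    and AB: "connected A" "connected B" "A \<inter> (T \<union> e) = {}" "B \<inter> (T \<union> e) = {}"
    and sides: "\<And>p. p \<in> e - {pathstart g, pathfinish g} \<Longrightarrow> \<exists>U. open U \<and> p \<in> U \<and> U - e \<subseteq> A \<union> B"
    and fin: "finite (components (- T))"
  shows "finite (components (- (T \<union> e))) \<and> card (components (- (T \<union> e))) \<le> card (components (- T)) + 1"
proof -
  let ?\<C> = "components (- (T \<union> e))"
  let ?e = "e - {pathstart g, pathfinish g}"
  have e_conn: "connected ?e" "?e \<noteq> {}"
    unfolding e using g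
    by (simp_all only: connected_simple_path_endless nonempty_simple_path_endless arc_imp_simple_path not_False_eq_True)
  have eT: "?e \<subseteq> - T" using uv by blast
  then obtain M where M: "M \<in> components (- T)" "?e \<subseteq> M"
    using e_conn exists_component_superset[OF eT _ e_conn(1)] by blast
  have cT: "closed (T \<union> e)" using T g e by (simp add: closed_Un closed_arc_image)
  have old: "C \<in> components (- T) - {M} \<or> C \<inter> A \<noteq> {} \<or> C \<inter> B \<noteq> {}"
    if C: "C \<in> ?\<C>" for C
  proof (rule ccontr)
    assume *: "\<not> ?thesis"
    have oC: "connected C" "C \<noteq> {}" "C \<subseteq> - (T \<union> e)"
      using in_components_connected[OF C] in_components_nonempty[OF C] in_components_subset[OF C] .
    have front: "frontier C \<subseteq> T \<union> e"
      using frontier_of_components_closed_complement[OF cT C] .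
    have nf: "p \<notin> frontier C" if p: "p \<in> ?e" for p
    proof
      assume "p \<in> frontier C"
      obtain U where U: "open U" "p \<in> U" "U - e \<subseteq> A \<union> B" using sides[OF p] by blast
      moreover have "p \<in> closure C" using \<open>p \<in> frontier C\<close> unfolding frontier_def by blast
      ultimately have "U \<inter> C \<noteq> {}" using open_Int_closure_eq_empty[of U C] by blast
      then show False using U * oC(3) by blast
    qed
    have fT: "frontier C \<subseteq> T" using front nf uv by blast
    have sub: "- (T \<union> e) \<subseteq> - T" by blast
    define K where "K = super_component (- T) C"
    have K: "K \<in> components (- T)" "C \<subseteq> K" using super_component[OF C sub] by (auto simp: K_def)
    \<comment> \<open>With its frontier inside \<open>T\<close>, \<open>C\<close> fills a whole
      region of \<open>- T\<close>. That region is not \<open>M\<close>, because \<open>M\<close>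
      contains the open edge.\<close>
    have "C = K" using connected_Int_frontier[of K C] K fT oC(2) in_components_connected[OF K(1)]
        in_components_subset[OF K(1)] K by blast
    moreover have "C \<noteq> M" using M e_conn(2) oC(3) by blast
    ultimately show False using * K by blast
  qed
  have pick: "\<exists>D. \<forall>C\<in>?\<C>. C \<inter> X \<noteq> {} \<longrightarrow> C = D"
    if X: "connected X" "X \<inter> (T \<union> e) = {}" for X
  proof (cases "X = {}")
    case False
    then obtain D where D: "D \<in> ?\<C>" "X \<subseteq> D"
      using exists_component_superset[of X "- (T \<union> e)"] X False by blast
    then show ?thesis using components_nonoverlap[of _ "- (T \<union> e)" D] by blast
  qed auto
  obtain DA DB where D: "\<forall>C\<in>?\<C>. C \<inter> A \<noteq> {} \<longrightarrow> C = DA" "\<forall>C\<in>?\<C>. C \<inter> B \<noteq> {} \<longrightarrow> C = DB"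
    using pick[OF AB(1,3)] pick[OF AB(2,4)] by blast
  have sub: "?\<C> \<subseteq> insert DA (insert DB (components (- T) - {M}))"
    using old D by blast
  have "card (insert DA (insert DB (components (- T) - {M}))) \<le> card (components (- T) - {M}) + 2"
    using fin by (auto simp: card_insert_if)
  moreover have "card (components (- T) - {M}) + 1 = card (components (- T))"
    using fin M by (metis Suc_eq_plus1 card_Suc_Diff1)
  ultimately show ?thesis
    using sub fin card_mono[OF _ sub] finite_subset[OF sub] by auto
qed

section \<open>Euler's formula for plane graphs\<close>

lemma plane_graph_subset: "plane_graph V E \<Longrightarrow> H \<subseteq> E \<Longrightarrow> plane_graph V H"
  unfolding plane_graph_def by (meson finite_subset subsetD)

lemma plane_graph_edgeE:
  assumes "plane_graph V E" "e \<in> E"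
  obtains g where "arc g" "path_image g = e" "e \<inter> V = {pathstart g, pathfinish g}"
proof -
  obtain u v where "joined_by_arc u v e" "e \<inter> V = {u, v}"
    using assms unfolding plane_graph_def by meson
  then show ?thesis using that unfolding joined_by_arc_def by metis
qed

lemma plane_graph_edge_Int:
  assumes "plane_graph V (insert e H)" "e \<notin> H"
  shows "e \<inter> (V \<union> \<Union>H) = e \<inter> V"
proof -
  have "e \<inter> e' \<subseteq> V" if "e' \<in> H" for e'
  proof -
    have "e \<noteq> e'" using assms(2) that by blast
    then show ?thesis using assms(1) that unfolding plane_graph_def by (meson insertI1 insertI2)
  qed
  then show ?thesis by blast
qed

lemma compact_plane_graph:
  assumes "plane_graph V E"
  shows "compact (V \<union> \<Union>E)"
proof (intro compact_Un compact_Union)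
  fix e assume "e \<in> E"
  then obtain g where "arc g" "path_image g = e" using plane_graph_edgeE[OF assms] by metis
  then show "compact e" using compact_arc_image by blast
qed (use assms in \<open>auto simp: plane_graph_def finite_imp_compact\<close>)

lemma plane_graph_insert_edgeE:
  assumes pg: "plane_graph V (insert e H)" "e \<notin> H" and fin: "finite (components (V \<union> \<Union>H))"
  obtains g Ku Kv where "arc g" "e = path_image g"
    "e \<inter> (V \<union> \<Union>H) = {pathstart g, pathfinish g}"
    "Ku \<in> components (V \<union> \<Union>H)" "pathstart g \<in> Ku"
    "Kv \<in> components (V \<union> \<Union>H)" "pathfinish g \<in> Kv"
    "components (V \<union> \<Union>(insert e H)) = insert (Ku \<union> Kv \<union> e) (components (V \<union> \<Union>H) - {Ku, Kv})"
proof -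
  let ?T = "V \<union> \<Union>H"
  obtain g where g: "arc g" "path_image g = e" "e \<inter> V = {pathstart g, pathfinish g}"
    using plane_graph_edgeE[OF pg(1) insertI1] .
  have i: "e \<inter> ?T = {pathstart g, pathfinish g}"
    using plane_graph_edge_Int[OF pg] g(3) by simp
  then have pT: "pathstart g \<in> ?T" "pathfinish g \<in> ?T" by blast+
  obtain Ku where Ku: "Ku \<in> components ?T" "pathstart g \<in> Ku"
    using component_of_point[OF pT(1)] by blast
  obtain Kv where Kv: "Kv \<in> components ?T" "pathfinish g \<in> Kv"
    using component_of_point[OF pT(2)] by blast
  have cT: "closed ?T"
    using compact_plane_graph[OF plane_graph_subset[OF pg(1)], of H] by (simp add: compact_imp_closed subset_insertI)
  have e: "closed e" "connected e"
    using g by (auto simp: closed_arc_image arc_imp_path connected_path_image)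
  then have "components (?T \<union> e) = insert (Ku \<union> Kv \<union> e) (components ?T - {Ku, Kv})"
    using i Ku(2) Kv(2) by (intro components_Un_connected[OF cT fin e Ku(1) Kv(1)]) auto
  moreover have "?T \<union> e = V \<union> \<Union>(insert e H)" by blast
  ultimately show ?thesis using that[OF g(1) g(2)[symmetric] i Ku Kv] by simp
qed

lemma components_finite:
  fixes V :: "'a::t1_space set"
  assumes "finite V"
  shows "components V = (\<lambda>v. {v}) ` V"
proof -
  have "components (\<Union>((\<lambda>v. {v}) ` V)) = (\<lambda>v. {v}) ` V"
    by (rule components_closed_unique) (use assms in \<open>auto simp: pairwise_def disjnt_def\<close>)
  then show ?thesis by simp
qed

lemma card_components_insert_edge:
  assumes fin: "finite (components T)"
    and K: "Ku \<in> components T" "Kv \<in> components T"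
  shows "card (insert (Ku \<union> Kv \<union> e) (components T - {Ku, Kv})) + (if Ku = Kv then 0 else 1)
    = card (components T)"
proof -
  have "Ku \<noteq> {}" using in_components_nonempty[OF K(1)] .
  have new: "Ku \<union> Kv \<union> e \<notin> components T - {Ku, Kv}"
  proof
    assume *: "Ku \<union> Kv \<union> e \<in> components T - {Ku, Kv}"
    then show False
      using components_nonoverlap[of "Ku \<union> Kv \<union> e" T Ku] K(1) \<open>Ku \<noteq> {}\<close> by blast
  qed
  have "card (components T - {Ku, Kv}) = card (components T) - card {Ku, Kv}"
    using fin K by (intro card_Diff_subset) auto
  moreover have "card {Ku, Kv} \<le> card (components T)"
    using fin K by (intro card_mono) auto
  ultimately show ?thesis
    using new fin by (cases "Ku = Kv") auto
qed

text \<open>The local condition under which an edge closing a cycle cuts its region into at most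
  two. \<open>G\<close> is fixed while the graph grows inside it, so the same \<open>A\<close> and
  \<open>B\<close> serve at whatever stage \<open>e\<close> is added, and also for
  subgraphs.\<close>

definition two_sided :: "complex set \<Rightarrow> complex set \<Rightarrow> complex set \<Rightarrow> bool" where
  "two_sided V G e \<longleftrightarrow> (\<exists>A B. connected A \<and> connected B \<and> A \<inter> G = {} \<and> B \<inter> G = {} \<and>
     (\<forall>p\<in>e - V. \<exists>U. open U \<and> p \<in> U \<and> U - e \<subseteq> A \<union> B))"

text \<open>Besides finiteness, path connectedness of the components is carried through the
  induction, because the lower bound for a cycle-closing edge needs an arc joining its ends in the
  old graph.\<close>

lemma euler_plane_graph:
  assumes "plane_graph V E" "V \<union> \<Union>E \<subseteq> G" "\<And>e. e \<in> E \<Longrightarrow> two_sided V G e"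
  shows "finite (components (V \<union> \<Union>E)) \<and> (\<forall>K\<in>components (V \<union> \<Union>E). path_connected K) \<and>
    finite (components (- (V \<union> \<Union>E))) \<and>
    card (components (- (V \<union> \<Union>E))) + card V = card (components (V \<union> \<Union>E)) + card E + 1"
proof -
  have "finite E" using assms by (simp add: plane_graph_def)
  then show ?thesis using assms
  proof (induction E)
    case empty
    then have V: "finite V" by (auto simp: plane_graph_def)
    moreover have "connected (- V)"
      using connected_open_delete_finite[of UNIV V] V by (simp add: Compl_eq_Diff_UNIV connected_UNIV)
    moreover have "- V \<noteq> {}"
      using V by (metis double_compl finite_compl infinite_UNIV_char_0 Compl_empty_eq)
    ultimately show ?case
      by (simp add: components_eq_sing_iff[THEN iffD2] components_finite card_image)
  next
    case (insert e H)
    define T where "T = V \<union> \<Union>H"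
    have eq: "V \<union> \<Union>(insert e H) = T \<union> e" by (auto simp: T_def)
    have pgH: "plane_graph V H" using plane_graph_subset[OF insert.prems(1)] by blast
    have T: "compact T" unfolding T_def by (rule compact_plane_graph[OF pgH])
    note cT = compact_imp_closed[OF T]
    have fin: "finite (components T)" "\<And>K. K \<in> components T \<Longrightarrow> path_connected K"
      "finite (components (- T))" and IH: "card (components (- T)) + card V = card (components T) + card H + 1"
      using insert.IH[OF pgH] insert.prems unfolding T_def by auto
    obtain g Ku Kv where g: "arc g" "e = path_image g" "e \<inter> T = {pathstart g, pathfinish g}"
      "Ku \<in> components T" "pathstart g \<in> Ku" "Kv \<in> components T" "pathfinish g \<in> Kv"
      "components (T \<union> e) = insert (Ku \<union> Kv \<union> e) (components T - {Ku, Kv})"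
      using plane_graph_insert_edgeE[OF insert.prems(1) insert.hyps(2)] fin(1) unfolding eq T_def by metis
    have e: "path_connected e" "pathstart g \<in> e" "pathfinish g \<in> e"
      using g(1,2) by (simp_all add: arc_imp_path path_connected_path_image pathstart_in_path_image pathfinish_in_path_image)
    have "path_connected ((Ku \<union> e) \<union> Kv)"
      using path_connected_Un[OF fin(2)[OF g(4)] e(1)] g(5) e(2) path_connected_Un[OF _ fin(2)[OF g(6)]] g(7) e(3) by blast
    then have "path_connected (Ku \<union> Kv \<union> e)" by (simp add: ac_simps)
    moreover have "finite (components (- (T \<union> e))) \<and>
      card (components (- (T \<union> e))) = card (components (- T)) + (if Ku = Kv then 1 else 0)"
    \<comment> \<open>With both ends in one component the edge adds a region; otherwise it merges
      two components and adds none.\<close>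
    proof (cases "Ku = Kv")
      case True
      have "two_sided V G e" using insert.prems(3) by blast
      then obtain A B where AB: "connected A" "connected B" "A \<inter> G = {}" "B \<inter> G = {}"
        "\<forall>p\<in>e - V. \<exists>U. open U \<and> p \<in> U \<and> U - e \<subseteq> A \<union> B"
        unfolding two_sided_def by (elim exE conjE)
      have "e \<inter> V = {pathstart g, pathfinish g}"
        using plane_graph_edge_Int[OF insert.prems(1) insert.hyps(2)] g(3) by (simp add: T_def)
      then have eV: "e - {pathstart g, pathfinish g} = e - V" by blast
      have "T \<union> e \<subseteq> G" using insert.prems(2) unfolding eq .
      then have "A \<inter> (T \<union> e) = {}" "B \<inter> (T \<union> e) = {}" using AB by blast+
      then have "finite (components (- (T \<union> e))) \<and>
        card (components (- (T \<union> e))) \<le> card (components (- T)) + 1"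
        using card_components_chord_le[OF cT g(1-3) AB(1,2) _ _ _ fin(3)] AB(5)[rule_format]
        unfolding eV by simp
      then show ?thesis
        using card_components_chord_ge[OF cT g(1-3) fin(2)[OF g(4)] in_components_subset[OF g(4)] g(5)] g(7) True
        by simp
    next
      case False
      then have "pathfinish g \<notin> Ku"
        using components_nonoverlap[OF g(4,6)] g(7) by blast
      then show ?thesis
        using card_components_bridge[OF T fin(1) g(1-5) _ fin(3)] card_components_arc_mono[OF cT g(1,2)] False
        by (simp add: le_antisym)
    qed
    ultimately show ?case
      using IH insert.hyps card_components_insert_edge[OF fin(1) g(4,6), of e] fin(1,2)
      unfolding eq g(8) by (auto split: if_splits)
  qed
qed

section \<open>Jordan curves, theta graphs and topological discs\<close>

lemma region_eq_inside:
  fixes F :: "complex set"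
  assumes c: "simple_path c" "pathfinish c = pathstart c"
    and F: "connected F" "bounded F" "F \<noteq> {}" "frontier F \<subseteq> path_image c" "F \<inter> path_image c = {}"
  shows "F = inside (path_image c)"
proof -
  let ?J = "path_image c"
  note j = Jordan_inside_outside[OF c]
  \<comment> \<open>A connected set that avoids the curve cannot cross the frontier of
    \<open>F\<close>. Applied to the outside this contradicts boundedness, applied to the inside it
    gives the missing inclusion.\<close>
  have comp: "X \<subseteq> F" if "connected X" "X \<inter> ?J = {}" "X \<inter> F \<noteq> {}" for X
    using connected_Int_frontier[of X F] that F(4) by blast
  have "inside ?J \<inter> ?J = {}" "outside ?J \<inter> ?J = {}"
    by (simp_all add: inside_no_overlap outside_no_overlap)
  have "outside ?J \<inter> F = {}"
  proof (rule ccontr)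
    assume "outside ?J \<inter> F \<noteq> {}"
    then have "outside ?J \<subseteq> F" using comp j by (simp add: outside_no_overlap)
    then show False using j F(2) bounded_subset by blast
  qed
  then have FI: "F \<subseteq> inside ?J" using j F(5) by blast
  moreover have "inside ?J \<subseteq> F"
    using comp[of "inside ?J"] j FI F(3) by (simp add: inside_no_overlap) blast
  ultimately show ?thesis by blast
qed

lemma Jordan_two_arcs:
  assumes "arc g" "arc h" "pathstart h = pathstart g" "pathfinish h = pathfinish g"
    and "path_image g \<inter> path_image h \<subseteq> {pathstart g, pathfinish g}"
  shows "\<exists>c. simple_path c \<and> pathfinish c = pathstart c \<and> path_image c = path_image g \<union> path_image h"
proof (intro exI conjI)
  show "simple_path (g +++ reversepath h)"
    using assms by (intro simple_path_join_loop) (auto simp: arc_reversepath)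
qed (use assms in \<open>simp_all add: path_image_join\<close>)

text \<open>By Janiszewski's theorem the complement of the theta graph has just the three components
  \<open>F1\<close>, \<open>F2\<close> and the exterior;
    if the middle arc were outside \<open>p1 \<union> p2\<close>, the inside of
  \<open>p1 \<union> p2\<close> would be a fourth one.\<close>

lemma theta_inside:
  fixes g p1 p2 :: "real \<Rightarrow> complex"
  assumes arcs: "arc g" "arc p1" "arc p2"
    and st: "pathstart g = a" "pathstart p1 = a" "pathstart p2 = a"
    and fi: "pathfinish g = b" "pathfinish p1 = b" "pathfinish p2 = b"
    and int: "path_image g \<inter> path_image p1 = {a, b}" "path_image g \<inter> path_image p2 = {a, b}"
      "path_image p1 \<inter> path_image p2 = {a, b}"
    and F1: "F1 = inside (path_image g \<union> path_image p1)" "F1 \<inter> path_image p2 = {}"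
    and F2: "F2 = inside (path_image g \<union> path_image p2)" "F2 \<inter> path_image p1 = {}"
    and disj: "F1 \<inter> F2 = {}"
  shows "F1 \<union> F2 \<union> (path_image g - {a, b}) = inside (path_image p1 \<union> path_image p2)"
proof -
  define G P1 P2 where "G = path_image g" and "P1 = path_image p1" and "P2 = path_image p2"
  note defs = G_def[symmetric] P1_def[symmetric] P2_def[symmetric]
  have ab: "a \<noteq> b" using arc_distinct_ends[OF arcs(1)] st fi by simp
  have i: "G \<inter> P1 = {a, b}" "G \<inter> P2 = {a, b}" "P1 \<inter> P2 = {a, b}"
    using int by (simp_all add: defs)
  have F: "F1 = inside (G \<union> P1)" "F2 = inside (G \<union> P2)" "F1 \<inter> P2 = {}" "F2 \<inter> P1 = {}"
    using F1 F2 by (simp_all add: defs)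
  obtain c1 where c1: "simple_path c1" "pathfinish c1 = pathstart c1" "path_image c1 = G \<union> P1"
    using Jordan_two_arcs[of g p1] arcs st fi int unfolding defs by auto
  obtain c2 where c2: "simple_path c2" "pathfinish c2 = pathstart c2" "path_image c2 = G \<union> P2"
    using Jordan_two_arcs[of g p2] arcs st fi int unfolding defs by auto
  obtain c3 where c3: "simple_path c3" "pathfinish c3 = pathstart c3" "path_image c3 = P1 \<union> P2"
    using Jordan_two_arcs[of p1 p2] arcs st fi int unfolding defs by auto
  note j1 = Jordan_inside_outside[OF c1(1,2), unfolded c1(3)]
  note j2 = Jordan_inside_outside[OF c2(1,2), unfolded c2(3)]
  note j3 = Jordan_inside_outside[OF c3(1,2), unfolded c3(3)]
  define I where "I = inside (P1 \<union> P2)"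
  define W where "W = - ((G \<union> P1 \<union> F1) \<union> (G \<union> P2 \<union> F2))"
  have gF: "(G \<union> P1) \<inter> F1 = {}" "(G \<union> P2) \<inter> F2 = {}" "I \<inter> (P1 \<union> P2) = {}"
    unfolding F(1,2) I_def using inside_no_overlap by (metis inf_commute)+
  have C1: "- (G \<union> P1 \<union> F1) = outside (G \<union> P1)"
    unfolding F(1) using j1 by blast
  have C2: "- (G \<union> P2 \<union> F2) = outside (G \<union> P2)"
    unfolding F(2) using j2 by blast
  have cl: "closed (G \<union> P1 \<union> F1)" "closed (G \<union> P2 \<union> F2)"
    unfolding closed_def C1 C2 using j1 j2 by simp_all
  have "bounded G" "bounded P1" "bounded P2" "bounded F1" "bounded F2"
    using j1 j2 arcs by (simp_all add: G_def P1_def P2_def F bounded_arc_image)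
  then have cpt: "compact (G \<union> P1 \<union> F1)" "compact (G \<union> P2 \<union> F2)"
    using cl by (simp_all add: compact_eq_bounded_closed)
  have CC: "(G \<union> P1 \<union> F1) \<inter> (G \<union> P2 \<union> F2) = G"
    using i(1) i(3) F(3,4) gF(1,2) disj by (auto simp: disjoint_iff)
  have W: "connected W"
    unfolding W_def
  proof (rule Janiszewski_connected[OF cpt(1) cl(2)])
    show "connected ((G \<union> P1 \<union> F1) \<inter> (G \<union> P2 \<union> F2))"
      unfolding CC using arcs(1) by (simp add: G_def arc_imp_path connected_path_image)
    show "connected (- (G \<union> P1 \<union> F1))" "connected (- (G \<union> P2 \<union> F2))"
      unfolding C1 C2 using j1 j2 by simp_all
  qed
  have unb: "\<not> bounded W"
    using cobounded_imp_unbounded[of W] compact_imp_bounded[OF compact_Un[OF cpt]]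
    unfolding W_def by simp
  have "G \<inter> I \<noteq> {}"
  proof
    assume *: "G \<inter> I = {}"
    then have I: "I \<subseteq> F1 \<union> F2 \<union> W" unfolding W_def using gF(3) by blast
    have I': "connected I" "I \<noteq> {}" "bounded I" "frontier I = P1 \<union> P2"
      unfolding I_def using j3 by simp_all
    have front: "frontier F1 = G \<union> P1" "frontier F2 = G \<union> P2" "connected F1" "connected F2"
      unfolding F using j1 j2 by simp_all
    have sub: "X \<subseteq> Y"
      if "connected X" "X \<inter> frontier Y = {}" "X \<inter> Y \<noteq> {}" for X Y :: "complex set"
      using connected_Int_frontier[of X Y] that by blast
    obtain q where q: "q \<in> P1" "q \<notin> {a, b}"
      using nonempty_simple_path_endless[OF arc_imp_simple_path[OF arcs(2)]] st fi unfolding P1_def by auto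
    obtain r where r: "r \<in> P2" "r \<notin> {a, b}"
      using nonempty_simple_path_endless[OF arc_imp_simple_path[OF arcs(3)]] st fi unfolding P2_def by auto
    obtain z where "z \<in> I" using I'(2) by blast
    then consider "I \<inter> F1 \<noteq> {}" | "I \<inter> F2 \<noteq> {}" | "I \<inter> W \<noteq> {}"
      using I by (metis IntI UnE empty_iff subsetD)
    then show False
    proof cases
      \<comment> \<open>\<open>I\<close> and \<open>F1\<close> contain each other, so their
        frontiers agree; but \<open>P2\<close> has a point off \<open>G \<union> P1\<close>.\<close>
      case 1
      have "F1 \<inter> (P1 \<union> P2) = {}" "F1 \<inter> I \<noteq> {}" using gF F(3) 1 by (auto simp: disjoint_iff)
      then have "F1 \<subseteq> I" using sub[OF front(3), of I] I'(4) by metis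
      moreover have "I \<inter> (G \<union> P1) = {}" using * gF(3) by (auto simp: disjoint_iff)
      ultimately have "frontier I = frontier F1" using sub[OF I'(1), of F1] front(1) 1 by simp
      then show False using front(1) I'(4) r(1) r i by auto
    next
      case 2
      have "F2 \<inter> (P1 \<union> P2) = {}" "F2 \<inter> I \<noteq> {}" using gF F(4) 2 by (auto simp: disjoint_iff)
      then have "F2 \<subseteq> I" using sub[OF front(4), of I] I'(4) by metis
      moreover have "I \<inter> (G \<union> P2) = {}" using * gF(3) by (auto simp: disjoint_iff)
      ultimately have "frontier I = frontier F2" using sub[OF I'(1), of F2] front(2) 2 by simp
      then show False using front(2) I'(4) q(1) q i by auto
    next
      case 3
      have "W \<inter> frontier I = {}" "W \<inter> I \<noteq> {}" unfolding I'(4) using 3 by (auto simp: W_def)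
      then have "W \<subseteq> I" by (rule sub[OF W])
      then show False using unb I'(3) bounded_subset by metis
    qed
  qed
  then have ne: "path_image g \<inter> inside (path_image p1 \<union> path_image p2) \<noteq> {}"
    by (simp add: I_def G_def P1_def P2_def)
  have int': "path_image p1 \<inter> path_image g = {a, b}" "path_image p2 \<inter> path_image g = {a, b}"
    using int by blast+
  have eq: "path_image p1 \<union> path_image g = path_image g \<union> path_image p1"
    "path_image p2 \<union> path_image g = path_image g \<union> path_image p2" by blast+
  show ?thesis
    by (rule split_inside_simple_closed_curve[OF
          arc_imp_simple_path[OF arcs(2)] st(2) fi(2) arc_imp_simple_path[OF arcs(3)] st(3) fi(3)
          arc_imp_simple_path[OF arcs(1)] st(1) fi(1) ab int(3) int' ne])
      (simp add: eq F1(1) F2(1))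
qed

text \<open>Invariance of domain puts the image of the open round disc into
  \<open>interior D\<close>, so interiors and frontiers of the two discs correspond; the Jordan
  curve is the image of the circle.\<close>

lemma topological_disc_interior:
  fixes D :: "complex set"
  assumes "D homeomorphic cball (0::complex) 1"
  shows "compact D" "connected (interior D)" "interior D \<noteq> {}"
    and "\<exists>c. simple_path c \<and> pathfinish c = pathstart c \<and> path_image c = frontier D"
proof -
  show cD: "compact D" using assms homeomorphic_compactness compact_cball by blast
  obtain h k where hk: "homeomorphism (cball (0::complex) 1) D h k"
    using assms homeomorphic_sym homeomorphic_def by metis
  have "continuous_on (ball 0 1) h"
    using homeomorphism_cont1[OF hk] by (rule continuous_on_subset) simp
  moreover have "inj_on h (cball 0 1)"
    using homeomorphism_apply1[OF hk] by (rule inj_on_inverseI)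
  then have "inj_on h (ball 0 1)" by (rule inj_on_subset) auto
  ultimately have "open (h ` ball 0 1)" using invariance_of_domain[OF _ open_ball] by blast
  moreover have "h ` ball 0 1 \<subseteq> D" using hk unfolding homeomorphism_def by auto
  ultimately have "h ` ball 0 1 \<subseteq> interior D" by (rule interior_maximal[rotated])
  then show ne: "interior D \<noteq> {}" by auto
  have ic: "interior (cball (0::complex) 1) \<noteq> {}" by simp
  have "interior D homeomorphic ball (0::complex) 1"
    using homeomorphic_interiors[OF assms] ne ic by simp
  then show "connected (interior D)" using homeomorphic_connectedness connected_ball by blast
  have "frontier D homeomorphic sphere (0::complex) 1"
    using homeomorphic_frontiers[OF assms] cD ne ic by (simp add: compact_imp_closed frontier_cball)
  then obtain f f' where f: "homeomorphism (sphere (0::complex) 1) (frontier D) f f'"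
    using homeomorphic_sym homeomorphic_def by metis
  let ?c = "f \<circ> circlepath 0 1"
  have "simple_path ?c"
  proof (rule simple_path_continuous_image)
    show "continuous_on (path_image (circlepath 0 1)) f" "inj_on f (path_image (circlepath 0 1))"
      using f by (auto simp: homeomorphism_def intro: inj_on_inverseI[of _ f'])
  qed (simp add: simple_path_circlepath)
  moreover have "pathfinish ?c = pathstart ?c"
    by (metis pathfinish_circlepath pathfinish_compose pathstart_circlepath pathstart_compose)
  moreover have "path_image ?c = frontier D"
    using f by (simp add: path_image_compose homeomorphism_def)
  ultimately show "\<exists>c. simple_path c \<and> pathfinish c = pathstart c \<and> path_image c = frontier D" by blast
qed

lemma plane_graph_edge_unique:
  "plane_graph V E \<Longrightarrow> e \<in> E \<Longrightarrow> e' \<in> E \<Longrightarrow> p \<in> e \<Longrightarrow> p \<in> e' \<Longrightarrow> p \<notin> V \<Longrightarrow> e = e'"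
  unfolding plane_graph_def by (meson IntI subsetD)

lemma plane_graph_ends_inj:
  "plane_graph V E \<Longrightarrow> e \<in> E \<Longrightarrow> e' \<in> E \<Longrightarrow> e \<inter> V = e' \<inter> V \<Longrightarrow> e = e'"
  unfolding plane_graph_def by meson

lemma plane_graph_ends:
  assumes "plane_graph V E" "e \<in> E"
  shows "\<exists>u v. u \<in> V \<and> v \<in> V \<and> u \<noteq> v \<and> e \<inter> V = {u, v}"
proof -
  obtain g where g: "arc g" "e \<inter> V = {pathstart g, pathfinish g}"
    using plane_graph_edgeE[OF assms] by metis
  then have "pathstart g \<in> V" "pathfinish g \<in> V" by blast+
  then show ?thesis using g arc_distinct_ends by metis
qed

lemma plane_graph_arc:
  assumes "plane_graph V E" "e \<in> E" "e \<inter> V = {u, v}"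
  shows "\<exists>g. arc g \<and> path_image g = e \<and> pathstart g = u \<and> pathfinish g = v"
proof -
  obtain g where g: "arc g" "path_image g = e" "e \<inter> V = {pathstart g, pathfinish g}"
    using plane_graph_edgeE[OF assms(1,2)] .
  then consider "pathstart g = u" "pathfinish g = v" | "pathstart g = v" "pathfinish g = u"
    using assms(3) by (metis doubleton_eq_iff)
  then show ?thesis
  proof cases
    case 2
    then have "arc (reversepath g) \<and> path_image (reversepath g) = e \<and>
        pathstart (reversepath g) = u \<and> pathfinish (reversepath g) = v"
      using g by (simp add: arc_reversepath)
    then show ?thesis by blast
  qed (use g in blast)
qed

lemma plane_graph_edge:
  assumes "plane_graph V E" "e \<in> E"
  shows "closed e" "connected e" "connected (e - V)" "e - V \<noteq> {}"
proof -
  obtain g where g: "arc g" "path_image g = e" "e \<inter> V = {pathstart g, pathfinish g}"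
    using plane_graph_edgeE[OF assms] .
  then have eq: "e - V = path_image g - {pathstart g, pathfinish g}" by blast
  show "closed e" "connected e"
    using g(1) closed_arc_image connected_path_image arc_imp_path unfolding g(2)[symmetric] by blast+
  show "connected (e - V)" "e - V \<noteq> {}"
    unfolding eq using connected_simple_path_endless nonempty_simple_path_endless arc_imp_simple_path[OF g(1)]
    by blast+
qed

text \<open>For edges leaving an induced subgraph: without the end that may lie in the subgraph they
  remain connected.\<close>

lemma arc_minus_start_connected:
  assumes "arc g"
  shows "connected (path_image g - {pathstart g})"
proof -
  have "path_image g - {pathstart g} = g ` {0<..1}"
  proof -
    have "g t \<noteq> g 0" if "t \<in> {0<..1}" for t
      using assms that unfolding arc_def inj_on_def by force
    moreover have "{0..1} = insert 0 {0<..1::real}" by auto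
    ultimately show ?thesis unfolding path_image_def pathstart_def by auto
  qed
  moreover have "continuous_on {0<..1} g"
    using assms unfolding arc_def path_def by (auto intro: continuous_on_subset)
  ultimately show ?thesis by (simp add: connected_continuous_image)
qed

lemma simple_cycle_edges:
  assumes pg: "plane_graph V E" and sc: "simple_cycle V E vs C"
  shows "C \<subseteq> E" "V \<inter> \<Union>C = set vs" "card C = length vs"
    "e \<in> E \<Longrightarrow> e \<subseteq> \<Union>C \<Longrightarrow> e \<in> C" "v \<in> set vs \<Longrightarrow> \<exists>e\<in>C. v \<in> e"
proof -
  obtain es where es: "length es = length vs" "set es = C" "C \<subseteq> E"
    "\<forall>i<length vs. es ! i \<inter> V = {vs ! i, vs ! (Suc i mod length vs)}"
    and len: "3 \<le> length vs" and dist: "distinct vs" and vsV: "set vs \<subseteq> V"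
    using sc unfolding simple_cycle_def by blast
  show "C \<subseteq> E" by (fact es(3))
  have in_es: "vs ! i \<in> es ! i" if "i < length vs" for i
    using es(4) that by blast
  show on: "\<exists>e\<in>C. v \<in> e" if "v \<in> set vs" for v
    using that in_es es(1,2) by (metis in_set_conv_nth nth_mem)
  show "V \<inter> \<Union>C = set vs"
  proof
    show "V \<inter> \<Union>C \<subseteq> set vs"
    proof
      fix v assume v: "v \<in> V \<inter> \<Union>C"
      then obtain i where i: "i < length vs" "v \<in> es ! i"
        using es(1,2) by (metis IntE UnionE in_set_conv_nth)
      then have "v \<in> {vs ! i, vs ! (Suc i mod length vs)}" using es(4) v by blast
      moreover have "Suc i mod length vs < length vs" using len by (intro mod_less_divisor) linarith
      ultimately show "v \<in> set vs" using i nth_mem by blast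
    qed
    show "set vs \<subseteq> V \<inter> \<Union>C" using on vsV by blast
  qed
  have "distinct es"
    unfolding distinct_conv_nth
  proof (intro allI impI)
    fix i j assume ij: "i < length es" "j < length es" "i \<noteq> j"
    show "es ! i \<noteq> es ! j"
    proof
      assume "es ! i = es ! j"
      then have eq: "{vs ! i, vs ! (Suc i mod length vs)} = {vs ! j, vs ! (Suc j mod length vs)}"
        using es(1,4) ij by metis
      have lt: "Suc i mod length vs < length vs" "Suc j mod length vs < length vs" "i < length vs" "j < length vs"
        using len ij es(1) by (linarith | intro mod_less_divisor)+
      have "vs ! i \<noteq> vs ! j" using ij dist es(1) by (simp add: nth_eq_iff_index_eq)
      \<comment> \<open>A repeated edge makes \<open>i\<close> and \<open>j\<close> cyclic
        successors of each other, which is possible only in a cycle of length 2.\<close>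
      then have "vs ! i = vs ! (Suc j mod length vs)" "vs ! j = vs ! (Suc i mod length vs)"
        using eq by (auto simp: doubleton_eq_iff)
      then have "i = Suc j mod length vs" "j = Suc i mod length vs"
        using dist lt by (simp_all add: nth_eq_iff_index_eq)
      moreover have "Suc k mod length vs = (if Suc k = length vs then 0 else Suc k)"
        if "k < length vs" for k using that by auto
      ultimately show False using lt(3,4) len by (auto split: if_splits)
    qed
  qed
  then show "card C = length vs" using es(1,2) distinct_card by metis
  show "e \<in> C" if e: "e \<in> E" "e \<subseteq> \<Union>C"
  proof -
    obtain p where p: "p \<in> e" "p \<notin> V" using plane_graph_edge(4)[OF pg e(1)] by blast
    then obtain e' where e': "e' \<in> C" "p \<in> e'" using e(2) by blast
    then show ?thesis using plane_graph_edge_unique[OF pg e(1) _ p(1) e'(2) p(2)] es(3) by blast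
  qed
qed

lemma simple_cycle_3:
  assumes pg: "plane_graph V E" and sc: "simple_cycle V E vs C" and len: "length vs = 3"
  obtains a b c e1 e2 e3 where "distinct [a, b, c]" "V \<inter> \<Union>C = {a, b, c}" "C = {e1, e2, e3}" "C \<subseteq> E"
    "e1 \<inter> V = {a, b}" "e2 \<inter> V = {b, c}" "e3 \<inter> V = {c, a}"
proof -
  obtain es where es: "length es = length vs" "set es = C" "C \<subseteq> E"
    "\<forall>i<length vs. es ! i \<inter> V = {vs ! i, vs ! (Suc i mod length vs)}" and dist: "distinct vs"
    using sc unfolding simple_cycle_def by blast
  obtain a b c where vs: "vs = [a, b, c]"
    using len by (auto simp: numeral_3_eq_3 length_Suc_conv)
  obtain e1 e2 e3 where es': "es = [e1, e2, e3]"
    using len es(1) by (auto simp: numeral_3_eq_3 length_Suc_conv)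
  have "e1 \<inter> V = {a, b}" "e2 \<inter> V = {b, c}" "e3 \<inter> V = {c, a}"
    using es(4)[rule_format, of 0] es(4)[rule_format, of 1] es(4)[rule_format, of 2] vs es' by auto
  moreover have "V \<inter> \<Union>C = {a, b, c}" using simple_cycle_edges(2)[OF pg sc] vs by simp
  moreover have "C = {e1, e2, e3}" using es(2) es' by auto
  ultimately show ?thesis using that dist vs es(3) by blast
qed

section \<open>Triangulated discs\<close>

locale triangulated_disc =
  fixes D :: "complex set" and V :: "complex set" and E :: "complex set set"
  assumes triangulation: "disc_triangulation D V E"
begin

definition graph :: "complex set" where "graph = V \<union> \<Union>E"
definition faces :: "complex set set" where "faces = components (D - graph)"
text \<open>Read off from the frontier, hence independent of the choice of a bounding cycle;
  \<open>face_triangle\<close> identifies it with the edges of that cycle.\<close>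

definition sides :: "complex set \<Rightarrow> complex set set" where "sides F = {e \<in> E. e \<subseteq> frontier F}"
abbreviation faces_at :: "complex set \<Rightarrow> complex set set" where "faces_at e \<equiv> {F \<in> faces. e \<in> sides F}"

lemma plane: "plane_graph V E" and graph_subset: "graph \<subseteq> D"
  and disc: "D homeomorphic cball (0::complex) 1"
  using triangulation unfolding disc_triangulation_def graph_def by auto

lemmas disc_facts = topological_disc_interior[OF disc]

lemma closed_D: "closed D" and bounded_D: "bounded D"
  using disc_facts(1) by (simp_all add: compact_imp_closed compact_imp_bounded)

lemma interior_eq: "interior D = D - frontier D"
  using closed_D interior_subset[of D] by (auto simp: frontier_def)

text \<open>The frontier of \<open>D\<close> is a Jordan curve with \<open>interior D\<close> as its
  inside, which leaves exactly \<open>- D\<close> for the outside.\<close>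

lemma outer: "connected (- D)" "\<not> bounded (- D)" "frontier (- D) = frontier D"
  "frontier (interior D) = frontier D"
proof -
  obtain c where c: "simple_path c" "pathfinish c = pathstart c" "path_image c = frontier D"
    using disc_facts(4) by blast
  note j = Jordan_inside_outside[OF c(1,2), unfolded c(3)]
  have io: "interior D = inside (frontier D)"
    unfolding c(3)[symmetric]
  proof (rule region_eq_inside[OF c(1,2) disc_facts(2) _ disc_facts(3)])
    show "bounded (interior D)" using bounded_subset[OF bounded_D interior_subset] .
    show "frontier (interior D) \<subseteq> path_image c" unfolding c(3) by (rule frontier_interior_subset)
    show "interior D \<inter> path_image c = {}" unfolding c(3) interior_eq by blast
  qed
  have D: "frontier D \<union> interior D = D"
    using interior_eq frontier_subset_closed[OF closed_D] by blast
  have "inside (frontier D) \<union> outside (frontier D) = - frontier D"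
    "inside (frontier D) \<inter> outside (frontier D) = {}" using j by simp_all
  then have oD: "outside (frontier D) = - D" unfolding io[symmetric] using D by auto
  show "connected (- D)" "\<not> bounded (- D)" "frontier (- D) = frontier D"
    using j unfolding oD by simp_all
  show "frontier (interior D) = frontier D"
    unfolding io using j by simp
qed

lemma finite_V: "finite V" and finite_E: "finite E"
  using plane by (simp_all add: plane_graph_def)

lemma compact_graph: "compact graph"
  unfolding graph_def by (rule compact_plane_graph[OF plane])

definition rim :: "complex set set" where "rim = {e \<in> E. e \<subseteq> frontier D}"

lemma rim:
  "\<Union>rim = frontier D" "card rim = card (V \<inter> frontier D)" "v \<in> V \<inter> frontier D \<Longrightarrow> \<exists>e\<in>rim. v \<in> e"
proof -
  obtain vs C where C: "simple_cycle V E vs C" "\<Union>C = frontier D"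
    using triangulation unfolding disc_triangulation_def by blast
  note sc = simple_cycle_edges[OF plane C(1)]
  have eq: "rim = C"
  proof
    show "rim \<subseteq> C" using sc(4) C(2) unfolding rim_def by blast
    show "C \<subseteq> rim" using sc(1) C(2) unfolding rim_def by blast
  qed
  have "distinct vs" using C(1) by (simp add: simple_cycle_def)
  then show "\<Union>rim = frontier D" "card rim = card (V \<inter> frontier D)"
    using sc(2,3) C(2) distinct_card[of vs] by (simp_all add: eq)
  show "\<exists>e\<in>rim. v \<in> e" if "v \<in> V \<inter> frontier D"
    using that sc(2,5) C(2) unfolding eq by blast
qed

lemma rim_iff:
  assumes "e \<in> E" "p \<in> e" "p \<notin> V"
  shows "p \<in> frontier D \<longleftrightarrow> e \<in> rim"
proof
  assume "p \<in> frontier D"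
  then obtain e' where e': "e' \<in> rim" "p \<in> e'" using rim(1) by blast
  then have "e' \<in> E" by (simp add: rim_def)
  then show "e \<in> rim" using plane_graph_edge_unique[OF plane assms(1) _ assms(2) e'(2) assms(3)] e'(1) by simp
next
  assume "e \<in> rim"
  then show "p \<in> frontier D" using assms(2) unfolding rim_def by blast
qed

lemma frontier_subset_graph: "frontier D \<subseteq> graph"
  using rim(1) unfolding graph_def rim_def by blast

lemma open_complement: "open (D - graph)"
proof -
  have "D - graph = interior D - graph"
    using interior_eq frontier_subset_graph by blast
  then show ?thesis using compact_imp_closed[OF compact_graph] by (simp add: open_Diff)
qed

section \<open>Faces and their bounding triangles\<close>

lemma face:
  assumes "F \<in> faces"
  shows "open F" "connected F" "F \<noteq> {}" "F \<inter> graph = {}" "F \<subseteq> interior D" "bounded F"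
    "frontier F \<subseteq> graph"
proof -
  have F: "F \<in> components (D - graph)" using assms by (simp add: faces_def)
  show "open F" by (rule open_components[OF open_complement F])
  show "connected F" by (rule in_components_connected[OF F])
  show "F \<noteq> {}" by (rule in_components_nonempty[OF F])
  have sub: "F \<subseteq> D - graph" by (rule in_components_subset[OF F])
  then show "F \<inter> graph = {}" "F \<subseteq> interior D" using interior_eq frontier_subset_graph by blast+
  show "bounded F" using bounded_subset[OF bounded_D] sub by blast
  obtain vs C where "simple_cycle V E vs C" "\<Union>C = frontier F"
    using triangulation F unfolding disc_triangulation_def graph_def by blast
  then show "frontier F \<subseteq> graph" using simple_cycle_edges(1)[OF plane] unfolding graph_def by blast
qed

lemma face_triangle:
  assumes "F \<in> faces"
  obtains a b c e1 e2 e3 where "distinct [a, b, c]" "V \<inter> frontier F = {a, b, c}"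
    "sides F = {e1, e2, e3}" "sides F \<subseteq> E" "frontier F = \<Union>(sides F)"
    "e1 \<inter> V = {a, b}" "e2 \<inter> V = {b, c}" "e3 \<inter> V = {c, a}"
proof -
  have F: "F \<in> components (D - graph)" using assms by (simp add: faces_def)
  then obtain vs C where C: "simple_cycle V E vs C" "length vs = 3" "\<Union>C = frontier F"
    using triangulation unfolding disc_triangulation_def graph_def by blast
  have eq: "sides F = C"
  proof
    show "sides F \<subseteq> C" using simple_cycle_edges(4)[OF plane C(1)] C(3) unfolding sides_def by blast
    show "C \<subseteq> sides F" using simple_cycle_edges(1)[OF plane C(1)] C(3) unfolding sides_def by blast
  qed
  show ?thesis
    by (rule simple_cycle_3[OF plane C(1,2)]) (use that C(3) in \<open>simp add: eq\<close>)
qed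

lemma frontier_face: "F \<in> faces \<Longrightarrow> frontier F = \<Union>(sides F)"
  by (erule face_triangle)

lemma face_third_vertex:
  assumes F: "F \<in> faces" and e: "e \<in> sides F" "e \<inter> V = {u, v}"
  obtains w e2 e3 where "w \<notin> {u, v}" "u \<noteq> v" "e2 \<inter> V = {v, w}" "e3 \<inter> V = {w, u}"
    "sides F = {e, e2, e3}" "sides F \<subseteq> E"
proof -
  obtain a b c e1 e2 e3 where *: "distinct [a, b, c]" "sides F = {e1, e2, e3}" "sides F \<subseteq> E"
    "e1 \<inter> V = {a, b}" "e2 \<inter> V = {b, c}" "e3 \<inter> V = {c, a}"
    by (rule face_triangle[OF F])
  have "(u, v, e) \<in> {(a, b, e1), (b, a, e1), (b, c, e2), (c, b, e2), (c, a, e3), (a, c, e3)}"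
  proof -
    have "e = e1 \<and> {u, v} = {a, b} \<or> e = e2 \<and> {u, v} = {b, c} \<or> e = e3 \<and> {u, v} = {c, a}"
      using e *(4-6) unfolding *(2) by (elim insertE emptyE) simp_all
    then show ?thesis by (auto simp: doubleton_eq_iff)
  qed
  then show ?thesis
    using *(1,3-6) that[of c e2 e3] that[of c e3 e2] that[of a e3 e1] that[of a e1 e3] that[of b e1 e2] that[of b e2 e1]
    unfolding *(2) by (elim insertE emptyE) (auto simp: insert_commute)
qed

text \<open>The bounding triangle as a theta graph needs it: the side \<open>e\<close> and the path
  \<open>p\<close> through the opposite vertex, with common ends.\<close>

lemma face_arcs:
  assumes F: "F \<in> faces" and e: "e \<in> sides F" "e \<inter> V = {u, v}"
  obtains g p w where "arc g" "path_image g = e" "pathstart g = u" "pathfinish g = v"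
    "arc p" "pathstart p = u" "pathfinish p = v" "e \<inter> path_image p = {u, v}"
    "frontier F = e \<union> path_image p" "path_image p \<inter> V = {u, v, w}" "w \<notin> {u, v}"
    "path_image p = \<Union>(sides F - {e})" "F = inside (e \<union> path_image p)"
proof -
  obtain w e2 e3 where *: "w \<notin> {u, v}" "u \<noteq> v" "e2 \<inter> V = {v, w}" "e3 \<inter> V = {w, u}"
    "sides F = {e, e2, e3}" "sides F \<subseteq> E"
    by (rule face_third_vertex[OF assms])
  have "{u, v} \<noteq> {v, w}" "{u, v} \<noteq> {w, u}" "{v, w} \<noteq> {w, u}"
    using *(1,2) by (auto simp: doubleton_eq_iff)
  then have ne: "e \<noteq> e2" "e \<noteq> e3" "e2 \<noteq> e3" using *(3,4) e(2) by metis+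
  have E: "e \<in> E" "e2 \<in> E" "e3 \<in> E" using *(5,6) by auto
  have sub: "e \<inter> e2 \<subseteq> V" "e \<inter> e3 \<subseteq> V" "e2 \<inter> e3 \<subseteq> V"
    using plane_graph_edge_unique[OF plane] E ne by blast+
  have "e3 \<inter> V = {u, w}" "e2 \<inter> V = {w, v}" using *(3,4) by auto
  then obtain g2 g3 where g2: "arc g2" "path_image g2 = e2" "pathstart g2 = w" "pathfinish g2 = v"
    and g3: "arc g3" "path_image g3 = e3" "pathstart g3 = u" "pathfinish g3 = w"
    using plane_graph_arc[OF plane E(2)] plane_graph_arc[OF plane E(3)] by metis
  obtain g where g: "arc g" "path_image g = e" "pathstart g = u" "pathfinish g = v"
    using plane_graph_arc[OF plane E(1) e(2)] by blast
  let ?p = "g3 +++ g2"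
  have im: "path_image ?p = e3 \<union> e2" using g2 g3 by (simp add: path_image_join)
  have p: "arc ?p" using sub(3) *(1-4) g2 g3 by (intro arc_join) auto
  have "e \<inter> (e3 \<union> e2) = (e \<inter> V) \<inter> (e3 \<inter> V \<union> e2 \<inter> V)" using sub by blast
  also have "\<dots> = {u, v}" unfolding e(2) *(3,4) using *(1) by auto
  finally have i: "e \<inter> (e3 \<union> e2) = {u, v}" .
  have fr: "frontier F = e \<union> (e3 \<union> e2)" using frontier_face[OF F] *(5) by auto
  obtain c where c: "simple_path c" "pathfinish c = pathstart c" "path_image c = e \<union> (e3 \<union> e2)"
    using Jordan_two_arcs[of g ?p] g g2 g3 p im i by auto
  have "F \<inter> frontier F = {}" using face(1)[OF F] frontier_disjoint_eq[of F] by (simp add: Int_commute)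
  then have "F = inside (path_image c)"
    using region_eq_inside[OF c(1,2), of F] face[OF F] fr c(3) by simp
  moreover have "(e3 \<union> e2) \<inter> V = {u, v, w}" using *(3,4) by blast
  moreover have "\<Union>(sides F - {e}) = e3 \<union> e2" using *(5) ne by auto
  ultimately show ?thesis
    using p g g2 g3 im i fr c(3) *(1) by (intro that[of g ?p w]) simp_all
qed

lemma face_eq_inside: "F \<in> faces \<Longrightarrow> F = inside (frontier F)"
proof -
  assume F: "F \<in> faces"
  obtain a b c e1 e2 e3 where "sides F = {e1, e2, e3}" "e1 \<inter> V = {a, b}"
    by (rule face_triangle[OF F])
  then have "e1 \<in> sides F" by simp
  then show ?thesis using \<open>e1 \<inter> V = {a, b}\<close> face_arcs[OF F, of e1 a b] by metis
qed

lemma sides_eq_corners: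
  assumes F: "F \<in> faces"
  shows "sides F = {e \<in> E. e \<inter> V \<subseteq> frontier F}"
proof -
  obtain a b c e1 e2 e3 where *: "V \<inter> frontier F = {a, b, c}"
    "sides F = {e1, e2, e3}" "sides F \<subseteq> E"
    "e1 \<inter> V = {a, b}" "e2 \<inter> V = {b, c}" "e3 \<inter> V = {c, a}"
    by (rule face_triangle[OF F])
  have "e \<in> sides F" if e: "e \<in> E" "e \<inter> V \<subseteq> frontier F" for e
  proof -
    obtain u v where uv: "u \<in> V" "v \<in> V" "u \<noteq> v" "e \<inter> V = {u, v}"
      using plane_graph_ends[OF plane e(1)] by blast
    then have "u \<in> {a, b, c}" "v \<in> {a, b, c}" using e(2) *(1) by blast+
    then have "{u, v} = {a, b} \<or> {u, v} = {b, c} \<or> {u, v} = {c, a}"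
      using uv(3) by (auto simp: insert_commute)
    then have "\<exists>d\<in>sides F. e \<inter> V = d \<inter> V" unfolding uv(4) *(2) by (simp add: *(4-6))
    then show ?thesis using plane_graph_ends_inj[OF plane e(1)] *(3) by blast
  qed
  then show ?thesis unfolding sides_def by blast
qed

text \<open>In the absence of parallel edges the corners determine the sides, the sides the
  frontier, and the frontier its inside.\<close>

lemma face_eqI:
  assumes "F \<in> faces" "F' \<in> faces" "V \<inter> frontier F = V \<inter> frontier F'"
  shows "F = F'"
proof -
  have "sides F = sides F'"
    unfolding sides_eq_corners[OF assms(1)] sides_eq_corners[OF assms(2)] using assms(3) by blast
  then show ?thesis
    using frontier_face assms(1,2) face_eq_inside by metis
qed

text \<open>A face is the inside of the union of its sides, so it is determined by a subset of the
  finite set of edges.\<close>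

lemma finite_faces: "finite faces"
proof (rule finite_subset)
  show "faces \<subseteq> (\<lambda>S. inside (\<Union>S)) ` Pow E"
  proof
    fix F assume F: "F \<in> faces"
    then have "F = inside (\<Union>(sides F))" using face_eq_inside frontier_face by metis
    then show "F \<in> (\<lambda>S. inside (\<Union>S)) ` Pow E" by (auto simp: sides_def intro: image_eqI[of _ _ "sides F"])
  qed
qed (simp add: finite_E)

lemma face_disjoint: "F \<in> faces \<Longrightarrow> F' \<in> faces \<Longrightarrow> F \<noteq> F' \<Longrightarrow> F \<inter> F' = {}"
  unfolding faces_def using components_nonoverlap by metis

lemma in_face: "x \<in> D - graph \<Longrightarrow> \<exists>F\<in>faces. x \<in> F"
  unfolding faces_def by (rule component_of_point)

section \<open>The faces along an edge\<close>

lemma closure_face: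
  assumes "F \<in> faces" "p \<in> closure F" "p \<in> graph" "p \<notin> V" "e \<in> E" "p \<in> e"
  shows "e \<in> sides F"
proof -
  have "p \<in> frontier F" using assms(1-3) face(1,4) by (auto simp: frontier_def interior_open)
  then obtain e' where e': "e' \<in> sides F" "p \<in> e'" using frontier_face[OF assms(1)] by blast
  then have "e' \<in> E" by (simp add: sides_def)
  then show ?thesis using plane_graph_edge_unique[OF plane assms(5) _ assms(6) e'(2) assms(4)] e'(1) by simp
qed

text \<open>\<open>W\<close> collects the vertices, the other edges and the closures of the faces
  that do not have \<open>e\<close> as a side. None of them contains \<open>p\<close>, and by
  finiteness \<open>W\<close> is closed.\<close>

lemma edge_nhd:
  assumes e: "e \<in> E" "p \<in> e" "p \<notin> V"
  obtains U where "open U" "p \<in> U" "U - e \<subseteq> \<Union>(faces_at e) \<union> - D"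
    "p \<in> interior D \<Longrightarrow> U \<subseteq> D"
proof -
  define W where "W = V \<union> \<Union>(E - {e}) \<union> \<Union>(closure ` {F \<in> faces. e \<notin> sides F})"
  have "closed W" unfolding W_def
    using finite_V finite_E finite_faces plane_graph_edge(1)[OF plane]
    by (intro closed_Un closed_Union finite_imp_closed) auto
  have pG: "p \<in> graph" using e unfolding graph_def by blast
  have "p \<notin> W"
  proof
    assume "p \<in> W"
    then consider e' where "e' \<in> E - {e}" "p \<in> e'" | F where "F \<in> faces" "e \<notin> sides F" "p \<in> closure F"
      using e(3) unfolding W_def by blast
    then show False
    proof cases
      case 1
      then show False using plane_graph_edge_unique[OF plane e(1) _ e(2) _ e(3)] by blast
    next
      case 2
      then show False using closure_face[OF 2(1,3) pG e(3,1,2)] by blast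
    qed
  qed
  have main: "x \<in> \<Union>(faces_at e) \<union> - D" if "x \<in> - W - e" for x
  proof (cases "x \<in> D")
    case True
    have "x \<notin> graph" using that unfolding W_def graph_def by blast
    then obtain F where F: "F \<in> faces" "x \<in> F" using in_face True by blast
    then have "e \<in> sides F" using that closure_subset[of F] unfolding W_def by blast
    then show ?thesis using F by blast
  qed simp
  show ?thesis
  proof (cases "p \<in> interior D")
    case True
    show ?thesis
      by (rule that[of "- W \<inter> interior D"])
        (use True \<open>closed W\<close> \<open>p \<notin> W\<close> main interior_subset[of D] in \<open>auto simp: open_Int open_Compl\<close>)
  next
    case False
    show ?thesis
      by (rule that[of "- W"]) (use False \<open>closed W\<close> \<open>p \<notin> W\<close> main in \<open>auto simp: open_Compl\<close>)
  qed
qed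

text \<open>The theta graph of the shared side and the two opposite paths shows that both faces
  together with the open edge form the inside of a quadrilateral. This set is open, so the edge
  cannot run along the frontier of \<open>D\<close>, and a third face has no room to touch
  it.\<close>

lemma two_faces:
  assumes F: "F1 \<in> faces" "F2 \<in> faces" "F1 \<noteq> F2" and e: "e \<in> sides F1" "e \<in> sides F2"
  shows "open (F1 \<union> F2 \<union> (e - V))" "e - V \<subseteq> interior D" "faces_at e = {F1, F2}"
proof -
  have eE: "e \<in> E" using e by (simp add: sides_def)
  obtain u v where uv: "e \<inter> V = {u, v}" using plane_graph_ends[OF plane eE] by blast
  obtain g p1 w1 where g: "arc g" "path_image g = e" "pathstart g = u" "pathfinish g = v"
    and p1: "arc p1" "pathstart p1 = u" "pathfinish p1 = v" "e \<inter> path_image p1 = {u, v}"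
    "frontier F1 = e \<union> path_image p1" "path_image p1 \<inter> V = {u, v, w1}" "w1 \<notin> {u, v}"
    "path_image p1 = \<Union>(sides F1 - {e})" "F1 = inside (e \<union> path_image p1)"
    by (rule face_arcs[OF F(1) e(1) uv])
  obtain p2 w2 where p2: "arc p2" "pathstart p2 = u" "pathfinish p2 = v" "e \<inter> path_image p2 = {u, v}"
    "frontier F2 = e \<union> path_image p2" "path_image p2 \<inter> V = {u, v, w2}" "w2 \<notin> {u, v}"
    "path_image p2 = \<Union>(sides F2 - {e})" "F2 = inside (e \<union> path_image p2)"
    by (rule face_arcs[OF F(2) e(2) uv])
  have "V \<inter> frontier F1 = {u, v, w1}" "V \<inter> frontier F2 = {u, v, w2}"
    using p1(5,6) p2(5,6) uv by auto
  then have w: "w1 \<noteq> w2" using face_eqI[OF F(1,2)] F(3) by metis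
  \<comment> \<open>A common edge of the two paths would have its ends in both
    \<open>{u, v, w1}\<close> and \<open>{u, v, w2}\<close>, thus be parallel to
    \<open>e\<close>.\<close>
  have pV: "path_image p1 \<inter> path_image p2 \<subseteq> V"
  proof
    fix x assume x: "x \<in> path_image p1 \<inter> path_image p2"
    show "x \<in> V"
    proof (rule ccontr)
      assume xV: "x \<notin> V"
      obtain d where d: "d \<in> sides F1 - {e}" "x \<in> d" using x p1(8) by blast
      obtain d' where d': "d' \<in> sides F2 - {e}" "x \<in> d'" using x p2(8) by blast
      have dE: "d \<in> E" "d' \<in> E" using d d' by (auto simp: sides_def)
      have "d = d'" using plane_graph_edge_unique[OF plane dE d(2) d'(2) xV] .
      obtain r s where rs: "r \<noteq> s" "d \<inter> V = {r, s}" using plane_graph_ends[OF plane dE(1)] by blast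
      have "d \<inter> V \<noteq> e \<inter> V" using plane_graph_ends_inj[OF plane dE(1) eE] d(1) by blast
      moreover have "d \<inter> V \<subseteq> {u, v, w1}" using d(1) p1(6,8) by blast
      moreover have "d \<inter> V \<subseteq> {u, v, w2}" using d'(1) \<open>d = d'\<close> p2(6,8) by blast
      ultimately show False using rs(1) w unfolding rs(2) uv by auto
    qed
  qed
  have "path_image p1 \<inter> path_image p2 = (path_image p1 \<inter> V) \<inter> (path_image p2 \<inter> V)"
    using pV by blast
  also have "\<dots> = {u, v}" unfolding p1(6) p2(6) using w by auto
  finally have "path_image p1 \<inter> path_image p2 = {u, v}" .
  have sub: "path_image p1 \<subseteq> graph" "path_image p2 \<subseteq> graph"
    using face(7)[OF F(1)] face(7)[OF F(2)] p1(5) p2(5) by blast+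
  have "F1 \<union> F2 \<union> (path_image g - {u, v}) = inside (path_image p1 \<union> path_image p2)"
  proof (rule theta_inside[OF g(1) p1(1) p2(1) g(3) p1(2) p2(2) g(4) p1(3) p2(3)])
    show "F1 \<inter> path_image p2 = {}" "F2 \<inter> path_image p1 = {}"
      using face(4)[OF F(1)] face(4)[OF F(2)] sub by blast+
    show "F1 \<inter> F2 = {}" by (rule face_disjoint[OF F])
    show "path_image g \<inter> path_image p1 = {u, v}" unfolding g(2) by (rule p1(4))
    show "path_image g \<inter> path_image p2 = {u, v}" unfolding g(2) by (rule p2(4))
    show "path_image p1 \<inter> path_image p2 = {u, v}" by fact
    show "F1 = inside (path_image g \<union> path_image p1)" unfolding g(2) by (rule p1(9))
    show "F2 = inside (path_image g \<union> path_image p2)" unfolding g(2) by (rule p2(9))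
  qed
  moreover have "path_image g - {u, v} = e - V" using uv g(2) by blast
  moreover obtain c where c: "simple_path c" "pathfinish c = pathstart c" "path_image c = path_image p1 \<union> path_image p2"
    using Jordan_two_arcs[OF p1(1) p2(1)] p1(2,3) p2(2,3) \<open>path_image p1 \<inter> path_image p2 = {u, v}\<close>
    by auto
  ultimately show op: "open (F1 \<union> F2 \<union> (e - V))"
    using Jordan_inside_outside[OF c(1,2)] by simp
  have "F1 \<union> F2 \<union> (e - V) \<subseteq> D"
    using face(5)[OF F(1)] face(5)[OF F(2)] interior_subset[of D] graph_subset eE unfolding graph_def by blast
  then show "e - V \<subseteq> interior D" using interior_maximal[OF _ op] by blast
  have "F = F1 \<or> F = F2" if F': "F \<in> faces" "e \<in> sides F" for F
  proof (rule ccontr)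
    assume ne: "\<not> ?thesis"
    obtain p where p: "p \<in> e - V" using plane_graph_edge(4)[OF plane eE] by blast
    have "p \<in> closure F" using frontier_face[OF F'(1)] F'(2) p by (auto simp: frontier_def)
    then have "(F1 \<union> F2 \<union> (e - V)) \<inter> F \<noteq> {}"
      using open_Int_closure_eq_empty[OF op, of F] p by blast
    moreover have "F1 \<inter> F = {}" "F2 \<inter> F = {}" using face_disjoint F F' ne by metis+
    moreover have "e \<inter> F = {}" using face(4)[OF F'(1)] eE unfolding graph_def by blast
    ultimately show False by blast
  qed
  then show "faces_at e = {F1, F2}" using F e by blast
qed

lemma face_curve:
  assumes "F \<in> faces"
  obtains c where "simple_path c" "pathfinish c = pathstart c" "path_image c = frontier F"
proof -
  obtain a b x e e2 e3 where e: "sides F = {e, e2, e3}" "sides F \<subseteq> E" "e \<inter> V = {a, b}"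
    by (rule face_triangle[OF assms])
  then have "e \<in> sides F" by simp
  obtain g p w where g: "arc g" "path_image g = e" "pathstart g = a" "pathfinish g = b"
    and p: "arc p" "pathstart p = a" "pathfinish p = b" "e \<inter> path_image p = {a, b}"
      "frontier F = e \<union> path_image p"
    by (rule face_arcs[OF assms \<open>e \<in> sides F\<close> e(3)])
  show ?thesis
    using Jordan_two_arcs[OF g(1) p(1)] g(2-4) p(2-5) that by auto
qed

text \<open>Points of \<open>interior D\<close> come arbitrarily close to the edge and, off the
  edge, lie in faces along it, so there is one. Two faces would put the open edge into
  \<open>interior D\<close>.\<close>

lemma rim_one_face:
  assumes e: "e \<in> rim"
  shows "\<exists>F. faces_at e = {F}"
proof -
  have eE: "e \<in> E" "e \<subseteq> frontier D" using e by (auto simp: rim_def)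
  obtain p where p: "p \<in> e" "p \<notin> V" using plane_graph_edge(4)[OF plane eE(1)] by blast
  obtain U where U: "open U" "p \<in> U" "U - e \<subseteq> \<Union>(faces_at e) \<union> - D"
    by (rule edge_nhd[OF eE(1) p])
  have "p \<in> closure (interior D)" using outer(4) p eE(2) by (auto simp: frontier_def)
  then obtain F where F: "F \<in> faces" "e \<in> sides F"
    using open_Int_closure_eq_empty[OF U(1)] U(2) eE(2) interior_eq U(3) by blast
  have "F' = F" if "F' \<in> faces" "e \<in> sides F'" for F'
  proof (rule ccontr)
    assume "F' \<noteq> F"
    then show False using two_faces(2)[OF that(1) F(1) _ that(2) F(2)] p eE(2) interior_eq by blast
  qed
  then show ?thesis using F by blast
qed

lemma inner_edge:
  assumes "e \<in> E - rim" "p \<in> e" "p \<notin> V"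
  shows "p \<in> interior D"
  using rim_iff[of e p] assms graph_subset interior_eq unfolding graph_def by blast

text \<open>Around an inner point of the edge everything off the edge belongs to faces along it, and
  an arc has empty interior, which gives \<open>F1\<close>. The point is also on the frontier of the
  outside of the triangle of \<open>F1\<close>, and a nearby point out there lies in a second
  face.\<close>

lemma inner_two_faces:
  assumes e: "e \<in> E - rim"
  obtains F1 F2 where "F1 \<noteq> F2" "faces_at e = {F1, F2}"
proof -
  have eE: "e \<in> E" using e by simp
  obtain p where p: "p \<in> e" "p \<notin> V" using plane_graph_edge(4)[OF plane eE] by blast
  have pD: "p \<in> interior D" by (rule inner_edge[OF e p])
  obtain U where U: "open U" "p \<in> U" "U - e \<subseteq> \<Union>(faces_at e) \<union> - D" "U \<subseteq> D"
    by (rule edge_nhd[OF eE p]) (use pD in blast)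
  have UF: "\<exists>F\<in>faces. e \<in> sides F \<and> x \<in> F" if "x \<in> U - e" for x using U(3,4) that by blast
  obtain g where g: "arc g" "path_image g = e" using plane_graph_edgeE[OF plane eE] by metis
  obtain F1 where F1: "F1 \<in> faces" "e \<in> sides F1" using open_subset_arc_empty[OF g(1) U(1)] U(2) g(2) UF by blast
  obtain c where c: "simple_path c" "pathfinish c = pathstart c" "path_image c = frontier F1"
    by (rule face_curve[OF F1(1)])
  note j = Jordan_inside_outside[OF c(1,2), unfolded c(3)]
  have fr: "frontier F1 = frontier (outside (frontier F1))" using j by simp
  have io: "inside (frontier F1) \<inter> outside (frontier F1) = {}" using j by simp
  have eF: "e \<subseteq> frontier F1" using F1 frontier_face by blast
  then have "p \<in> closure (outside (frontier F1))"
    using fr p(1) unfolding frontier_def[of "outside (frontier F1)"] by blast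
  then obtain x where x: "x \<in> U" "x \<in> outside (frontier F1)" using open_Int_closure_eq_empty[OF U(1)] U(2) by blast
  then obtain F2 where F2: "F2 \<in> faces" "e \<in> sides F2" "x \<in> F2"
    using eF outside_no_overlap[of "frontier F1"] UF x(1) by blast
  have "F1 \<noteq> F2" using face_eq_inside[OF F1(1)] io x(2) F2(3) by blast
  then show ?thesis
    using that two_faces(3)[OF F1(1) F2(1) \<open>F1 \<noteq> F2\<close> F1(2) F2(2)] \<open>F1 \<noteq> F2\<close> by blast
qed

text \<open>For a rim edge the connected exterior \<open>- D\<close> serves as the second
  side.\<close>

lemma two_sided_edge:
  assumes e: "e \<in> E"
  shows "two_sided V graph e"
proof (cases "e \<in> rim")
  case True
  obtain F where F: "faces_at e = {F}" using rim_one_face[OF True] by blast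
  then have "F \<in> faces" by blast
  have "\<exists>U. open U \<and> p \<in> U \<and> U - e \<subseteq> F \<union> - D" if p: "p \<in> e - V" for p
  proof -
    obtain U where "open U" "p \<in> U" "U - e \<subseteq> \<Union>(faces_at e) \<union> - D"
      by (rule edge_nhd[of e p]) (use e p in blast)+
    then show ?thesis unfolding F by auto
  qed
  moreover have "- D \<inter> graph = {}" using graph_subset by blast
  ultimately show ?thesis
    unfolding two_sided_def using face(2,4)[OF \<open>F \<in> faces\<close>] outer(1) by blast
next
  case False
  then have e': "e \<in> E - rim" using e by simp
  obtain F1 F2 where F: "faces_at e = {F1, F2}" by (rule inner_two_faces[OF e'])
  then have F': "F1 \<in> faces" "F2 \<in> faces" by blast+
  have "\<exists>U. open U \<and> p \<in> U \<and> U - e \<subseteq> F1 \<union> F2" if p: "p \<in> e - V" for p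
  proof -
    have pD: "p \<in> interior D" using inner_edge[OF e'] p by blast
    obtain U where U: "open U" "p \<in> U" "U - e \<subseteq> \<Union>(faces_at e) \<union> - D" "U \<subseteq> D"
      by (rule edge_nhd[of e p]) (use e p pD in blast)+
    then have "U - e \<subseteq> F1 \<union> F2" unfolding F by blast
    then show ?thesis using U by blast
  qed
  then show ?thesis
    unfolding two_sided_def using face(2,4)[OF F'(1)] face(2,4)[OF F'(2)] by blast
qed

text \<open>A separation of the graph would extend to the connected set \<open>D\<close>: each face
  has a connected frontier, so its closure can be attached to the part containing that frontier.
  Finiteness of the faces keeps the two parts closed.\<close>

lemma connected_graph: "connected graph"
  unfolding connected_closed
proof (rule notI, elim exE conjE)
  fix A B assume AB: "closed A" "closed B" "graph \<subseteq> A \<union> B" "A \<inter> B \<inter> graph = {}"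
    "A \<inter> graph \<noteq> {}" "B \<inter> graph \<noteq> {}"
  define X where "X Z = (Z \<inter> graph) \<union> \<Union>(closure ` {F \<in> faces. frontier F \<subseteq> Z \<inter> graph})" for Z
  have cl: "closed (X Z)" if "closed Z" for Z
    unfolding X_def using that compact_graph finite_faces
    by (intro closed_Un closed_Int closed_Union) (auto simp: compact_imp_closed)
  have split: "frontier F \<subseteq> A \<inter> graph \<or> frontier F \<subseteq> B \<inter> graph"
    if F: "F \<in> faces" for F
  proof -
    obtain c where c: "simple_path c" "path_image c = frontier F" by (rule face_curve[OF F])
    have "connected (frontier F)"
      using c connected_path_image simple_path_imp_path by metis
    then have "A \<inter> frontier F = {} \<or> B \<inter> frontier F = {}"
      using face(7)[OF F] AB by (intro connected_closedD) auto
    then show ?thesis using face(7)[OF F] AB(3) by blast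
  qed
  have cov: "D \<subseteq> X A \<union> X B"
  proof
    fix x assume x: "x \<in> D"
    show "x \<in> X A \<union> X B"
    proof (cases "x \<in> graph")
      case True
      then show ?thesis using AB(3) unfolding X_def by blast
    next
      case False
      then obtain F where F: "F \<in> faces" "x \<in> F" using in_face x by blast
      then show ?thesis using closure_subset split[OF F(1)] F(1) unfolding X_def by blast
    qed
  qed
  have fne: "frontier F \<noteq> {}" if "F \<in> faces" for F
    using face_triangle[OF that] by (metis Int_empty_right insert_not_empty)
  have clos: "x \<in> F \<or> x \<in> frontier F" if "F \<in> faces" "x \<in> closure F" for x F
    using that face(1)[OF that(1)] by (auto simp: frontier_def interior_open)
  have disj: "X A \<inter> X B = {}"
  proof (rule ccontr)
    assume "X A \<inter> X B \<noteq> {}"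
    then obtain x where x: "x \<in> X A" "x \<in> X B" by blast
    show False
    proof (cases "x \<in> graph")
      case True
      have "x \<in> Z" if xZ: "x \<in> X Z" for Z
      proof (cases "x \<in> Z")
        case False
        then obtain F where F: "F \<in> faces" "frontier F \<subseteq> Z \<inter> graph" "x \<in> closure F"
          using xZ unfolding X_def by blast
        then show ?thesis using clos[OF F(1,3)] face(4)[OF F(1)] True by blast
      qed
      then show False using x AB(4) True by blast
    next
      case False
      obtain F where F: "F \<in> faces" "frontier F \<subseteq> A \<inter> graph" "x \<in> closure F"
        using x(1) False unfolding X_def by blast
      obtain F' where F': "F' \<in> faces" "frontier F' \<subseteq> B \<inter> graph" "x \<in> closure F'"
        using x(2) False unfolding X_def by blast
      show False
        using clos[OF F(1,3)] clos[OF F'(1,3)] F(2) F'(2) False face_disjoint[OF F(1) F'(1)] F(2) F'(2) AB(4) fne[OF F(1)] by blast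
    qed
  qed
  have "connected D"
    using homeomorphic_connectedness[OF disc] connected_cball by blast
  from connected_closedD[OF this _ cov cl[OF AB(1)] cl[OF AB(2)]] disj
  show False using AB(5,6) graph_subset unfolding X_def by blast
qed

section \<open>Global counts and the link of an internal vertex\<close>

lemma graph_nonempty: "V \<noteq> {}" "graph \<noteq> {}"
proof -
  have "frontier D \<noteq> {}"
    using outer(2) closed_D disc_facts(3) frontier_eq_empty bounded_D
    by (metis interior_empty compl_top_eq bounded_empty)
  then obtain e where "e \<in> E" using rim(1) unfolding rim_def by blast
  then show "V \<noteq> {}" using plane_graph_ends[OF plane] by blast
  then show "graph \<noteq> {}" unfolding graph_def by blast
qed

lemma components_complement: "components (- graph) = insert (- D) faces"
proof (rule components_open_unique)
  have FD: "F \<inter> - D = {}" if "F \<in> faces" for F using face(5)[OF that] interior_subset by blast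
  show "pairwise disjnt (insert (- D) faces)"
    using FD face_disjoint by (auto simp: pairwise_def disjnt_def)
  have "\<Union>faces = D - graph" unfolding faces_def by simp
  then show "\<Union>(insert (- D) faces) = - graph" using graph_subset by auto
  fix X assume "X \<in> insert (- D) faces"
  then show "open X \<and> connected X \<and> X \<noteq> {}"
    using face(1-3)[of X] outer(1,2) closed_D by auto
qed

lemma euler_formula: "card V + card faces = card E + 1"
proof -
  have "- D \<notin> faces" using face(6) outer(2) by blast
  then have cf: "card (components (- graph)) = card faces + 1"
    unfolding components_complement using finite_faces by simp
  have "components graph = {graph}"
    using connected_graph graph_nonempty(2) by (simp add: components_eq_sing_iff)
  then have c1: "card (components graph) = 1" by simp
  have "card (components (- graph)) + card V = card (components graph) + card E + 1"
    using euler_plane_graph[OF plane, of graph] two_sided_edge unfolding graph_def by blast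
  then show ?thesis using cf c1 by linarith
qed

text \<open>Incident pairs of edges and faces: three per face, two per inner edge, one per rim edge,
  and the rim is a cycle with as many edges as vertices.\<close>

lemma boundary_count: "2 * card E = 3 * card faces + card (V \<inter> frontier D)"
proof -
  have rimE: "rim \<subseteq> E" "finite rim" using finite_E finite_subset by (auto simp: rim_def)
  have "(\<Sum>e\<in>E. card (faces_at e)) = (\<Sum>F\<in>faces. card {e \<in> E. e \<in> sides F})"
    by (rule double_count[OF finite_E finite_faces])
  also have "\<dots> = (\<Sum>F\<in>faces. 3)"
  proof (rule sum.cong)
    fix F assume F: "F \<in> faces"
    obtain a b c e1 e2 e3 where *: "distinct [a, b, c]" "sides F = {e1, e2, e3}" "sides F \<subseteq> E"
      "e1 \<inter> V = {a, b}" "e2 \<inter> V = {b, c}" "e3 \<inter> V = {c, a}"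
      by (rule face_triangle[OF F])
    have "{a, b} \<noteq> {b, c}" "{b, c} \<noteq> {c, a}" "{a, b} \<noteq> {c, a}"
      using *(1) by (auto simp: doubleton_eq_iff)
    then have "e1 \<noteq> e2" "e2 \<noteq> e3" "e1 \<noteq> e3" using *(4-6) by metis+
    moreover have "{e \<in> E. e \<in> sides F} = {e1, e2, e3}" using *(2,3) by auto
    ultimately show "card {e \<in> E. e \<in> sides F} = 3" by simp
  qed simp
  finally have "(\<Sum>e\<in>E. card (faces_at e)) = 3 * card faces" by simp
  moreover have "(\<Sum>e\<in>E. card (faces_at e)) =
      (\<Sum>e\<in>E - rim. card (faces_at e)) + (\<Sum>e\<in>rim. card (faces_at e))"
    by (rule sum.subset_diff[OF rimE(1) finite_E])
  moreover have "(\<Sum>e\<in>rim. card (faces_at e)) = (\<Sum>e\<in>rim. 1)"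
  proof (rule sum.cong)
    fix e assume "e \<in> rim"
    then obtain F where "faces_at e = {F}" using rim_one_face by blast
    then show "card (faces_at e) = 1" by (simp only: card.insert) simp
  qed simp
  moreover have "(\<Sum>e\<in>E - rim. card (faces_at e)) = (\<Sum>e\<in>E - rim. 2)"
  proof (rule sum.cong)
    fix e assume "e \<in> E - rim"
    then obtain F1 F2 where "F1 \<noteq> F2" "faces_at e = {F1, F2}" by (rule inner_two_faces)
    then show "card (faces_at e) = 2" by (metis card_2_iff)
  qed simp
  ultimately show ?thesis using card_Diff_subset[OF rimE(2,1)] card_mono[OF finite_E rimE(1)] rim(2) by simp
qed

text \<open>If no face at \<open>v\<close> had sides of both classes there, the edges and closed
  faces of the two classes would split a small punctured ball around \<open>v\<close> into two
  nonempty, relatively closed, disjoint parts. A punctured ball in the plane is connected.\<close>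

lemma link_connected:
  assumes v: "v \<in> V" "v \<notin> frontier D"
    and A: "e \<in> E" "v \<in> e" "e \<in> A" and B: "e' \<in> E" "v \<in> e'" "e' \<notin> A"
  shows "\<exists>F\<in>faces. \<exists>d\<in>sides F \<inter> A. \<exists>d'\<in>sides F - A. v \<in> d \<and> v \<in> d'"
proof (rule ccontr)
  assume no: "\<not> ?thesis"
  define side where "side S = \<Union>{d \<in> E. v \<in> d \<and> d \<in> S} \<union>
      \<Union>(closure ` {F \<in> faces. \<exists>d\<in>sides F. v \<in> d \<and> d \<in> S})" for S
  \<comment> \<open>Everything that stays away from \<open>v\<close>; a ball off \<open>W\<close>
    sees only edges and faces at \<open>v\<close>.\<close>
  define W where "W = (V - {v}) \<union> \<Union>{d \<in> E. v \<notin> d} \<union> \<Union>(closure ` {F \<in> faces. v \<notin> closure F})"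
  have cls: "closed (side S)" for S
    unfolding side_def using finite_E finite_faces plane_graph_edge(1)[OF plane]
    by (intro closed_Un closed_Union) auto
  have clW: "closed W"
    unfolding W_def using finite_V finite_E finite_faces plane_graph_edge(1)[OF plane]
    by (intro closed_Un closed_Union finite_imp_closed) auto
  have vW: "v \<notin> W" unfolding W_def by blast
  have vG: "v \<in> graph" using v(1) unfolding graph_def by blast
  have vD: "v \<in> interior D" using vG graph_subset v(2) interior_eq by blast
  have "open (- W \<inter> interior D)" using clW by (simp add: open_Compl open_Int)
  then obtain r where r: "r > 0" "ball v r \<subseteq> - W \<inter> interior D"
    using vW vD by (metis ComplI IntI openE)
  have clos: "x \<in> F \<or> x \<in> frontier F" if "F \<in> faces" "x \<in> closure F" for x F
    using that face(1)[OF that(1)] by (auto simp: frontier_def interior_open)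
  have at_v: "\<exists>d\<in>sides F. v \<in> d" if F: "F \<in> faces" "v \<in> closure F" for F
    using clos[OF F] face(4)[OF F(1)] vG frontier_face[OF F(1)] by blast
  have cov: "ball v r - {v} \<subseteq> side A \<union> side (- A)"
  proof
    fix x assume x: "x \<in> ball v r - {v}"
    then have xW: "x \<notin> W" "x \<in> D" using r(2) interior_subset[of D] by blast+
    show "x \<in> side A \<union> side (- A)"
    proof (cases "x \<in> graph")
      case True
      then obtain d where "d \<in> E" "x \<in> d" "v \<in> d" using xW(1) x unfolding graph_def W_def by blast
      then show ?thesis unfolding side_def by blast
    next
      case False
      then obtain F where F: "F \<in> faces" "x \<in> F" using in_face xW(2) by blast
      then have xF: "x \<in> closure F" using closure_subset by blast
      then have "v \<in> closure F" using xW(1) F(1) unfolding W_def by blast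
      then obtain d where "d \<in> sides F" "v \<in> d" using at_v F(1) by blast
      then show ?thesis using xF F(1) unfolding side_def by blast
    qed
  qed
  \<comment> \<open>A graph point may lie in \<open>side S\<close> only through the closure of a
    face with a side in \<open>S\<close> at \<open>v\<close>. Its edge is then again a side of that
    face at \<open>v\<close>, and \<open>no\<close> forbids the face to mix classes, so this edge is
    in \<open>S\<close> as well.\<close>
  have edge_at: "\<exists>d\<in>E. v \<in> d \<and> x \<in> d \<and> d \<in> S \<and> (\<forall>d'\<in>E. x \<in> d' \<longrightarrow> d' = d)"
    if x: "x \<in> ball v r - {v}" "x \<in> side S" "x \<in> graph" and S: "S = A \<or> S = - A" for x S
  proof -
    have xW: "x \<notin> W" using x(1) r(2) by blast
    then have xV: "x \<notin> V" using x(1) unfolding W_def by blast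
    have uniq: "d' = d" if "d \<in> E" "x \<in> d" "d' \<in> E" "x \<in> d'" for d d'
      using plane_graph_edge_unique[OF plane that(3,1,4,2) xV] .
    consider d where "d \<in> E" "v \<in> d" "d \<in> S" "x \<in> d" |
      F d where "F \<in> faces" "d \<in> sides F" "v \<in> d" "d \<in> S" "x \<in> closure F"
      using x(2) unfolding side_def by blast
    then show ?thesis
    proof cases
      case 1
      then show ?thesis using uniq by blast
    next
      case 2
      obtain d' where d': "d' \<in> sides F" "x \<in> d'"
        using clos[OF 2(1,5)] face(4)[OF 2(1)] x(3) frontier_face[OF 2(1)] by blast
      then have d'E: "d' \<in> E" by (simp add: sides_def)
      have vd': "v \<in> d'" using xW d'E d'(2) unfolding W_def by blast
      have "d' \<in> S" using no 2 d'(1) vd' S by blast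
      then show ?thesis using d'E vd' d'(2) uniq by blast
    qed
  qed
  have disj: "side A \<inter> side (- A) \<inter> (ball v r - {v}) = {}"
  proof (rule ccontr)
    assume "\<not> ?thesis"
    then obtain x where x: "x \<in> side A" "x \<in> side (- A)" "x \<in> ball v r - {v}" by blast
    show False
    proof (cases "x \<in> graph")
      case True
      show False using edge_at[OF x(3,1) True] edge_at[OF x(3,2) True] by blast
    next
      case False
      obtain F d where F: "F \<in> faces" "d \<in> sides F" "v \<in> d" "d \<in> A" "x \<in> closure F"
        using x(1) False unfolding side_def graph_def by blast
      obtain F' d' where F': "F' \<in> faces" "d' \<in> sides F'" "v \<in> d'" "d' \<notin> A" "x \<in> closure F'"
        using x(2) False unfolding side_def graph_def by blast
      show False
        using clos[OF F(1,5)] clos[OF F'(1,5)] face(7)[OF F(1)] face(7)[OF F'(1)] False face_disjoint[OF F(1) F'(1)] no F F' by blast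
    qed
  qed
  have conn: "connected (ball v r - {v})" by (rule connected_punctured_ball) simp
  \<comment> \<open>A connected edge cannot jump from \<open>v\<close> to the outside of the ball;
    hence both parts are nonempty.\<close>
  have near: "\<exists>x\<in>d. x \<in> ball v r - {v}" if d: "d \<in> E" "v \<in> d" for d
  proof (rule ccontr)
    assume n: "\<not> ?thesis"
    obtain p where p: "p \<in> d" "p \<notin> V" using plane_graph_edge(4)[OF plane d(1)] by blast
    have vr: "v \<in> ball v r" using r(1) by simp
    have "ball v r \<inter> - {v} \<inter> d = {}" using n by blast
    moreover have "d \<subseteq> ball v r \<union> - {v}" using vr by blast
    moreover have "open (- {v})" by (simp add: open_Compl)
    ultimately have "ball v r \<inter> d = {} \<or> - {v} \<inter> d = {}"
      using connectedD[OF plane_graph_edge(2)[OF plane d(1)] open_ball[of v r], of "- {v}"] by metis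
    moreover have "v \<in> ball v r \<inter> d" "p \<in> - {v} \<inter> d" using vr d(2) p v(1) by auto
    ultimately show False by blast
  qed
  have "side A \<inter> (ball v r - {v}) \<noteq> {}" using near[OF A(1,2)] A unfolding side_def by blast
  moreover have "side (- A) \<inter> (ball v r - {v}) \<noteq> {}" using near[OF B(1,2)] B unfolding side_def by blast
  ultimately show False
    using connected_closedD[OF conn disj cov cls cls] by blast
qed

section \<open>Euler's inequality for induced subgraphs\<close>

lemma induced_outer_component:
  assumes U: "U \<subseteq> V - frontier D" and H: "H = {e \<in> E. e \<inter> V \<subseteq> U}"
    and reach: "\<And>X. X \<noteq> {} \<Longrightarrow> X \<subseteq> V - U - frontier D \<Longrightarrow>
      \<exists>e\<in>E. \<exists>x\<in>X. \<exists>y\<in>V - U - X. e \<inter> V = {x, y}"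
  obtains Q where "Q \<in> components (- (U \<union> \<Union>H))" "frontier D \<union> - D \<subseteq> Q" "V - U \<subseteq> Q"
proof -
  let ?T = "U \<union> \<Union>H"
  have TV: "?T \<inter> V \<subseteq> U" using U unfolding H by blast
  have T_edge: "p \<in> V" if ep: "e \<in> E" "e \<notin> H" "p \<in> e" "p \<in> ?T" for e p
  proof (rule ccontr)
    assume pV: "p \<notin> V"
    then obtain e' where e': "e' \<in> H" "p \<in> e'" using ep(4) U by blast
    then have "e' \<in> E" by (simp add: H)
    then show False using plane_graph_edge_unique[OF plane ep(1) _ ep(3) e'(2) pV] e'(1) ep(2) by blast
  qed
  have "p \<notin> ?T" if p: "p \<in> frontier D" for p
  proof
    assume pT: "p \<in> ?T"
    then have "p \<notin> V" using p TV U by blast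
    then obtain e where e: "e \<in> H" "p \<in> e" using pT U by blast
    then have eE: "e \<in> E" "e \<inter> V \<subseteq> U" by (simp_all add: H)
    then have "e \<inter> V \<subseteq> frontier D"
      using rim_iff[OF eE(1) e(2) \<open>p \<notin> V\<close>] p by (auto simp: rim_def)
    moreover obtain u where "u \<in> e \<inter> V" using plane_graph_ends[OF plane eE(1)] by blast
    ultimately show False using eE(2) U by blast
  qed
  moreover have "?T \<subseteq> D" using graph_subset U unfolding graph_def H by blast
  ultimately have sub: "frontier D \<union> - D \<subseteq> - ?T" by blast
  \<comment> \<open>As the closure of the connected exterior this set is connected, and the induced
    subgraph avoids it, so a single region \<open>Q\<close> contains it.\<close>
  have eq: "closure (- D) = frontier D \<union> - D"
    using outer(3) by (metis closure_Un_frontier sup_commute)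
  have "connected (frontier D \<union> - D)"
    using connected_imp_connected_closure[OF outer(1)] unfolding eq .
  moreover have "- D \<noteq> {}" using outer(2) by (metis bounded_empty)
  ultimately obtain Q where Q: "Q \<in> components (- ?T)" "frontier D \<union> - D \<subseteq> Q"
    using sub exists_component_superset[OF sub] by blast
  have "V - U \<subseteq> Q"
  proof (rule ccontr)
    assume "\<not> V - U \<subseteq> Q"
    \<comment> \<open>The vertices not in \<open>Q\<close> are internal, so \<open>reach\<close>
      gives an edge from them to a vertex of \<open>Q\<close> off \<open>U\<close>. That edge misses
      the induced subgraph and would carry its first end into \<open>Q\<close>.\<close>
    moreover have "V - U - Q \<subseteq> V - U - frontier D" using Q(2) by blast
    ultimately obtain e y z where e: "e \<in> E" "e \<inter> V = {y, z}" "y \<in> V - U - Q" "z \<in> V - U - (V - U - Q)"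
      using reach[of "V - U - Q"] by blast
    then have "e \<notin> H" by (auto simp: H)
    have "e \<subseteq> - ?T"
    proof
      fix x assume x: "x \<in> e"
      show "x \<in> - ?T"
      proof
        assume xT: "x \<in> ?T"
        then have "x \<in> V" by (rule T_edge[OF e(1) \<open>e \<notin> H\<close> x])
        then have "x \<in> {y, z}" "x \<in> U" using x xT TV e(2) by blast+
        then show False using e(3,4) by blast
      qed
    qed
    moreover have "z \<in> e" "y \<in> e" "z \<in> Q" using e(2-4) by blast+
    ultimately have "e \<subseteq> Q"
      using components_maximal[OF Q(1) plane_graph_edge(2)[OF plane e(1)]] by blast
    then show False using \<open>y \<in> e\<close> e(3) by blast
  qed
  then show ?thesis using that Q by blast
qed

text \<open>A bounded component of the complement of the induced subgraph contains no vertex, hence no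
  part of an edge, so it is a face of the triangulation.\<close>

lemma induced_bounded_component:
  assumes U: "U \<subseteq> V - frontier D" and H: "H = {e \<in> E. e \<inter> V \<subseteq> U}"
    and Q: "Q \<in> components (- (U \<union> \<Union>H))" "frontier D \<union> - D \<subseteq> Q" "V - U \<subseteq> Q"
    and K: "K \<in> components (- (U \<union> \<Union>H))" "K \<noteq> Q"
  shows "K \<in> faces \<and> V \<inter> frontier K \<subseteq> U"
proof -
  let ?T = "U \<union> \<Union>H"
  have UV: "U \<subseteq> V" using U by blast
  have TV: "?T \<inter> V \<subseteq> U" using U unfolding H by blast
  have KO: "K \<inter> Q = {}" using components_nonoverlap[OF K(1) Q(1)] K(2) by blast
  have KT: "K \<inter> ?T = {}" using in_components_subset[OF K(1)] by blast
  have Ke: "K \<inter> e = {}" if e: "e \<in> E" for e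
  proof (cases "e \<in> H")
    case True
    then show ?thesis using KT by blast
  next
    case False
    obtain u v where uv: "u \<in> V" "v \<in> V" "u \<noteq> v" "e \<inter> V = {u, v}"
      using plane_graph_ends[OF plane e] by blast
    \<comment> \<open>An edge outside \<open>H\<close> has an end \<open>y\<close> off
      \<open>U\<close>, hence in \<open>Q\<close>; at most the other end \<open>z\<close> touches
      the induced subgraph, so the rest of the edge follows \<open>y\<close> into
      \<open>Q\<close>.\<close>
    obtain y z where yz: "e \<inter> V = {z, y}" "y \<noteq> z" "y \<notin> U" "y \<in> V"
    proof (cases "v \<in> U")
      case True
      then have "u \<notin> U" using False e uv(4) by (auto simp: H)
      then show ?thesis using that[of v u] uv by (simp add: insert_commute)
    next
      case False
      then show ?thesis using that[of u v] uv by simp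
    qed
    obtain g where g: "arc g" "path_image g = e" "pathstart g = z" "pathfinish g = y"
      using plane_graph_arc[OF plane e yz(1)] by blast
    have con: "connected (e - {z})" using arc_minus_start_connected[OF g(1)] g by simp
    have T_edge: "p \<in> V" if ep: "p \<in> e" "p \<in> ?T" for p
    proof (rule ccontr)
      assume pV: "p \<notin> V"
      then obtain e' where e': "e' \<in> H" "p \<in> e'" using ep(2) UV by blast
      then have "e' \<in> E" by (simp add: H)
      then show False using plane_graph_edge_unique[OF plane e _ ep(1) e'(2) pV] e'(1) False by blast
    qed
    have sub: "e - {z} \<subseteq> - ?T" using T_edge TV yz by blast
    have "y \<in> e" using yz(1) by blast
    moreover have "y \<in> Q" using Q(3) yz by blast
    ultimately have "e - {z} \<subseteq> Q"
      using components_maximal[OF Q(1) con sub] yz(2) by blast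
    moreover have "z \<notin> K"
    proof (cases "z \<in> U")
      case True
      then show ?thesis using KT by blast
    next
      case False
      then show ?thesis using Q(3) KO yz(1) by blast
    qed
    ultimately show ?thesis using KO by blast
  qed
  have "K \<inter> graph = {}" using KT KO Q(3) Ke unfolding graph_def by blast
  moreover have "K \<subseteq> D" using KO Q(2) by blast
  ultimately have KG: "K \<subseteq> D - graph" by blast
  have Kc: "connected K" "K \<noteq> {}"
    using in_components_connected[OF K(1)] in_components_nonempty[OF K(1)] by blast+
  then obtain F where F: "F \<in> faces" "K \<subseteq> F"
    using exists_component_superset[OF KG] KG unfolding faces_def by blast
  have "?T \<subseteq> graph" using UV unfolding graph_def H by blast
  then have "K = F" using face(4)[OF F(1)] components_maximal[OF K(1) face(2)[OF F(1)]] F(2) Kc(2) F(2) by blast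
  have "closed ?T"
    using finite_V finite_E plane_graph_edge(1)[OF plane] UV
    by (intro closed_Un closed_Union finite_imp_closed) (auto simp: H intro: finite_subset)
  then have "V \<inter> frontier K \<subseteq> U" using frontier_of_components_closed_complement K(1) TV by blast
  then show ?thesis using F(1) \<open>K = F\<close> by simp
qed

lemma plane_graph_induced:
  assumes U: "U \<subseteq> V"
  shows "plane_graph U {e \<in> E. e \<inter> V \<subseteq> U}"
proof -
  have eq: "e \<inter> U = e \<inter> V" if "e \<inter> V \<subseteq> U" for e using that U by blast
  show ?thesis
    unfolding plane_graph_def
  proof (intro conjI ballI impI)
    show "finite U" using U finite_V finite_subset by blast
    show "finite {e \<in> E. e \<inter> V \<subseteq> U}" using finite_E by simp
    fix e assume e: "e \<in> {e \<in> E. e \<inter> V \<subseteq> U}"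
    show "\<exists>u v. joined_by_arc u v e \<and> e \<inter> U = {u, v}"
    proof -
      have eE: "e \<in> E" "e \<inter> V \<subseteq> U" using e by simp_all
      have "\<exists>u v. joined_by_arc u v e \<and> e \<inter> V = {u, v}"
        using plane eE(1) unfolding plane_graph_def by meson
      then show ?thesis using eq[OF eE(2)] by simp
    qed
    fix e' assume e': "e' \<in> {e \<in> E. e \<inter> V \<subseteq> U}"
    show "e = e'" if "e \<inter> U = e' \<inter> U"
    proof (rule plane_graph_ends_inj[OF plane])
      show "e \<in> E" "e' \<in> E" using e e' by simp_all
      have "e \<inter> U = e \<inter> V" "e' \<inter> U = e' \<inter> V" using e e' by (simp_all add: eq)
      then show "e \<inter> V = e' \<inter> V" using that by (simp only:)
    qed
    show "e \<inter> e' \<subseteq> U" if "e \<noteq> e'"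
    proof
      fix p assume p: "p \<in> e \<inter> e'"
      then show "p \<in> U" using plane_graph_edge_unique[OF plane, of e e' p] e e' that p e by blast
    qed
  qed
qed

text \<open>The regions are the outer one and at most the faces spanned by \<open>U\<close>, and
  there is at least one component. Both estimates turn Euler's equation into an inequality in the
  direction that peeling needs, however many pieces \<open>U\<close> has.\<close>

lemma euler_induced_subgraph:
  assumes U: "U \<subseteq> V - frontier D" "U \<noteq> {}"
    and reach: "\<And>X. X \<noteq> {} \<Longrightarrow> X \<subseteq> V - U - frontier D \<Longrightarrow>
      \<exists>e\<in>E. \<exists>x\<in>X. \<exists>y\<in>V - U - X. e \<inter> V = {x, y}"
  shows "card {e \<in> E. e \<inter> V \<subseteq> U} + 1 \<le> card U + card {F \<in> faces. V \<inter> frontier F \<subseteq> U}"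
proof -
  define H where "H = {e \<in> E. e \<inter> V \<subseteq> U}"
  let ?T = "U \<union> \<Union>H" and ?F = "{F \<in> faces. V \<inter> frontier F \<subseteq> U}"
  obtain Q where Q: "Q \<in> components (- ?T)" "frontier D \<union> - D \<subseteq> Q" "V - U \<subseteq> Q"
    by (rule induced_outer_component[OF U(1) H_def reach])
  have sub: "components (- ?T) \<subseteq> insert Q ?F"
    using induced_bounded_component[OF U(1) H_def Q] by blast
  have "card (components (- ?T)) \<le> card ?F + 1"
    using finite_faces card_mono[OF _ sub] by (simp add: card_insert_if split: if_splits)
  moreover have two_sided: "?T \<subseteq> graph" "\<And>e. e \<in> H \<Longrightarrow> two_sided U graph e"
  proof -
    show "?T \<subseteq> graph" using U(1) unfolding graph_def H_def by blast
    fix e assume "e \<in> H"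
    then have "e \<in> E" "e - U \<subseteq> e - V" by (auto simp: H_def)
    then show "two_sided U graph e" using two_sided_edge[of e] unfolding two_sided_def by (meson subsetD)
  qed
  moreover have pg: "plane_graph U H" unfolding H_def using U(1) by (intro plane_graph_induced) blast
  moreover have "card (components ?T) \<ge> 1"
    using euler_plane_graph[OF pg two_sided] U(2) by (simp add: Suc_le_eq card_gt_0_iff)
  ultimately show ?thesis
    using euler_plane_graph[OF pg two_sided] unfolding H_def by linarith
qed

theorem vertex_bound:
  assumes deg: "\<And>v. v \<in> V - frontier D \<Longrightarrow> 6 \<le> vertex_degree E v"
  shows "12 * (card V - 1) \<le> card (V \<inter> frontier D) * (card (V \<inter> frontier D) + 6)"
proof -
  interpret triangle_incidence V E faces "V \<inter> frontier D" "\<lambda>e. e \<inter> V" "\<lambda>F. V \<inter> frontier F" sides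
  proof
    show "finite V" "finite E" "finite faces" by (fact finite_V finite_E finite_faces)+
    show "\<exists>u v. u \<in> V \<and> v \<in> V \<and> u \<noteq> v \<and> e \<inter> V = {u, v}" if "e \<in> E" for e
      by (rule plane_graph_ends[OF plane that])
    show "\<exists>a b c e1 e2 e3. distinct [a, b, c] \<and> V \<inter> frontier F = {a, b, c} \<and>
          sides F = {e1, e2, e3} \<and> sides F \<subseteq> E \<and>
          e1 \<inter> V = {a, b} \<and> e2 \<inter> V = {b, c} \<and> e3 \<inter> V = {c, a}" if F: "F \<in> faces" for F
      by (rule face_triangle[OF F]) (intro exI conjI)
    show "card (faces_at e) = 2" if e: "e \<in> E" "\<not> e \<inter> V \<subseteq> V \<inter> frontier D" for e
    proof -
      have "e \<in> E - rim" using e by (auto simp: rim_def)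
      then obtain F1 F2 where "F1 \<noteq> F2" "faces_at e = {F1, F2}" by (rule inner_two_faces)
      then show ?thesis by (metis card_2_iff)
    qed
    have one: "card (faces_at e) = 1" if e: "e \<in> rim" for e
      using rim_one_face[OF e] by (metis card_1_singleton_iff One_nat_def)
    show "card (faces_at e) \<le> 2" if e: "e \<in> E" for e
    proof (cases "e \<in> rim")
      case True
      then show ?thesis using one by simp
    next
      case False
      then have "e \<in> E - rim" using e by simp
      then obtain F1 F2 where "F1 \<noteq> F2" "faces_at e = {F1, F2}" by (rule inner_two_faces)
      then show ?thesis by (metis card_2_iff order_refl)
    qed
    show "\<exists>e\<in>E. v \<in> e \<inter> V \<and> card (faces_at e) \<le> 1"
      if v: "v \<in> V \<inter> frontier D" for v
    proof -
      obtain e where "e \<in> rim" "v \<in> e" using rim(3)[OF v] by blast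
      then show ?thesis using one[of e] v by (auto simp: rim_def)
    qed
    show "2 * card E = 3 * card faces + card (V \<inter> frontier D)" by (rule boundary_count)
    show "\<exists>f\<in>faces. \<exists>d\<in>sides f \<inter> A. \<exists>d'\<in>sides f - A. v \<in> d \<inter> V \<and> v \<in> d' \<inter> V"
      if "v \<in> V - V \<inter> frontier D" "e \<in> E" "v \<in> e \<inter> V" "e \<in> A" "e' \<in> E" "v \<in> e' \<inter> V" "e' \<notin> A"
      for v e A e'
    proof -
      show ?thesis using that link_connected[of v e A e'] that(2,4,5,7) by blast
    qed
    show "6 \<le> card {e \<in> E. v \<in> e \<inter> V}" if v: "v \<in> V - V \<inter> frontier D" for v
    proof -
      have "{e \<in> E. v \<in> e \<inter> V} = {e \<in> E. v \<in> e}" using v by blast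
      moreover have "6 \<le> vertex_degree E v" using v by (intro deg) blast
      ultimately show ?thesis unfolding vertex_degree_def by simp
    qed
    show "card V + card faces = card E + 1" by (rule euler_formula)
    show "card {e \<in> E. e \<inter> V \<subseteq> U} + 1 \<le> card U + card {f \<in> faces. V \<inter> frontier f \<subseteq> U}"
      if U: "U \<subseteq> V - V \<inter> frontier D" "U \<noteq> {}"
        "\<And>X. X \<noteq> {} \<Longrightarrow> X \<subseteq> V - U - V \<inter> frontier D \<Longrightarrow>
          \<exists>e\<in>E. \<exists>x\<in>X. \<exists>y\<in>V - U - X. e \<inter> V = {x, y}" for U
    proof (rule euler_induced_subgraph[OF _ U(2)])
      show "U \<subseteq> V - frontier D" using U(1) by blast
      fix X assume "X \<noteq> {}" "X \<subseteq> V - U - frontier D"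
      then show "\<exists>e\<in>E. \<exists>x\<in>X. \<exists>y\<in>V - U - X. e \<inter> V = {x, y}"
        using U(3)[of X] by blast
    qed
  qed
  show ?thesis by (rule isoperimetric)
qed

end

lemma round_bound:
  assumes "12 * (V - 1) \<le> n * (n + 6)"
  shows "int V \<le> round ((real n + 3)\<^sup>2 / 12)"
proof -
  have "12 * (real V - 1) \<le> real n * (real n + 6)"
  proof (cases "V = 0")
    case False
    then have "12 * (real V - 1) = real (12 * (V - 1))" by (simp add: of_nat_diff)
    also have "\<dots> \<le> real (n * (n + 6))" using assms by (simp only: of_nat_le_iff)
    finally show ?thesis by simp
  qed (simp add: order_trans[of _ 0])
  then have "real V \<le> (real n + 3)\<^sup>2 / 12 + 1 / 2"
    by (simp add: power2_eq_square field_simps)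
  then show ?thesis unfolding round_def by (simp add: le_floor_iff)
qed

section \<open>The triangular lattice\<close>

text \<open>Oblique coordinates for the basis \<open>1\<close>, \<open>cis (pi / 3)\<close>. The
  lines of the lattice are those on which \<open>cx\<close>, \<open>cy\<close> or
  \<open>cx + cy\<close> is a fixed integer.\<close>

definition pt :: "real \<Rightarrow> real \<Rightarrow> complex" where
  "pt a b = of_real a + of_real b * cis (pi / 3)"

definition cx :: "complex \<Rightarrow> real" where "cx p = Re p - Im p / sqrt 3"
definition cy :: "complex \<Rightarrow> real" where "cy p = 2 * Im p / sqrt 3"

lemma cis_third: "cis (pi / 3) = Complex (1 / 2) (sqrt 3 / 2)"
  by (simp add: cis.ctr cos_60 sin_60)

lemma cx_pt [simp]: "cx (pt a b) = a" and cy_pt [simp]: "cy (pt a b) = b"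
  by (simp_all add: cx_def cy_def pt_def cis_third field_simps)

lemma pt_cx_cy: "pt (cx p) (cy p) = p"
  by (rule complex_eqI) (simp_all add: cx_def cy_def pt_def cis_third field_simps)

lemma pt_eq_iff [simp]: "pt a b = pt c d \<longleftrightarrow> a = c \<and> b = d"
  by (metis cx_pt cy_pt)

lemma eq_pt_iff: "p = pt a b \<longleftrightarrow> cx p = a \<and> cy p = b"
  by (metis cx_pt cy_pt pt_cx_cy)

lemma coords_linear [simp]:
  "cx (p + q) = cx p + cx q" "cy (p + q) = cy p + cy q"
  "cx (p - q) = cx p - cx q" "cy (p - q) = cy p - cy q"
  "cx (r *\<^sub>R p) = r * cx p" "cy (r *\<^sub>R p) = r * cy p"
  by (simp_all add: cx_def cy_def field_simps)

lemma continuous_coords [continuous_intros]: "continuous_on S cx" "continuous_on S cy"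
  unfolding cx_def cy_def by (intro continuous_intros; simp)+

text \<open>The norm form of the Eisenstein integers, integral on lattice points.\<close>

lemma norm_sq_coords: "(norm p)\<^sup>2 = (cx p)\<^sup>2 + cx p * cy p + (cy p)\<^sup>2"
  unfolding cmod_power2 cx_def cy_def by (simp add: power2_eq_square field_simps)

lemma triangular_lattice_iff: "p \<in> triangular_lattice \<longleftrightarrow> cx p \<in> \<int> \<and> cy p \<in> \<int>"
proof
  assume "p \<in> triangular_lattice"
  then obtain a b :: int where "p = of_int a + of_int b * cis (pi / 3)"
    unfolding triangular_lattice_def by blast
  then have "p = pt (of_int a) (of_int b)" by (simp add: pt_def)
  then show "cx p \<in> \<int> \<and> cy p \<in> \<int>" by simp
next
  assume "cx p \<in> \<int> \<and> cy p \<in> \<int>"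
  then obtain a b where "cx p = of_int a" "cy p = of_int b" by (auto elim!: Ints_cases)
  then have "p = of_int a + of_int b * cis (pi / 3)"
    using pt_cx_cy[of p] by (simp add: pt_def)
  then show "p \<in> triangular_lattice" unfolding triangular_lattice_def by blast
qed

lemma closed_segment_coords:
  "p \<in> closed_segment u v \<longleftrightarrow>
    (\<exists>t. 0 \<le> t \<and> t \<le> 1 \<and> cx p = (1 - t) * cx u + t * cx v \<and> cy p = (1 - t) * cy u + t * cy v)"
proof -
  have "p = (1 - t) *\<^sub>R u + t *\<^sub>R v \<longleftrightarrow>
      cx p = (1 - t) * cx u + t * cx v \<and> cy p = (1 - t) * cy u + t * cy v" for t
    using pt_cx_cy by (metis coords_linear(1,2,5,6))
  then show ?thesis by (auto simp: in_segment)
qed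

text \<open>A positive integer value of the norm form is at least 1.\<close>

lemma lattice_dist_ge_1:
  assumes "u \<in> triangular_lattice" "v \<in> triangular_lattice" "u \<noteq> v"
  shows "1 \<le> dist u v"
proof -
  have "cx (u - v) \<in> \<int>" "cy (u - v) \<in> \<int>" using assms by (simp_all add: triangular_lattice_iff)
  then obtain a b where ab: "cx (u - v) = of_int a" "cy (u - v) = of_int b" by (auto elim!: Ints_cases)
  have sq: "(dist u v)\<^sup>2 = of_int (a\<^sup>2 + a * b + b\<^sup>2)"
    unfolding dist_norm norm_sq_coords ab by simp
  have "0 < dist u v" using assms by simp
  then have "0 < (dist u v)\<^sup>2" by simp
  then have "1 \<le> a\<^sup>2 + a * b + b\<^sup>2" unfolding sq by (simp only: of_int_0_less_iff)
  then have "1 \<le> (dist u v)\<^sup>2" unfolding sq by (metis of_int_1_le_iff)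
  then show ?thesis
    using power_le_one_iff[of "dist u v" 2] by (metis zero_le_dist abs_le_square_iff abs_of_nonneg one_power2 zero_le_one)
qed

text \<open>A further lattice point on the segment would split length 1 into two lengths of at least
  1.\<close>

lemma lattice_segment:
  assumes "u \<in> triangular_lattice" "v \<in> triangular_lattice" "dist u v = 1"
  shows "closed_segment u v \<inter> triangular_lattice = {u, v}"
proof -
  have "w \<in> {u, v}" if w: "w \<in> closed_segment u v" "w \<in> triangular_lattice" for w
  proof (rule ccontr)
    assume "w \<notin> {u, v}"
    then have "1 \<le> dist u w" "1 \<le> dist w v" using lattice_dist_ge_1 assms w by auto
    moreover have "dist u v = dist u w + dist w v"
      using w(1) between between_mem_segment by metis
    ultimately show False using assms by simp
  qed
  then show ?thesis using assms by auto
qed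

text \<open>The six units of the Eisenstein integers. Four times the form is
  \<open>(2 * a + b)^2 + 3 * b^2\<close>, and symmetrically, which bounds both coordinates by 1 in
  absolute value.\<close>

lemma int_quadratic_1:
  fixes a b :: int
  assumes "a\<^sup>2 + a * b + b\<^sup>2 = 1"
  shows "(a, b) \<in> {(1, 0), (-1, 0), (0, 1), (0, -1), (1, -1), (-1, 1)}"
proof -
  have "(2 * a + b)\<^sup>2 + 3 * b\<^sup>2 = 4" "(2 * b + a)\<^sup>2 + 3 * a\<^sup>2 = 4"
    using assms by (simp_all add: power2_eq_square algebra_simps)
  then have "b\<^sup>2 \<le> 1" "a\<^sup>2 \<le> 1"
    using zero_le_power2[of "2 * a + b"] zero_le_power2[of "2 * b + a"] by linarith+
  then have "\<bar>a\<bar> \<le> 1" "\<bar>b\<bar> \<le> 1" by (simp_all add: abs_square_le_1)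
  then have "a = -1 \<or> a = 0 \<or> a = 1" "b = -1 \<or> b = 0 \<or> b = 1" by linarith+
  then show ?thesis using assms by auto
qed

text \<open>The three kinds of edges, indexed by the lower left corner of a unit rhombus: its horizontal
  side, its slanted side and its short diagonal.\<close>

definition hedge :: "int \<Rightarrow> int \<Rightarrow> complex set" where
  "hedge i j = {p. cy p = j \<and> i \<le> cx p \<and> cx p \<le> i + 1}"
definition vedge :: "int \<Rightarrow> int \<Rightarrow> complex set" where
  "vedge i j = {p. cx p = i \<and> j \<le> cy p \<and> cy p \<le> j + 1}"
definition dedge :: "int \<Rightarrow> int \<Rightarrow> complex set" where
  "dedge i j = {p. cx p + cy p = i + j + 1 \<and> i \<le> cx p \<and> cx p \<le> i + 1}"

lemma hedge_segment: "hedge i j = closed_segment (pt i j) (pt (i + 1) j)"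
proof (rule set_eqI)
  fix p
  show "p \<in> hedge i j \<longleftrightarrow> p \<in> closed_segment (pt i j) (pt (i + 1) j)"
    unfolding closed_segment_coords hedge_def
    by (auto simp: algebra_simps intro!: exI[of _ "cx p - i"])
qed

lemma vedge_segment: "vedge i j = closed_segment (pt i j) (pt i (j + 1))"
proof (rule set_eqI)
  fix p
  show "p \<in> vedge i j \<longleftrightarrow> p \<in> closed_segment (pt i j) (pt i (j + 1))"
    unfolding closed_segment_coords vedge_def
    by (auto simp: algebra_simps intro!: exI[of _ "cy p - j"])
qed

lemma dedge_segment: "dedge i j = closed_segment (pt i (j + 1)) (pt (i + 1) j)"
proof (rule set_eqI)
  fix p
  show "p \<in> dedge i j \<longleftrightarrow> p \<in> closed_segment (pt i (j + 1)) (pt (i + 1) j)"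
    unfolding closed_segment_coords dedge_def
    by (auto simp: algebra_simps intro!: exI[of _ "cx p - i"])
qed

lemma lattice_edge_cases:
  assumes "e \<in> triangular_lattice_edges"
  shows "\<exists>i j. e = hedge i j \<or> e = vedge i j \<or> e = dedge i j"
proof -
  obtain u v where e: "e = closed_segment u v" and uv: "u \<in> triangular_lattice"
    "v \<in> triangular_lattice" "dist u v = 1"
    using assms unfolding triangular_lattice_edges_def by blast
  obtain a b where u: "cx u = of_int a" "cy u = of_int b"
    using uv(1) by (auto simp: triangular_lattice_iff elim!: Ints_cases)
  obtain c d where v: "cx v = of_int c" "cy v = of_int d"
    using uv(2) by (auto simp: triangular_lattice_iff elim!: Ints_cases)
  have u': "u = pt a b" and v': "v = pt c d" using u v by (simp_all add: eq_pt_iff)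
  have "(dist v u)\<^sup>2 = of_int ((c - a)\<^sup>2 + (c - a) * (d - b) + (d - b)\<^sup>2)"
    unfolding dist_norm norm_sq_coords by (simp add: u v)
  then have "of_int ((c - a)\<^sup>2 + (c - a) * (d - b) + (d - b)\<^sup>2) = (1::real)"
    using uv(3) by (simp add: dist_commute)
  then have "(c - a)\<^sup>2 + (c - a) * (d - b) + (d - b)\<^sup>2 = 1" by (simp only: of_int_eq_1_iff)
  from int_quadratic_1[OF this] consider "c = a + 1" "d = b" | "a = c + 1" "d = b" | "c = a" "d = b + 1"
    | "c = a" "b = d + 1" | "c = a + 1" "b = d + 1" | "a = c + 1" "d = b + 1" by auto
  then show ?thesis
  proof cases
    case 1 then show ?thesis unfolding e u' v' hedge_segment by auto
  next
    case 2 then show ?thesis unfolding e u' v' hedge_segment closed_segment_commute[of "pt a b"] by auto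
  next
    case 3 then show ?thesis unfolding e u' v' vedge_segment by auto
  next
    case 4 then show ?thesis unfolding e u' v' vedge_segment closed_segment_commute[of "pt a b"] by auto
  next
    case 5 then show ?thesis unfolding e u' v' dedge_segment by auto
  next
    case 6 then show ?thesis unfolding e u' v' dedge_segment closed_segment_commute[of "pt a b"] by auto
  qed
qed

lemma lattice_pt [simp]: "pt (of_int a) (of_int b) \<in> triangular_lattice"
  by (simp add: triangular_lattice_iff)

lemma dist_pt: "dist (pt a b) (pt c d) = 1 \<longleftrightarrow> (a - c)\<^sup>2 + (a - c) * (b - d) + (b - d)\<^sup>2 = 1"
proof -
  have "dist (pt a b) (pt c d) = 1 \<longleftrightarrow> (dist (pt a b) (pt c d))\<^sup>2 = 1"
    using power2_eq_1_iff[of "dist (pt a b) (pt c d)"] zero_le_dist[of "pt a b" "pt c d"] by auto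
  then show ?thesis unfolding dist_norm norm_sq_coords by simp
qed

lemma edge_kinds_lattice:
  "hedge i j \<in> triangular_lattice_edges" "vedge i j \<in> triangular_lattice_edges" "dedge i j \<in> triangular_lattice_edges"
proof -
  have *: "closed_segment (pt (of_int a) (of_int b)) (pt (of_int c) (of_int d)) \<in> triangular_lattice_edges"
    if "(a - c)\<^sup>2 + (a - c) * (b - d) + (b - d)\<^sup>2 = 1" for a b c d :: int
  proof -
    have "dist (pt (of_int a) (of_int b)) (pt (of_int c) (of_int d)) = 1"
      unfolding dist_pt using arg_cong[OF that, of real_of_int] by simp
    then show ?thesis unfolding triangular_lattice_edges_def using lattice_pt by blast
  qed
  show "hedge i j \<in> triangular_lattice_edges" unfolding hedge_segment using *[of i "i + 1" j j] by simp
  show "vedge i j \<in> triangular_lattice_edges" unfolding vedge_segment using *[of i i j "j + 1"] by simp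
  show "dedge i j \<in> triangular_lattice_edges" unfolding dedge_segment using *[of i "i + 1" "j + 1" j] by simp
qed

text \<open>The edge through a point off the lattice can be read off the coordinates of the point.\<close>

lemma lattice_edge_unique:
  assumes e: "e \<in> triangular_lattice_edges" "e' \<in> triangular_lattice_edges"
    and p: "p \<in> e" "p \<in> e'" "p \<notin> triangular_lattice"
  shows "e = e'"
proof -
  have *: "d = (if cy p \<in> \<int> then hedge \<lfloor>cx p\<rfloor> \<lfloor>cy p\<rfloor> else if cx p \<in> \<int> then vedge \<lfloor>cx p\<rfloor> \<lfloor>cy p\<rfloor>
      else dedge \<lfloor>cx p\<rfloor> \<lfloor>cy p\<rfloor>)" if d: "d \<in> triangular_lattice_edges" "p \<in> d" for d
  proof -
    obtain i j where "d = hedge i j \<or> d = vedge i j \<or> d = dedge i j" using lattice_edge_cases[OF d(1)] by blast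
    then consider "d = hedge i j" | "d = vedge i j" | "d = dedge i j" by blast
    then show ?thesis
    proof cases
      case 1
      then have q: "cy p = j" "i \<le> cx p" "cx p \<le> i + 1" using d(2) by (auto simp: hedge_def)
      then have "cx p \<notin> \<int>" using p(3) by (simp add: triangular_lattice_iff)
      then have "cx p \<noteq> i + 1" by auto
      then have "\<lfloor>cx p\<rfloor> = i" using q by (simp add: floor_eq_iff)
      then show ?thesis using q 1 by simp
    next
      case 2
      then have q: "cx p = i" "j \<le> cy p" "cy p \<le> j + 1" using d(2) by (auto simp: vedge_def)
      then have "cy p \<notin> \<int>" using p(3) by (simp add: triangular_lattice_iff)
      then have "cy p \<noteq> j + 1" "cy p \<notin> \<int>" by auto
      then have "\<lfloor>cy p\<rfloor> = j" using q by (simp add: floor_eq_iff)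
      then show ?thesis using q 2 \<open>cy p \<notin> \<int>\<close> by simp
    next
      case 3
      then have q: "cx p + cy p = i + j + 1" "i \<le> cx p" "cx p \<le> i + 1" using d(2) by (auto simp: dedge_def)
      have "cx p = of_int (i + j + 1) - cy p" "cy p = of_int (i + j + 1) - cx p" using q by simp_all
      then have "cx p \<in> \<int> \<longleftrightarrow> cy p \<in> \<int>" by (metis Ints_diff Ints_of_int)
      then have n: "cx p \<notin> \<int>" "cy p \<notin> \<int>" using p(3) by (auto simp: triangular_lattice_iff)
      then have "cx p \<noteq> i + 1" "cx p \<noteq> i" by auto
      then have "\<lfloor>cx p\<rfloor> = i" "\<lfloor>cy p\<rfloor> = j" using q by (simp_all add: floor_eq_iff)
      then show ?thesis using n 3 by simp
    qed
  qed
  show ?thesis using *[OF e(1) p(1)] *[OF e(2) p(2)] by simp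
qed

section \<open>Lattice hexagons\<close>

text \<open>Serves two purposes: closures of open triangles, drawing \<open>q\<close> towards an
  inner point, and points that are not interior, with \<open>T\<close> a complement.\<close>

lemma closure_along_segment:
  fixes q c :: "'a::real_normed_vector"
  assumes "\<And>t. 0 < t \<Longrightarrow> t \<le> 1 \<Longrightarrow> q + t *\<^sub>R (c - q) \<in> T"
  shows "q \<in> closure T"
  unfolding closure_approachable
proof (intro allI impI)
  fix e :: real assume "0 < e"
  define t where "t = min 1 (e / (2 * (norm (c - q) + 1)))"
  have n: "0 < norm (c - q) + 1" by (simp add: add_nonneg_pos)
  have t: "0 < t" "t \<le> 1" using \<open>0 < e\<close> n by (simp_all add: t_def)
  have "t * (norm (c - q) + 1) \<le> e / 2"
  proof -
    have "t \<le> e / (2 * (norm (c - q) + 1))" by (simp add: t_def)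
    then show ?thesis using n by (simp add: field_simps)
  qed
  then have "t * norm (c - q) < e" using t \<open>0 < e\<close> by (simp add: algebra_simps)
  then have "dist (q + t *\<^sub>R (c - q)) q < e" using t by (simp add: dist_norm)
  then show "\<exists>y\<in>T. dist y q < e" using assms[OF t] by blast
qed

lemma open_strict_region:
  "open {p. a < cx p}" "open {p. cx p < a}" "open {p. a < cy p}" "open {p. cy p < a}"
  "open {p. a < cx p + cy p}" "open {p. cx p + cy p < a}"
  by (intro open_Collect_less continuous_intros)+

lemma closed_region:
  "closed {p. a \<le> cx p}" "closed {p. cx p \<le> a}" "closed {p. a \<le> cy p}" "closed {p. cy p \<le> a}"
  "closed {p. a \<le> cx p + cy p}" "closed {p. cx p + cy p \<le> a}"
  by (intro closed_Collect_le continuous_intros)+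

text \<open>The open halves of the unit rhombus at \<open>(i, j)\<close>, on either side of its
  short diagonal \<open>dedge i j\<close>.\<close>

definition up_tri :: "int \<Rightarrow> int \<Rightarrow> complex set" where
  "up_tri i j = {p. i < cx p \<and> j < cy p \<and> cx p + cy p < i + j + 1}"
definition down_tri :: "int \<Rightarrow> int \<Rightarrow> complex set" where
  "down_tri i j = {p. cx p < i + 1 \<and> cy p < j + 1 \<and> i + j + 1 < cx p + cy p}"

lemma open_tri: "open (up_tri i j)" "open (down_tri i j)"
  unfolding up_tri_def down_tri_def by (intro open_Collect_conj open_strict_region)+

lemma linear_coords: "linear cx" "linear cy" "linear (\<lambda>p. cx p + cy p)"
  by (simp_all add: linear_iff algebra_simps)

lemmas convex_strip = convex_linear_vimage[OF linear_coords(1)]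
  convex_linear_vimage[OF linear_coords(2)] convex_linear_vimage[OF linear_coords(3)]

lemma convex_tri: "convex (up_tri i j)" "convex (down_tri i j)"
proof -
  have "up_tri i j = cx -` {i<..} \<inter> cy -` {j<..} \<inter> (\<lambda>p. cx p + cy p) -` {..<i + j + 1}"
    by (auto simp: up_tri_def)
  then show "convex (up_tri i j)" by (simp only:) (intro convex_Int convex_strip convex_real_interval)
  have "down_tri i j = cx -` {..<i + 1} \<inter> cy -` {..<j + 1} \<inter> (\<lambda>p. cx p + cy p) -` {i + j + 1<..}"
    by (auto simp: down_tri_def)
  then show "convex (down_tri i j)" by (simp only:) (intro convex_Int convex_strip convex_real_interval)
qed

lemma closure_up_tri: "closure (up_tri i j) = {p. i \<le> cx p \<and> j \<le> cy p \<and> cx p + cy p \<le> i + j + 1}" (is "_ = ?K")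
proof
  have "closed ?K" by (intro closed_Collect_conj closed_region)
  then show "closure (up_tri i j) \<subseteq> ?K" by (intro closure_minimal) (auto simp: up_tri_def)
  show "?K \<subseteq> closure (up_tri i j)"
  proof
    fix q assume q: "q \<in> ?K"
    show "q \<in> closure (up_tri i j)"
    \<comment> \<open>The centroid: any step towards it makes all three inequalities strict.\<close>
    proof (rule closure_along_segment[where c = "pt (i + 1/3) (j + 1/3)"])
      fix t :: real assume t: "0 < t" "t \<le> 1"
      have "(1 - t) * i \<le> (1 - t) * cx q" "(1 - t) * j \<le> (1 - t) * cy q"
        "(1 - t) * (cx q + cy q) \<le> (1 - t) * (i + j + 1)"
        using q t by (intro mult_left_mono; simp)+
      then show "q + t *\<^sub>R (pt (i + 1/3) (j + 1/3) - q) \<in> up_tri i j"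
        using t by (simp add: up_tri_def algebra_simps)
    qed
  qed
qed

lemma closure_down_tri: "closure (down_tri i j) = {p. cx p \<le> i + 1 \<and> cy p \<le> j + 1 \<and> i + j + 1 \<le> cx p + cy p}" (is "_ = ?K")
proof
  have "closed ?K" by (intro closed_Collect_conj closed_region)
  then show "closure (down_tri i j) \<subseteq> ?K" by (intro closure_minimal) (auto simp: down_tri_def)
  show "?K \<subseteq> closure (down_tri i j)"
  proof
    fix q assume q: "q \<in> ?K"
    show "q \<in> closure (down_tri i j)"
    proof (rule closure_along_segment[where c = "pt (i + 2/3) (j + 2/3)"])
      fix t :: real assume t: "0 < t" "t \<le> 1"
      have "(1 - t) * cx q \<le> (1 - t) * (i + 1)" "(1 - t) * cy q \<le> (1 - t) * (j + 1)"
        "(1 - t) * (i + j + 1) \<le> (1 - t) * (cx q + cy q)"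
        using q t by (intro mult_left_mono; simp)+
      then show "q + t *\<^sub>R (pt (i + 2/3) (j + 2/3) - q) \<in> down_tri i j"
        using t by (simp add: down_tri_def algebra_simps)
    qed
  qed
qed

lemma frontier_up_tri: "frontier (up_tri i j) = hedge i j \<union> vedge i j \<union> dedge i j"
  unfolding frontier_def interior_open[OF open_tri(1)] closure_up_tri
  by (auto simp: up_tri_def hedge_def vedge_def dedge_def)

lemma frontier_down_tri: "frontier (down_tri i j) = hedge i (j + 1) \<union> vedge (i + 1) j \<union> dedge i j"
  unfolding frontier_def interior_open[OF open_tri(2)] closure_down_tri
  by (auto simp: down_tri_def hedge_def vedge_def dedge_def)

text \<open>The weak inequalities say that the sides, of lengths \<open>P - z\<close>,
  \<open>L - P\<close>, \<open>P + Q - L\<close>, \<open>L - Q\<close>, \<open>Q - z\<close> and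
  \<open>z\<close> in counterclockwise order, are nonnegative, so some may degenerate to points. The
  strict ones make the interior nonempty.\<close>

locale lattice_hexagon =
  fixes P Q z L :: int
  assumes bounds: "0 \<le> z" "z \<le> P" "z \<le> Q" "P \<le> L" "Q \<le> L" "L \<le> P + Q" "z < L" "0 < P" "0 < Q"
begin

definition D :: "complex set" where
  "D = {p. 0 \<le> cx p \<and> cx p \<le> P \<and> 0 \<le> cy p \<and> cy p \<le> Q \<and> z \<le> cx p + cy p \<and> cx p + cy p \<le> L}"

definition V :: "complex set" where "V = triangular_lattice \<inter> D"
definition E :: "complex set set" where "E = {e \<in> triangular_lattice_edges. e \<subseteq> D}"

lemma convex_D: "convex D"
proof -
  have "D = cx -` {0..P} \<inter> cy -` {0..Q} \<inter> (\<lambda>p. cx p + cy p) -` {z..L}"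
    by (auto simp: D_def)
  then show ?thesis by (simp only:) (intro convex_Int convex_strip convex_real_interval)
qed

lemma closed_D: "closed D"
  unfolding D_def by (intro closed_Collect_conj closed_region)

lemma bounded_D: "bounded D"
proof (rule boundedI)
  fix p assume p: "p \<in> D"
  have "norm p = norm (pt (cx p) (cy p))" by (simp add: pt_cx_cy)
  also have "\<dots> \<le> \<bar>cx p\<bar> + \<bar>cy p\<bar>"
    unfolding pt_def by (rule order_trans[OF norm_triangle_ineq]) (simp add: norm_mult)
  also have "\<dots> \<le> P + Q" using p by (simp add: D_def)
  finally show "norm p \<le> P + Q" .
qed

lemma interior_D: "interior D =
  {p. 0 < cx p \<and> cx p < P \<and> 0 < cy p \<and> cy p < Q \<and> z < cx p + cy p \<and> cx p + cy p < L}" (is "_ = ?S")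
proof
  have "open ?S" by (intro open_Collect_conj open_strict_region)
  then show "?S \<subseteq> interior D" by (intro interior_maximal) (auto simp: D_def)
  show "interior D \<subseteq> ?S"
  proof
    fix p assume p: "p \<in> interior D"
    then have pD: "p \<in> D" using interior_subset by blast
    \<comment> \<open>A direction that leaves \<open>D\<close> at once shows \<open>p\<close> to be
      a limit of the complement; each of the six active constraints has such a lattice
      direction.\<close>
    have out: "\<not> (\<forall>t>0. p + t *\<^sub>R c \<notin> D)" for c
    proof
      assume *: "\<forall>t>0. p + t *\<^sub>R c \<notin> D"
      have "p \<in> closure (- D)"
        by (rule closure_along_segment[where c = "p + c"]) (use * in simp)
      then show False using p by (simp add: closure_complement)
    qed
    show "p \<in> ?S"
    proof (rule ccontr)
      assume "p \<notin> ?S"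
      then consider "cx p = 0" | "cx p = P" | "cy p = 0" | "cy p = Q" | "cx p + cy p = z" | "cx p + cy p = L"
        using pD by (auto simp: D_def)
      then show False
      proof cases
        case 1 then show False using out[of "pt (-1) 0"] by (auto simp: D_def)
      next
        case 2 then show False using out[of "pt 1 0"] by (auto simp: D_def)
      next
        case 3 then show False using out[of "pt 0 (-1)"] by (auto simp: D_def)
      next
        case 4 then show False using out[of "pt 0 1"] by (auto simp: D_def)
      next
        case 5 then show False using out[of "pt (-1) 0"] by (auto simp: D_def)
      next
        case 6 then show False using out[of "pt 1 0"] by (auto simp: D_def)
      qed
    qed
  qed
qed

lemma interior_nonempty: "interior D \<noteq> {}"
proof -
  define m :: real where "m = min L (P + Q)"
  \<comment> \<open>The point of the diagonal from \<open>(0, 0)\<close> to \<open>(P, Q)\<close> at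
    which the coordinate sum is halfway between \<open>z\<close> and \<open>m\<close>.\<close>
  define s where "s = (z + m) / (2 * (P + Q))"
  have m: "m \<le> L" "m \<le> P + Q" "z < m" using bounds by (auto simp: m_def)
  have PQ: "0 < real_of_int P + Q" "0 \<le> real_of_int z" using bounds by simp_all
  then have s: "0 < s" "s < 1"
    using m by (simp_all add: s_def)
  have sPQ: "s * (P + Q) = (z + m) / 2"
    using PQ(1) unfolding s_def by (simp add: field_simps)
  have "s * P < P" "s * Q < Q" "0 < s * P" "0 < s * Q" using s bounds by simp_all
  moreover have "z < s * P + s * Q" "s * P + s * Q < L"
    using sPQ m by (simp_all add: distrib_left)
  ultimately have "pt (s * P) (s * Q) \<in> interior D" unfolding interior_D by simp
  then show ?thesis by blast
qed

lemma homeomorphic_D: "D homeomorphic cball (0::complex) 1"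
  using convex_D closed_D bounded_D interior_nonempty
  by (intro homeomorphic_convex_compact_cball) (auto simp: compact_eq_bounded_closed)

lemma finite_V: "finite V"
proof (rule finite_subset)
  show "V \<subseteq> (\<lambda>(a, b). pt (of_int a) (of_int b)) ` ({0..P} \<times> {0..Q})"
  proof
    fix p assume p: "p \<in> V"
    then obtain a b where ab: "cx p = of_int a" "cy p = of_int b"
      by (auto simp: V_def triangular_lattice_iff elim!: Ints_cases)
    then have "p = pt (of_int a) (of_int b)" by (simp add: eq_pt_iff)
    moreover have "a \<in> {0..P}" "b \<in> {0..Q}" using p ab by (auto simp: V_def D_def)
    ultimately show "p \<in> (\<lambda>(a, b). pt (of_int a) (of_int b)) ` ({0..P} \<times> {0..Q})"
      by (intro image_eqI[of _ _ "(a, b)"]) simp_all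
  qed
qed simp

lemma edge_ends:
  assumes "e \<in> E"
  obtains u v where "u \<in> V" "v \<in> V" "dist u v = 1" "e = closed_segment u v" "e \<inter> V = {u, v}"
proof -
  obtain u v where *: "u \<in> triangular_lattice" "v \<in> triangular_lattice" "dist u v = 1" "e = closed_segment u v"
    using assms unfolding E_def triangular_lattice_edges_def by blast
  have "e \<subseteq> D" using assms by (simp add: E_def)
  then have "u \<in> V" "v \<in> V" using * by (auto simp: V_def)
  moreover have "e \<inter> V = {u, v}"
    using lattice_segment[OF *(1-3)] \<open>e \<subseteq> D\<close> *(4) unfolding V_def by blast
  ultimately show ?thesis using that * by blast
qed

lemma segment_E:
  assumes "u \<in> V" "v \<in> V" "dist u v = 1"
  shows "closed_segment u v \<in> E"
  using assms closed_segment_subset[OF _ _ convex_D]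
  unfolding E_def V_def triangular_lattice_edges_def by blast

lemma plane_graph: "plane_graph V E"
  unfolding plane_graph_def
proof (intro conjI ballI impI)
  show "finite V" by (rule finite_V)
  have "E \<subseteq> (\<lambda>(u, v). closed_segment u v) ` (V \<times> V)"
  proof
    fix e assume "e \<in> E"
    then obtain u v where "u \<in> V" "v \<in> V" "e = closed_segment u v" by (rule edge_ends)
    then show "e \<in> (\<lambda>(u, v). closed_segment u v) ` (V \<times> V)" by blast
  qed
  then show "finite E" by (rule finite_subset) (simp add: finite_V)
  fix e assume e: "e \<in> E"
  obtain u v where uv: "dist u v = 1" "e = closed_segment u v" "e \<inter> V = {u, v}" by (rule edge_ends[OF e])
  have "u \<noteq> v" using uv(1) by auto
  then have "joined_by_arc u v e"
    unfolding joined_by_arc_def uv(2) by (intro exI[of _ "linepath u v"]) (simp add: arc_linepath)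
  then show "\<exists>u v. joined_by_arc u v e \<and> e \<inter> V = {u, v}" using uv(3) by blast
  fix e' assume e': "e' \<in> E"
  obtain u' v' where uv': "e' = closed_segment u' v'" "e' \<inter> V = {u', v'}" by (rule edge_ends[OF e'])
  show "e = e'" if "e \<inter> V = e' \<inter> V"
  proof -
    have "{u, v} = {u', v'}" using that uv(3) uv'(2) by simp
    then show ?thesis unfolding uv(2) uv'(1) by (simp add: closed_segment_eq)
  qed
  show "e \<inter> e' \<subseteq> V" if "e \<noteq> e'"
  proof
    fix p assume p: "p \<in> e \<inter> e'"
    then have "p \<in> triangular_lattice"
      using lattice_edge_unique[of e e' p] e e' that by (auto simp: E_def)
    moreover have "p \<in> D" using p e by (auto simp: E_def)
    ultimately show "p \<in> V" by (simp add: V_def)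
  qed
qed

lemma edges_in_E:
  "0 \<le> i \<Longrightarrow> i + 1 \<le> P \<Longrightarrow> 0 \<le> j \<Longrightarrow> j \<le> Q \<Longrightarrow> z \<le> i + j \<Longrightarrow> i + j + 1 \<le> L \<Longrightarrow> hedge i j \<in> E"
  "0 \<le> i \<Longrightarrow> i \<le> P \<Longrightarrow> 0 \<le> j \<Longrightarrow> j + 1 \<le> Q \<Longrightarrow> z \<le> i + j \<Longrightarrow> i + j + 1 \<le> L \<Longrightarrow> vedge i j \<in> E"
  "0 \<le> i \<Longrightarrow> i + 1 \<le> P \<Longrightarrow> 0 \<le> j \<Longrightarrow> j + 1 \<le> Q \<Longrightarrow> z \<le> i + j + 1 \<Longrightarrow> i + j + 1 \<le> L \<Longrightarrow> dedge i j \<in> E"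
  unfolding E_def using edge_kinds_lattice by (auto simp: D_def hedge_def vedge_def dedge_def)

text \<open>This turns membership in the graph into integrality of coordinates, so the faces can be
  recognised as open unit triangles, on which none of the three quantities is an integer.\<close>

lemma graph_eq: "V \<union> \<Union>E = {p \<in> D. cx p \<in> \<int> \<or> cy p \<in> \<int> \<or> cx p + cy p \<in> \<int>}"
proof
  show "V \<union> \<Union>E \<subseteq> {p \<in> D. cx p \<in> \<int> \<or> cy p \<in> \<int> \<or> cx p + cy p \<in> \<int>}"
  proof
    fix p assume "p \<in> V \<union> \<Union>E"
    then consider "p \<in> V" | e where "e \<in> E" "p \<in> e" by blast
    then show "p \<in> {p \<in> D. cx p \<in> \<int> \<or> cy p \<in> \<int> \<or> cx p + cy p \<in> \<int>}"
    proof cases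
      case 2
      then obtain i j where "e = hedge i j \<or> e = vedge i j \<or> e = dedge i j"
        using lattice_edge_cases unfolding E_def by blast
      then have "cx p \<in> \<int> \<or> cy p \<in> \<int> \<or> cx p + cy p \<in> \<int>"
      proof (elim disjE)
        assume "e = dedge i j"
        then have "cx p + cy p = of_int (i + j + 1)" using 2 by (simp add: dedge_def)
        then show ?thesis by (metis Ints_of_int)
      qed (use 2 in \<open>simp_all add: hedge_def vedge_def\<close>)
      then show ?thesis using 2 by (auto simp: E_def)
    qed (auto simp: V_def triangular_lattice_iff)
  qed
  show "{p \<in> D. cx p \<in> \<int> \<or> cy p \<in> \<int> \<or> cx p + cy p \<in> \<int>} \<subseteq> V \<union> \<Union>E"
  proof
    fix p assume p: "p \<in> {p \<in> D. cx p \<in> \<int> \<or> cy p \<in> \<int> \<or> cx p + cy p \<in> \<int>}"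
    show "p \<in> V \<union> \<Union>E"
    proof (cases "p \<in> triangular_lattice")
      case True then show ?thesis using p by (simp add: V_def)
    next
      case False
      define i j where "i = \<lfloor>cx p\<rfloor>" and "j = \<lfloor>cy p\<rfloor>"
      have D: "0 \<le> cx p" "cx p \<le> P" "0 \<le> cy p" "cy p \<le> Q" "z \<le> cx p + cy p" "cx p + cy p \<le> L"
        using p by (auto simp: D_def)
      have fl: "i \<le> cx p" "cx p < i + 1" "j \<le> cy p" "cy p < j + 1"
        unfolding i_def j_def by linarith+
      have ni: "cx p \<notin> \<int> \<or> cy p \<notin> \<int>" using False triangular_lattice_iff by blast
      consider "cy p \<in> \<int>" "cx p \<notin> \<int>" | "cx p \<in> \<int>" "cy p \<notin> \<int>" | "cx p + cy p \<in> \<int>" "cx p \<notin> \<int>" "cy p \<notin> \<int>"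
        using p ni by blast
      then show ?thesis
      proof cases
        case 1
        then have c: "cy p = j" "cx p \<noteq> i" by (auto simp: j_def of_int_floor_cancel)
        then have "hedge i j \<in> E" using D fl by (intro edges_in_E(1)) linarith+
        moreover have "p \<in> hedge i j" using c fl by (simp add: hedge_def)
        ultimately show ?thesis by blast
      next
        case 2
        then have c: "cx p = i" "cy p \<noteq> j" by (auto simp: i_def of_int_floor_cancel)
        then have "vedge i j \<in> E" using D fl by (intro edges_in_E(2)) linarith+
        moreover have "p \<in> vedge i j" using c fl by (simp add: vedge_def)
        ultimately show ?thesis by blast
      next
        case 3
        then obtain m where m: "cx p + cy p = of_int m" by (auto elim: Ints_cases)
        have "cx p \<noteq> i" "cy p \<noteq> j" using 3 by auto
        \<comment> \<open>Two fractional parts, both positive and with integral sum, add up to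
          1.\<close>
        then have "m = i + j + 1" using m fl by linarith
        then have c: "cx p + cy p = i + j + 1" using m by simp
        then have "dedge i j \<in> E"
          using D fl \<open>cx p \<noteq> i\<close> \<open>cy p \<noteq> j\<close> by (intro edges_in_E(3)) linarith+
        moreover have "p \<in> dedge i j" using c fl by (simp add: dedge_def)
        ultimately show ?thesis by blast
      qed
    qed
  qed
qed

end

lemma not_Ints_between:
  fixes r :: real
  assumes "of_int m < r" "r < of_int m + 1"
  shows "r \<notin> \<int>"
  using assms by (auto elim!: Ints_cases)

lemma tri_not_Ints:
  assumes "p \<in> up_tri i j \<union> down_tri i j"
  shows "cx p \<notin> \<int> \<and> cy p \<notin> \<int> \<and> cx p + cy p \<notin> \<int>"
  using assms
proof
  assume p: "p \<in> up_tri i j"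
  show ?thesis
    by (intro conjI not_Ints_between[of i] not_Ints_between[of j] not_Ints_between[of "i + j"])
      (use p in \<open>auto simp: up_tri_def\<close>)
next
  assume p: "p \<in> down_tri i j"
  show ?thesis
    by (intro conjI not_Ints_between[of i] not_Ints_between[of j] not_Ints_between[of "i + j + 1"])
      (use p in \<open>auto simp: down_tri_def\<close>)
qed

context lattice_hexagon
begin

section \<open>Faces and boundary of a hexagon as cycles of lattice edges\<close>

lemma segment_Int_V:
  assumes "u \<in> V" "v \<in> V" "dist u v = 1"
  shows "closed_segment u v \<inter> V = {u, v}"
proof -
  have "closed_segment u v \<subseteq> D" using segment_E[OF assms] by (simp add: E_def)
  then show ?thesis using lattice_segment[of u v] assms unfolding V_def by blast
qed

definition polygon_edges :: "complex list \<Rightarrow> complex set list" where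
  "polygon_edges vs = map (\<lambda>i. closed_segment (vs ! i) (vs ! (Suc i mod length vs))) [0..<length vs]"

lemma polygon_cycle:
  assumes len: "3 \<le> length vs" and dist: "distinct vs" and V: "set vs \<subseteq> V"
    and d1: "\<And>i. i < length vs \<Longrightarrow> dist (vs ! i) (vs ! (Suc i mod length vs)) = 1"
  shows "simple_cycle V E vs (set (polygon_edges vs))"
proof -
  have lt: "Suc i mod length vs < length vs" for i
    using len by (intro mod_less_divisor) linarith
  have nthV: "vs ! i \<in> V" if "i < length vs" for i using V that nth_mem by blast
  have "set (polygon_edges vs) \<subseteq> E"
    unfolding polygon_edges_def using segment_E[OF nthV nthV[OF lt] d1] by auto
  moreover have "polygon_edges vs ! i \<inter> V = {vs ! i, vs ! (Suc i mod length vs)}" if "i < length vs" for i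
    using segment_Int_V[OF nthV[OF that] nthV[OF lt] d1[OF that]] that by (simp add: polygon_edges_def)
  ultimately show ?thesis
    unfolding simple_cycle_def using len dist V
    by (intro conjI exI[of _ "polygon_edges vs"]) (auto simp: polygon_edges_def)
qed

lemma triangle_cycle:
  assumes "u \<in> V" "v \<in> V" "w \<in> V" "dist u v = 1" "dist v w = 1" "dist w u = 1"
  shows "\<exists>vs C. simple_cycle V E vs C \<and> length vs = 3 \<and>
    \<Union>C = closed_segment u v \<union> closed_segment v w \<union> closed_segment w u"
proof (intro exI conjI)
  have "u \<noteq> v" "v \<noteq> w" "w \<noteq> u" using assms by auto
  show "simple_cycle V E [u, v, w] (set (polygon_edges [u, v, w]))"
  proof (rule polygon_cycle)
    fix i assume "i < length [u, v, w]"
    then have "i = 0 \<or> i = 1 \<or> i = 2" by auto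
    then show "dist ([u, v, w] ! i) ([u, v, w] ! (Suc i mod length [u, v, w])) = 1"
      using assms by auto
  qed (use assms \<open>u \<noteq> v\<close> \<open>v \<noteq> w\<close> \<open>w \<noteq> u\<close> in auto)
  then show "\<Union>(set (polygon_edges [u, v, w])) = closed_segment u v \<union> closed_segment v w \<union> closed_segment w u"
    unfolding polygon_edges_def by (simp add: Un_ac)
qed simp

lemma V_pt: "pt (of_int a) (of_int b) \<in> V \<longleftrightarrow> 0 \<le> a \<and> a \<le> P \<and> 0 \<le> b \<and> b \<le> Q \<and> z \<le> a + b \<and> a + b \<le> L"
proof -
  have "real_of_int z \<le> of_int a + of_int b \<longleftrightarrow> z \<le> a + b" "of_int a + of_int b \<le> real_of_int L \<longleftrightarrow> a + b \<le> L"
    by linarith+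
  then show ?thesis by (simp add: V_def D_def)
qed

text \<open>\<open>T\<close> is connected and off the graph, so it lies in \<open>F\<close>; and
  \<open>F\<close> cannot leave \<open>T\<close> without meeting the frontier of \<open>T\<close>,
  which is part of the graph.\<close>

lemma component_eq:
  assumes F: "F \<in> components (D - (V \<union> \<Union>E))" and T: "convex T" "frontier T \<subseteq> V \<union> \<Union>E"
    "T \<subseteq> D - (V \<union> \<Union>E)" "p \<in> F" "p \<in> T"
  shows "F = T"
proof
  have cF: "connected F" "F \<subseteq> D - (V \<union> \<Union>E)"
    using in_components_connected[OF F] in_components_subset[OF F] .
  show "T \<subseteq> F" using components_maximal[OF F convex_connected[OF T(1)] T(3)] T(4,5) by blast
  show "F \<subseteq> T"
  proof (rule ccontr)
    assume "\<not> F \<subseteq> T"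
    then show False using connected_Int_frontier[OF cF(1), of T] T(4,5) cF(2) T(2) by blast
  qed
qed

lemma face_boundary:
  assumes F: "F \<in> components (D - (V \<union> \<Union>E))"
  shows "\<exists>vs C. simple_cycle V E vs C \<and> length vs = 3 \<and> \<Union>C = frontier F"
proof -
  obtain p where p: "p \<in> F" using in_components_nonempty[OF F] by blast
  then have pD: "p \<in> D - (V \<union> \<Union>E)" using in_components_subset[OF F] by blast
  have ni: "cx p \<notin> \<int>" "cy p \<notin> \<int>" "cx p + cy p \<notin> \<int>" using pD unfolding graph_eq by blast+
  have D: "0 \<le> cx p" "cx p \<le> P" "0 \<le> cy p" "cy p \<le> Q" "z \<le> cx p + cy p" "cx p + cy p \<le> L"
    using pD by (auto simp: D_def)
  define i j where "i = \<lfloor>cx p\<rfloor>" and "j = \<lfloor>cy p\<rfloor>"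
  have "cx p \<noteq> i" "cy p \<noteq> j" using ni by auto
  then have fl: "i < cx p" "cx p < i + 1" "j < cy p" "cy p < j + 1"
    unfolding i_def j_def by linarith+
  have ij: "0 \<le> i" "i + 1 \<le> P" "0 \<le> j" "j + 1 \<le> Q" using fl D by linarith+
  have nis: "cx p + cy p \<noteq> of_int (i + j + 1)" "cx p + cy p \<noteq> of_int z" "cx p + cy p \<noteq> of_int L"
    using ni(3) by (metis Ints_of_int)+
  show ?thesis
  proof (cases "cx p + cy p < i + j + 1")
    case True
    \<comment> \<open>The coordinate sum of \<open>p\<close> lies strictly between
      \<open>i + j\<close> and \<open>i + j + 1\<close>. As \<open>z\<close> and \<open>L\<close>
      are integers, the constraints on one point extend to the whole closed triangle.\<close>
    have s: "z \<le> i + j" "i + j + 1 \<le> L" using fl D True nis by linarith+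
    have TD: "closure (up_tri i j) \<subseteq> D"
      using ij s unfolding closure_up_tri by (auto simp: D_def)
    have fr: "frontier (up_tri i j) \<subseteq> V \<union> \<Union>E"
    proof -
      have "hedge i j \<in> E" "vedge i j \<in> E" "dedge i j \<in> E"
        using ij s by (auto intro!: edges_in_E)
      then show ?thesis unfolding frontier_up_tri by blast
    qed
    have "up_tri i j \<inter> (V \<union> \<Union>E) = {}"
      unfolding graph_eq using tri_not_Ints by blast
    then have "up_tri i j \<subseteq> D - (V \<union> \<Union>E)" using TD closure_subset by blast
    then have "F = up_tri i j"
      using F p fl True by (intro component_eq[OF F convex_tri(1) fr]) (auto simp: up_tri_def)
    then have eq: "frontier F = hedge i j \<union> vedge i j \<union> dedge i j" by (simp add: frontier_up_tri)
    have "\<exists>vs C. simple_cycle V E vs C \<and> length vs = 3 \<and>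
      \<Union>C = closed_segment (pt i j) (pt (i + 1) j) \<union> closed_segment (pt (i + 1) j) (pt i (j + 1)) \<union>
        closed_segment (pt i (j + 1)) (pt i j)"
      using V_pt[of i j] V_pt[of "i + 1" j] V_pt[of i "j + 1"] ij s
      by (intro triangle_cycle) (simp_all add: dist_pt)
    then show ?thesis
      unfolding eq hedge_segment vedge_segment dedge_segment
      by (simp add: closed_segment_commute Un_ac)
  next
    case False
    then have big: "i + j + 1 < cx p + cy p" using nis(1) by simp
    have s: "z \<le> i + j + 1" "i + j + 2 \<le> L" using fl D big nis by linarith+
    have TD: "closure (down_tri i j) \<subseteq> D"
      using ij s unfolding closure_down_tri by (auto simp: D_def)
    have fr: "frontier (down_tri i j) \<subseteq> V \<union> \<Union>E"
    proof -
      have "hedge i (j + 1) \<in> E" "vedge (i + 1) j \<in> E" "dedge i j \<in> E"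
        using ij s by (auto intro!: edges_in_E)
      then show ?thesis unfolding frontier_down_tri by blast
    qed
    have "down_tri i j \<inter> (V \<union> \<Union>E) = {}"
      unfolding graph_eq using tri_not_Ints by blast
    then have "down_tri i j \<subseteq> D - (V \<union> \<Union>E)" using TD closure_subset by blast
    then have "F = down_tri i j"
      using F p fl big by (intro component_eq[OF F convex_tri(2) fr]) (auto simp: down_tri_def)
    then have eq: "frontier F = hedge i (j + 1) \<union> vedge (i + 1) j \<union> dedge i j" by (simp add: frontier_down_tri)
    have "\<exists>vs C. simple_cycle V E vs C \<and> length vs = 3 \<and>
      \<Union>C = closed_segment (pt i (j + 1)) (pt (i + 1) (j + 1)) \<union> closed_segment (pt (i + 1) (j + 1)) (pt (i + 1) j) \<union>
        closed_segment (pt (i + 1) j) (pt i (j + 1))"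
      using V_pt[of "i + 1" "j + 1"] V_pt[of "i + 1" j] V_pt[of i "j + 1"] ij s
      by (intro triangle_cycle) (simp_all add: dist_pt)
    then show ?thesis
      unfolding eq hedge_segment vedge_segment dedge_segment
      by (simp add: closed_segment_commute Un_ac)
  qed
qed

text \<open>\<open>walk\<close> runs counterclockwise along the six sides, starting at \<open>(z, 0)\<close>; its branches agree
  at the corners, so sides of length \<open>0\<close> need no special treatment.\<close>

definition perim :: int where "perim = P + Q + L - z"

definition walk :: "int \<Rightarrow> int \<times> int" where
  "walk t =
    (if t \<le> P - z then (z + t, 0)
     else if t \<le> L - z then (P, t - (P - z))
     else if t \<le> P + Q - z then (P + L - z - t, t - (P - z))
     else if t \<le> P + L - z then (P + L - z - t, Q)
     else if t \<le> P + Q + L - 2 * z then (0, P + Q + L - z - t)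
     else (t - (P + Q + L - 2 * z), P + Q + L - z - t))"

definition wpt :: "int \<Rightarrow> complex" where
  "wpt t = pt (of_int (fst (walk t))) (of_int (snd (walk t)))"

lemma perim_ge_3: "3 \<le> perim"
  using bounds unfolding perim_def by linarith

lemma walk_sides:
  "t \<le> P - z \<Longrightarrow> walk t = (z + t, 0)"
  "P - z \<le> t \<Longrightarrow> t \<le> L - z \<Longrightarrow> walk t = (P, t - (P - z))"
  "L - z \<le> t \<Longrightarrow> t \<le> P + Q - z \<Longrightarrow> walk t = (P + L - z - t, t - (P - z))"
  "P + Q - z \<le> t \<Longrightarrow> t \<le> P + L - z \<Longrightarrow> walk t = (P + L - z - t, Q)"
  "P + L - z \<le> t \<Longrightarrow> t \<le> P + Q + L - 2 * z \<Longrightarrow> walk t = (0, P + Q + L - z - t)"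
  "P + Q + L - 2 * z \<le> t \<Longrightarrow> walk t = (t - (P + Q + L - 2 * z), P + Q + L - z - t)"
  using bounds by (auto simp: walk_def)

lemma walk_side_cases:
  assumes "0 \<le> t" "t < perim"
  obtains "t + 1 \<le> P - z" | "P - z \<le> t" "t + 1 \<le> L - z" | "L - z \<le> t" "t + 1 \<le> P + Q - z"
    | "P + Q - z \<le> t" "t + 1 \<le> P + L - z" | "P + L - z \<le> t" "t + 1 \<le> P + Q + L - 2 * z"
    | "P + Q + L - 2 * z \<le> t"
  by linarith

lemma wpt_closed: "wpt perim = wpt 0"
  using bounds by (auto simp: walk_def perim_def wpt_def)

lemma wpt_V: "0 \<le> t \<Longrightarrow> t \<le> perim \<Longrightarrow> wpt t \<in> V"
  unfolding wpt_def V_pt using bounds by (auto simp: walk_def perim_def)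

lemma wpt_dist:
  assumes "0 \<le> t" "t < perim"
  shows "dist (wpt t) (wpt (t + 1)) = 1"
  unfolding wpt_def dist_pt using assms
  by (rule walk_side_cases) (simp_all add: walk_sides)

lemma wpt_inj:
  assumes "0 \<le> s" "s < t" "t < perim"
  shows "wpt s \<noteq> wpt t"
proof -
  have "walk s \<noteq> walk t"
    using assms bounds by (auto simp: walk_def perim_def split: if_splits)
  then show ?thesis by (simp add: wpt_def prod_eq_iff)
qed

lemma frontier_D: "p \<in> frontier D \<longleftrightarrow> p \<in> D \<and>
    (cx p = 0 \<or> cx p = P \<or> cy p = 0 \<or> cy p = Q \<or> cx p + cy p = z \<or> cx p + cy p = L)"
  unfolding frontier_def closure_closed[OF closed_D] interior_D by (auto simp: D_def)

lemma segment_subset_frontier: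
  assumes t: "0 \<le> t" "t < perim"
  shows "closed_segment (wpt t) (wpt (t + 1)) \<subseteq> frontier D"
proof
  fix p assume p: "p \<in> closed_segment (wpt t) (wpt (t + 1))"
  have "wpt t \<in> D" "wpt (t + 1) \<in> D" using wpt_V[of t] wpt_V[of "t + 1"] t by (auto simp: V_def)
  then have pD: "p \<in> D" using closed_segment_subset[OF _ _ convex_D] p by blast
  obtain s where s: "0 \<le> s" "s \<le> 1" "cx p = (1 - s) * cx (wpt t) + s * cx (wpt (t + 1))"
    "cy p = (1 - s) * cy (wpt t) + s * cy (wpt (t + 1))"
    using p unfolding closed_segment_coords by blast
  from t have "cx p = 0 \<or> cx p = P \<or> cy p = 0 \<or> cy p = Q \<or> cx p + cy p = z \<or> cx p + cy p = L"
    by (rule walk_side_cases) (simp_all add: s wpt_def walk_sides algebra_simps)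
  then show "p \<in> frontier D" unfolding frontier_D using pD by simp
qed

text \<open>One argument for all six sides: between \<open>lo\<close> and \<open>hi\<close> the walk
  is affine, and \<open>r\<close> is the real parameter of \<open>p\<close> on that side. For
  \<open>r = hi\<close> the point is the start of the next segment, which after the last side is the
  first one again.\<close>

lemma side_cover:
  assumes lohi: "0 \<le> lo" "hi \<le> perim"
    and w: "\<And>t. lo \<le> t \<Longrightarrow> t \<le> hi \<Longrightarrow> wpt t = pt (\<alpha> + \<beta> * of_int t) (\<gamma> + \<delta> * of_int t)"
    and r: "of_int lo \<le> r" "r \<le> of_int hi" and p: "cx p = \<alpha> + \<beta> * r" "cy p = \<gamma> + \<delta> * r"
  shows "\<exists>t. 0 \<le> t \<and> t < perim \<and> p \<in> closed_segment (wpt t) (wpt (t + 1))"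
proof -
  define t where "t = \<lfloor>r\<rfloor>"
  have t: "lo \<le> t" "t \<le> hi" "t \<le> r" "r < t + 1" unfolding t_def using r by linarith+
  show ?thesis
  proof (cases "t < hi")
    case True
    have "p \<in> closed_segment (wpt t) (wpt (t + 1))"
      unfolding closed_segment_coords using t True p
      by (intro exI[of _ "r - t"]) (simp add: w algebra_simps)
    then show ?thesis using t True lohi by (intro exI[of _ t]) auto
  next
    case False
    then have "t = hi" "r = hi" using t r by linarith+
    then have "wpt hi = pt (cx p) (cy p)" using p t w[of hi] by simp
    then have pw: "p = wpt hi" by (simp add: pt_cx_cy)
    show ?thesis
    proof (cases "hi < perim")
      case True
      then show ?thesis using pw t lohi \<open>t = hi\<close> by (intro exI[of _ hi]) auto
    next
      case False
      then show ?thesis using pw lohi wpt_closed perim_ge_3 by (intro exI[of _ 0]) auto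
    qed
  qed
qed

lemma frontier_cover:
  assumes p: "p \<in> frontier D"
  shows "\<exists>t. 0 \<le> t \<and> t < perim \<and> p \<in> closed_segment (wpt t) (wpt (t + 1))"
proof -
  have D: "0 \<le> cx p" "cx p \<le> P" "0 \<le> cy p" "cy p \<le> Q" "z \<le> cx p + cy p" "cx p + cy p \<le> L"
    using p unfolding frontier_D by (auto simp: D_def)
  consider "cy p = 0" | "cx p = P" | "cx p + cy p = L" | "cy p = Q" | "cx p = 0" | "cx p + cy p = z"
    using p unfolding frontier_D by blast
  then show ?thesis
  proof cases
    case 1
    show ?thesis
      by (rule side_cover[where lo = 0 and hi = "P - z" and \<alpha> = z and \<beta> = 1 and \<gamma> = 0 and \<delta> = 0 and r = "cx p - z"])
        (use 1 D bounds in \<open>auto simp: wpt_def walk_sides perim_def\<close>)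
  next
    case 2
    show ?thesis
      by (rule side_cover[where lo = "P - z" and hi = "L - z" and \<alpha> = P and \<beta> = 0 and \<gamma> = "- (P - z)" and \<delta> = 1
            and r = "cy p + (P - z)"])
        (use 2 D bounds in \<open>auto simp: wpt_def walk_sides perim_def\<close>)
  next
    case 3
    show ?thesis
      by (rule side_cover[where lo = "L - z" and hi = "P + Q - z" and \<alpha> = "P + L - z" and \<beta> = "-1" and
            \<gamma> = "- (P - z)" and \<delta> = 1 and r = "cy p + (P - z)"])
        (use 3 D bounds in \<open>auto simp: wpt_def walk_sides perim_def\<close>)
  next
    case 4
    show ?thesis
      by (rule side_cover[where lo = "P + Q - z" and hi = "P + L - z" and \<alpha> = "P + L - z" and \<beta> = "-1" and
            \<gamma> = Q and \<delta> = 0 and r = "P + L - z - cx p"])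
        (use 4 D bounds in \<open>auto simp: wpt_def walk_sides perim_def\<close>)
  next
    case 5
    show ?thesis
      by (rule side_cover[where lo = "P + L - z" and hi = "P + Q + L - 2 * z" and \<alpha> = 0 and \<beta> = 0 and
            \<gamma> = "P + Q + L - z" and \<delta> = "-1" and r = "P + Q + L - z - cy p"])
        (use 5 D bounds in \<open>auto simp: wpt_def walk_sides perim_def\<close>)
  next
    case 6
    show ?thesis
      by (rule side_cover[where lo = "P + Q + L - 2 * z" and hi = perim and \<alpha> = "- (P + Q + L - 2 * z)" and \<beta> = 1 and
            \<gamma> = "P + Q + L - z" and \<delta> = "-1" and r = "P + Q + L - z - cy p"])
        (use 6 D bounds in \<open>auto simp: wpt_def walk_sides perim_def\<close>)
  qed
qed

definition boundary_list :: "complex list" where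
  "boundary_list = map (\<lambda>i. wpt (int i)) [0..<nat perim]"

lemma boundary_list_nth:
  assumes "i < nat perim"
  shows "boundary_list ! i = wpt (int i)" "boundary_list ! (Suc i mod length boundary_list) = wpt (int i + 1)"
proof -
  show "boundary_list ! i = wpt (int i)" using assms by (simp add: boundary_list_def)
  show "boundary_list ! (Suc i mod length boundary_list) = wpt (int i + 1)"
  proof (cases "Suc i = nat perim")
    case True
    then have "int i + 1 = perim" by linarith
    then show ?thesis using True wpt_closed by (simp add: boundary_list_def)
  next
    case False
    then show ?thesis using assms by (simp add: boundary_list_def add.commute)
  qed
qed

lemma boundary_cycle:
  "simple_cycle V E boundary_list (set (polygon_edges boundary_list))"
  "\<Union>(set (polygon_edges boundary_list)) = frontier D"
proof -
  have len: "length boundary_list = nat perim" by (simp add: boundary_list_def)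
  show "simple_cycle V E boundary_list (set (polygon_edges boundary_list))"
  proof (rule polygon_cycle)
    show "3 \<le> length boundary_list" using perim_ge_3 len by simp
    show "distinct boundary_list"
    proof -
      have "inj_on (\<lambda>i. wpt (int i)) {0..<nat perim}"
      proof (rule linorder_inj_onI)
        fix i j assume "i < j" "i \<in> {0..<nat perim}" "j \<in> {0..<nat perim}"
        then show "wpt (int i) \<noteq> wpt (int j)" by (intro wpt_inj) auto
      qed auto
      then show ?thesis by (simp add: boundary_list_def distinct_map)
    qed
    show "set boundary_list \<subseteq> V"
      unfolding boundary_list_def using wpt_V by auto
    fix i assume "i < length boundary_list"
    then show "dist (boundary_list ! i) (boundary_list ! (Suc i mod length boundary_list)) = 1"
      using boundary_list_nth[of i] wpt_dist[of "int i"] len by simp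
  qed
  have "\<Union>(set (polygon_edges boundary_list)) = (\<Union>i<nat perim. closed_segment (wpt (int i)) (wpt (int i + 1)))"
    unfolding polygon_edges_def using boundary_list_nth len by (auto simp: atLeast0LessThan)
  also have "\<dots> = frontier D"
  proof
    show "(\<Union>i<nat perim. closed_segment (wpt (int i)) (wpt (int i + 1))) \<subseteq> frontier D"
    proof (rule UN_least)
      fix i assume "i \<in> {..<nat perim}"
      then show "closed_segment (wpt (int i)) (wpt (int i + 1)) \<subseteq> frontier D"
        by (intro segment_subset_frontier) auto
    qed
    show "frontier D \<subseteq> (\<Union>i<nat perim. closed_segment (wpt (int i)) (wpt (int i + 1)))"
    proof
      fix p assume "p \<in> frontier D"
      then obtain t where t: "0 \<le> t" "t < perim" "p \<in> closed_segment (wpt t) (wpt (t + 1))"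
        using frontier_cover by blast
      then show "p \<in> (\<Union>i<nat perim. closed_segment (wpt (int i)) (wpt (int i + 1)))"
        by (intro UN_I[of "nat t"]) auto
    qed
  qed
  finally show "\<Union>(set (polygon_edges boundary_list)) = frontier D" .
qed

lemma disc_triangulation: "disc_triangulation D V E"
  unfolding disc_triangulation_def
  using homeomorphic_D plane_graph boundary_cycle face_boundary
  by (auto simp: V_def E_def)

lemma card_boundary: "card (boundary_vertices D V) = nat perim"
proof -
  have "V \<inter> frontier D = set boundary_list"
    using simple_cycle_edges(2)[OF plane_graph boundary_cycle(1)] boundary_cycle(2) by simp
  moreover have "distinct boundary_list" using boundary_cycle(1) by (simp add: simple_cycle_def)
  ultimately show ?thesis
    using distinct_card[of boundary_list] by (simp add: boundary_vertices_def boundary_list_def)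
qed

lemma degree_internal:
  assumes v: "v \<in> internal_vertices D V"
  shows "6 \<le> vertex_degree E v"
proof -
  have vV: "v \<in> V" "v \<notin> frontier D" using v by (simp_all add: internal_vertices_def)
  then obtain a b where ab: "cx v = of_int a" "cy v = of_int b"
    by (auto simp: V_def triangular_lattice_iff elim!: Ints_cases)
  then have v': "v = pt a b" by (simp add: eq_pt_iff)
  have "v \<in> interior D" using vV unfolding V_def frontier_def closure_closed[OF closed_D] by blast
  then have "real_of_int z < of_int a + of_int b" "of_int a + of_int b < real_of_int L"
    "0 < a" "a < P" "0 < b" "b < Q" unfolding interior_D using ab by auto
  then have in_D: "0 < a" "a < P" "0 < b" "b < Q" "z < a + b" "a + b < L" by linarith+
  \<comment> \<open>The six lattice neighbours. Strict inequalities between integers leave a margin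
    of 1, so all of them stay in the hexagon.\<close>
  define N where "N = {(a + 1, b), (a - 1, b), (a, b + 1), (a, b - 1), (a + 1, b - 1), (a - 1, b + 1)}"
  let ?f = "\<lambda>(c, d). closed_segment v (pt (of_int c) (of_int d))"
  have "card N = 6" unfolding N_def by simp
  moreover have "inj_on ?f N"
  proof (rule inj_onI)
    fix x y assume eq: "?f x = ?f y"
    obtain c d c' d' where xy: "x = (c, d)" "y = (c', d')" by (cases x, cases y)
    have "{v, pt (of_int c) (of_int d)} = {v, pt (of_int c') (of_int d')}"
      using eq unfolding xy by (simp add: closed_segment_eq)
    then have "pt (of_int c) (of_int d) = pt (of_int c') (of_int d')"
      by (metis doubleton_eq_iff)
    then show "x = y" unfolding xy by simp
  qed
  ultimately have "card (?f ` N) = 6" by (simp add: card_image)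
  moreover have sub: "?f ` N \<subseteq> {e \<in> E. v \<in> e}"
  proof
    fix e assume "e \<in> ?f ` N"
    then obtain c d where cd: "(c, d) \<in> N" "e = closed_segment v (pt (of_int c) (of_int d))" by auto
    have "pt (of_int c) (of_int d) \<in> V" unfolding V_pt using cd(1) in_D by (auto simp: N_def)
    moreover have "dist v (pt (of_int c) (of_int d)) = 1"
      unfolding v' dist_pt using cd(1) by (auto simp: N_def)
    ultimately show "e \<in> {e \<in> E. v \<in> e}" using segment_E[OF vV(1)] cd(2) by auto
  qed
  moreover have "finite {e \<in> E. v \<in> e}" using plane_graph by (simp add: plane_graph_def)
  then have "card (?f ` N) \<le> card {e \<in> E. v \<in> e}" using sub by (rule card_mono)
  ultimately show ?thesis unfolding vertex_degree_def by simp
qed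

end

section \<open>Counting lattice points of a hexagon\<close>

definition int_triangle :: "int \<Rightarrow> (int \<times> int) set" where
  "int_triangle n = {(a, b). 0 \<le> a \<and> 0 \<le> b \<and> a + b < n}"

lemma finite_int_triangle: "finite (int_triangle n)"
proof (rule finite_subset)
  show "int_triangle n \<subseteq> {0..n} \<times> {0..n}" by (auto simp: int_triangle_def)
qed simp

lemma card_int_triangle: "2 * card (int_triangle (int n)) = n * (n + 1)"
proof (induction n)
  case 0
  have "int_triangle 0 = {}" by (auto simp: int_triangle_def)
  then show ?case by simp
next
  case (Suc n)
  have eq: "int_triangle (int (Suc n)) = int_triangle (int n) \<union> (\<lambda>a. (a, int n - a)) ` {0..int n}"
    by (auto simp: int_triangle_def image_iff)
  have "card (int_triangle (int (Suc n))) = card (int_triangle (int n)) + card ((\<lambda>a. (a, int n - a)) ` {0..int n})"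
    unfolding eq by (rule card_Un_disjoint) (auto simp: finite_int_triangle, auto simp: int_triangle_def)
  moreover have "card ((\<lambda>a. (a, int n - a)) ` {0..int n}) = n + 1"
    by (subst card_image) (auto simp: inj_on_def)
  ultimately show ?case using Suc by simp
qed

lemma card_int_triangle':
  assumes "0 \<le> n"
  shows "2 * int (card (int_triangle n)) = n * (n + 1)"
proof -
  obtain m where n: "n = int m" using nonneg_int_cases[OF assms] .
  have "int (2 * card (int_triangle (int m))) = int (m * (m + 1))"
    by (simp only: card_int_triangle)
  then show ?thesis unfolding n by (simp add: algebra_simps)
qed

context lattice_hexagon
begin

text \<open>The hexagon is a triangle of side \<open>L\<close> minus three corner triangles.\<close>

lemma card_V_ge:
  "(L + 1) * (L + 2) - (L - P) * (L - P + 1) - (L - Q) * (L - Q + 1) - z * (z + 1) \<le> 2 * int (card V)"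
proof -
  define R where "R = {(a, b). 0 \<le> a \<and> a \<le> P \<and> 0 \<le> b \<and> b \<le> Q \<and> z \<le> a + b \<and> a + b \<le> L}"
  have "inj_on (\<lambda>(a, b). pt (of_int a) (of_int b)) R" by (auto simp: inj_on_def)
  moreover have "(\<lambda>(a, b). pt (of_int a) (of_int b)) ` R \<subseteq> V"
    by (auto simp: R_def V_pt)
  ultimately have RV: "card R \<le> card V" using card_inj_on_le finite_V by blast
  let ?A = "(\<lambda>(a, b). (a + P + 1, b)) ` int_triangle (L - P)"
  let ?B = "(\<lambda>(a, b). (a, b + Q + 1)) ` int_triangle (L - Q)"
  have "int_triangle (L + 1) \<subseteq> R \<union> ?A \<union> ?B \<union> int_triangle z"
  proof
    fix x assume "x \<in> int_triangle (L + 1)"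
    then obtain a b where x: "x = (a, b)" "0 \<le> a" "0 \<le> b" "a + b \<le> L" by (auto simp: int_triangle_def)
    consider "P < a" | "Q < b" | "a + b < z" | "a \<le> P" "b \<le> Q" "z \<le> a + b" by linarith
    then show "x \<in> R \<union> ?A \<union> ?B \<union> int_triangle z"
    proof cases
      case 1
      then have "x \<in> ?A" using x by (intro image_eqI[of _ _ "(a - P - 1, b)"]) (auto simp: int_triangle_def)
      then show ?thesis by blast
    next
      case 2
      then have "x \<in> ?B" using x by (intro image_eqI[of _ _ "(a, b - Q - 1)"]) (auto simp: int_triangle_def)
      then show ?thesis by blast
    qed (use x in \<open>auto simp: R_def int_triangle_def\<close>)
  qed
  moreover have "finite R"
    by (rule finite_subset[of _ "{0..P} \<times> {0..Q}"]) (auto simp: R_def)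
  ultimately have "card (int_triangle (L + 1)) \<le> card (R \<union> ?A \<union> ?B \<union> int_triangle z)"
    using finite_int_triangle by (intro card_mono) auto
  also have "\<dots> \<le> card R + card ?A + card ?B + card (int_triangle z)"
    by (meson add_mono card_Un_le order_refl order_trans)
  also have "\<dots> \<le> card V + card (int_triangle (L - P)) + card (int_triangle (L - Q)) + card (int_triangle z)"
    using RV card_image_le[OF finite_int_triangle] by (intro add_mono) auto
  finally have "2 * int (card (int_triangle (L + 1))) \<le> 2 * int (card V) + 2 * int (card (int_triangle (L - P)))
      + 2 * int (card (int_triangle (L - Q))) + 2 * int (card (int_triangle z))" by simp
  then show ?thesis
    using bounds by (simp add: card_int_triangle' algebra_simps)
qed

end

section \<open>Extremal hexagons for each boundary length\<close>

definition large_lattice_disc :: "nat \<Rightarrow> complex set \<Rightarrow> complex set \<Rightarrow> complex set set \<Rightarrow> bool" where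
  "large_lattice_disc n D V E \<longleftrightarrow>
      disc_triangulation D V E \<and> card (boundary_vertices D V) = n \<and>
      (\<forall>v \<in> internal_vertices D V. 6 \<le> vertex_degree E v) \<and>
      V \<subseteq> triangular_lattice \<and> E \<subseteq> triangular_lattice_edges \<and>
      round ((real n + 3)\<^sup>2 / 12) \<le> int (card V)"

text \<open>\<open>W\<close> is the number of lattice points that the corner count predicts. The
  strict hypothesis is \<open>(n + 3)^2 / 12 + 1 / 2 < W + 1\<close> cleared of denominators, that
  is, the rounded bound does not exceed \<open>W\<close>.\<close>

lemma hexagon_extremal:
  assumes "lattice_hexagon P Q z L" and n: "int n = P + Q + L - z"
    and W: "(real n + 3)\<^sup>2 + 6 < 12 * (real_of_int W + 1)"
    and count: "2 * W = (L + 1) * (L + 2) - (L - P) * (L - P + 1) - (L - Q) * (L - Q + 1) - z * (z + 1)"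
  shows "\<exists>D V E. large_lattice_disc n D V E"
proof -
  interpret lattice_hexagon P Q z L by fact
  have "round ((real n + 3)\<^sup>2 / 12) \<le> W"
    using W unfolding round_def by (simp add: floor_le_iff field_simps)
  also have "W \<le> int (card V)" using card_V_ge count by linarith
  finally have "round ((real n + 3)\<^sup>2 / 12) \<le> int (card V)" .
  moreover have "card (boundary_vertices D V) = n"
    using card_boundary n by (simp add: perim_def)
  ultimately show ?thesis
    unfolding large_lattice_disc_def using disc_triangulation degree_internal
    by (intro exI[of _ D] exI[of _ V] exI[of _ E]) (auto simp: V_def E_def)
qed

text \<open>With \<open>n = 6 * k + r\<close> the sides, in the order of the walk, have lengths
  \<open>k, k, k, k, k, k\<close> for \<open>r = 0\<close>,
  \<open>k, k, k, k + 1, k - 1, k + 1\<close> for \<open>r = 1\<close>,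
  \<open>k, k, k + 1, k, k, k + 1\<close> for \<open>r = 2\<close>,
  \<open>k + 1, k, k + 1, k, k + 1, k\<close> for \<open>r = 3\<close>,
  \<open>k + 1, k, k + 1, k + 1, k, k + 1\<close> for \<open>r = 4\<close>,
  \<open>k + 1, k, k + 2, k, k + 1, k + 1\<close> for \<open>r = 5\<close>.\<close>

lemma extremal_exists:
  assumes "3 \<le> n"
  shows "\<exists>D V E. large_lattice_disc n D V E"
proof -
  define k where "k = int (n div 6)"
  have n: "int n = 6 * k + int (n mod 6)" "n mod 6 < 6" "0 \<le> k" unfolding k_def by presburger+
  then have n': "real n = 6 * of_int k + real (n mod 6)" by (metis of_int_add of_int_mult of_int_numeral of_int_of_nat_eq)
  have "n mod 6 = 0 \<or> n mod 6 = 1 \<or> n mod 6 = 2 \<or> n mod 6 = 3 \<or> n mod 6 = 4 \<or> n mod 6 = 5"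
    using n(2) by linarith
  \<comment> \<open>For the first three residues \<open>k = 0\<close> would mean
    \<open>n < 3\<close>, where the hexagon degenerates.\<close>
  then consider "n mod 6 = 0" "1 \<le> k" | "n mod 6 = 1" "1 \<le> k" | "n mod 6 = 2" "1 \<le> k"
    | "n mod 6 = 3" | "n mod 6 = 4" | "n mod 6 = 5"
    using assms n(1,3) by linarith
  then show ?thesis
  proof cases
    case 1
    show ?thesis
      by (rule hexagon_extremal[of "2 * k" "2 * k" k "3 * k" n "3 * k\<^sup>2 + 3 * k + 1"], unfold_locales)
        (use 1 n n' in \<open>auto simp: power2_eq_square algebra_simps\<close>)
  next
    case 2
    show ?thesis
      by (rule hexagon_extremal[of "2 * k + 1" "2 * k" "k + 1" "3 * k + 1" n "3 * k\<^sup>2 + 4 * k + 1"], unfold_locales)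
        (use 2 n n' in \<open>auto simp: power2_eq_square algebra_simps\<close>)
  next
    case 3
    show ?thesis
      by (rule hexagon_extremal[of "2 * k + 1" "2 * k + 1" "k + 1" "3 * k + 1" n "3 * k\<^sup>2 + 5 * k + 2"], unfold_locales)
        (use 3 n n' in \<open>auto simp: power2_eq_square algebra_simps\<close>)
  next
    case 4
    show ?thesis
      by (rule hexagon_extremal[of "2 * k + 1" "2 * k + 1" k "3 * k + 1" n "3 * k\<^sup>2 + 6 * k + 3"], unfold_locales)
        (use 4 n n' in \<open>auto simp: power2_eq_square algebra_simps\<close>)
  next
    case 5
    show ?thesis
      by (rule hexagon_extremal[of "2 * k + 2" "2 * k + 1" "k + 1" "3 * k + 2" n "3 * k\<^sup>2 + 7 * k + 4"], unfold_locales)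
        (use 5 n n' in \<open>auto simp: power2_eq_square algebra_simps\<close>)
  next
    case 6
    show ?thesis
      by (rule hexagon_extremal[of "2 * k + 2" "2 * k + 2" "k + 1" "3 * k + 2" n "3 * k\<^sup>2 + 8 * k + 5"], unfold_locales)
        (use 6 n n' in \<open>auto simp: power2_eq_square algebra_simps\<close>)
  qed
qed

lemma vertices_le_round:
  assumes "disc_triangulation D V E" "card (boundary_vertices D V) = n"
    and "\<forall>v \<in> internal_vertices D V. 6 \<le> vertex_degree E v"
  shows "int (card V) \<le> round ((real n + 3)\<^sup>2 / 12)"
proof -
  interpret triangulated_disc D V E by unfold_locales fact
  have "12 * (card V - 1) \<le> n * (n + 6)"
    using vertex_bound assms(2,3) by (simp add: boundary_vertices_def internal_vertices_def)
  then show ?thesis by (rule round_bound)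
qed

text \<open>A boundary cycle has at least three vertices, so the range \<open>n \<ge> 3\<close> of
  the second part covers every boundary length that occurs.\<close>

theorem theorem2:
  "(\<forall>D V E n.
      disc_triangulation D V E \<and>
      card (boundary_vertices D V) = n \<and>
      (\<forall>v \<in> internal_vertices D V. 6 \<le> vertex_degree E v)
      \<longrightarrow> int (card V) \<le> round ((real n + 3)\<^sup>2 / 12)) \<and>
   (\<forall>n\<ge>3. \<exists>D V E.
      disc_triangulation D V E \<and>
      card (boundary_vertices D V) = n \<and>
      (\<forall>v \<in> internal_vertices D V. 6 \<le> vertex_degree E v) \<and>
      V \<subseteq> triangular_lattice \<and> E \<subseteq> triangular_lattice_edges \<and>
      int (card V) = round ((real n + 3)\<^sup>2 / 12))"
proof (intro conjI allI impI, goal_cases)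
  case (1 D V E n)
  then show ?case using vertices_le_round by blast
next
  case (2 n)
  then obtain D V E where "large_lattice_disc n D V E" using extremal_exists by blast
  then show ?case
    unfolding large_lattice_disc_def using vertices_le_round[of D V E n]
    by (intro exI[of _ D] exI[of _ V] exI[of _ E]) (simp add: order_antisym)
qed

end
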